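(* There exist constants $c,C>0$, depending only on the domain $\Omega$ and the shape-regularity parameter $\gamma$ (and not on $H$, $V_h$, the eigenvalues, $\ell$ or the coefficient $A$), such that for every $\ell\in\{1,2,\ldots,N_H\}$: if $$H\le c\,\ell^{-1/4}\sqrt{\frac{\alpha}{\lambda_h^{(\ell)}}},$$ then $$\frac{\lambda_H^{(\ell)}-\lambda_h^{(\ell)}}{\lambda_h^{(\ell)}}\le C\,\ell\left(\frac{\lambda_h^{(\ell)}}{\alpha}\right)^2H^4 .$$
   Context: Domain and coefficient. $\Omega\subset\mathbb{R}^d$ is a bounded polyhedral Lipschitz domain; $A\in L^\infty(\Omega,\mathbb{R}^{d\times d}_{\mathrm{sym}})$ is a symmetric matrix-valued coefficient whose spectrum satisfies $\sigma(A(x))\subset[\alpha,\beta]$ for almost all $x\in\Omega$, with $0<\alpha\le\beta<\infty$. Put $V:=H^1_0(\Omega)$, $a(u,v):=\int_\Omega (A\nabla u)\cdot\nabla v\,dx$, $(u,v)_{L^2(\Omega)}:=\int_\Omega uv\,dx$, $\|v\|:=(v,v)_{L^2(\Omega)}^{1/2}$. Mesh and finite element spaces. $\mathcal{T}_H$ is a regular (conforming, no hanging nodes, in the sense of Ciarlet) finite element mesh of $\Omega$ into closed simplices, $H>0$ denotes its maximal mesh size $\max_{T\in\mathcal{T}_H}\operatorname{diam}T$, and $\gamma:=\max_{T\in\mathcal{T}_H}\frac{\operatorname{diam}T}{\operatorname{diam}B_T}$, where $B_T$ is the largest ball contained in $T$. $V_H:=\{v\in V: v|_T\text{ is a polynomial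 of total degree}\le 1\ \forall T\in\mathcal{T}_H\}$; $\mathcal{N}_H$ is the set of interior vertices of $\mathcal{T}_H$; $\phi_z\in V_H$ ($z\in\mathcal{N}_H$) are the nodal (hat) basis functions; $N_H:=\dim V_H=|\mathcal{N}_H|$. $V_h$ is a (closed) subspace of $V$ with $V_H\subsetneq V_h\subseteq V$, typically a conforming finite element space on a refinement $\mathcal{T}_h$ of $\mathcal{T}_H$; only these inclusions are used. Quasi-interpolation. $\mathcal{I}_H:H^1_0(\Omega)\to V_H$ is defined by $\mathcal{I}_Hv:=\sum_{z\in\mathcal{N}_H}\frac{(v,\phi_z)_{L^2(\Omega)}}{(1,\phi_z)_{L^2(\Omega)}}\phi_z$. Fine and coarse spaces. $V_{\mathrm f}:=\{v\in V_h:\mathcal{I}_Hv=0\}$. $\mathcal{P}_{\mathrm f}:V_h\to V_{\mathrm f}$ is the $a$-orthogonal projection: $a(\mathcal{P}_{\mathrm f}v,w)=a(v,w)$ for all $w\in V_{\mathrm f}$. The coarse space is $V_{\mathrm c}:=(1-\mathcal{P}_{\mathrm f})V_H$; one has $\dim V_{\mathrm c}=N_H$. Eigenvalues. $0<\lambda_h^{(1)}\le\lambda_h^{(2)}\le\cdots$ are the eigenvalues, repeated according to multiplicity, of the problem: find $\lambda_h\in\mathbb{R}$ and $0\ne u_h\in V_h$ with $a(u_h,v)=\lambda_h(u_h,v)_{L^2(\Omega)}$ for all $v\in V_h$. $0<\lambda_H^{(1)}\le\cdots\le\lambda_H^{(N_H)}$ are the eigenvalues, repeated according to multiplicity, of the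 problem: find $\lambda_H\in\mathbb{R}$ and $0\ne u_{\mathrm c}\in V_{\mathrm c}$ with $a(u_{\mathrm c},v)=\lambda_H(u_{\mathrm c},v)_{L^2(\Omega)}$ for all $v\in V_{\mathrm c}$. *)

theory Defs
  imports "HOL-Analysis.Analysis"
begin

text \<open>
  Elements of \<open>L\<^sup>2(\<Omega>)\<close> and \<open>H\<^sup>1\<^sub>0(\<Omega>)\<close> are represented by functions on the whole space of which only
  the values on \<open>\<Omega>\<close>, up to null sets, matter. All sets of functions below that stand for subspaces
  of \<open>H\<^sup>1\<^sub>0(\<Omega>)\<close> contain every representative of each of their elements, while ``zero'',
  linear independence and dimension are understood modulo almost everywhere equality on \<open>\<Omega>\<close>.
\<close>

subsection \<open>Domain and coefficient\<close>

text \<open>Near every boundary point, \<open>\<Omega>\<close> is the strict epigraph, in some direction \<open>e\<close>, of a Lipschitz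
  function on the hyperplane orthogonal to \<open>e\<close>.\<close>
definition lipschitz_boundary :: "(real^'n) set \<Rightarrow> bool" where
  "lipschitz_boundary \<Omega> \<longleftrightarrow>
     (\<forall>x\<in>frontier \<Omega>. \<exists>U e g L. open U \<and> x \<in> U \<and> norm e = 1 \<and>
        L-lipschitz_on {w. e \<bullet> w = 0} (g :: real^'n \<Rightarrow> real) \<and>
        \<Omega> \<inter> U = {y\<in>U. g (y - (e \<bullet> y) *\<^sub>R e) < e \<bullet> y})"

definition polyhedral_lipschitz_domain :: "(real^'n) set \<Rightarrow> bool" where
  "polyhedral_lipschitz_domain \<Omega> \<longleftrightarrow>
     open \<Omega> \<and> connected \<Omega> \<and> \<Omega> \<noteq> {} \<and> bounded \<Omega> \<and> lipschitz_boundary \<Omega> \<and>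
     (\<exists>\<P>. finite \<P> \<and> (\<forall>P\<in>\<P>. polytope P) \<and> closure \<Omega> = \<Union>\<P>)"

text \<open>Real eigenvalues only; this is the whole spectrum for the symmetric matrices it is applied to.\<close>
definition mat_spectrum :: "real^'n^'n \<Rightarrow> real set" where
  "mat_spectrum M = {\<mu>. \<exists>v. v \<noteq> 0 \<and> M *v v = \<mu> *\<^sub>R v}"

definition admissible_coefficient ::
    "(real^'n) set \<Rightarrow> real \<Rightarrow> real \<Rightarrow> (real^'n \<Rightarrow> real^'n^'n) \<Rightarrow> bool" where
  "admissible_coefficient \<Omega> \<alpha> \<beta> A \<longleftrightarrow>
     0 < \<alpha> \<and> \<alpha> \<le> \<beta> \<and>
     A \<in> borel_measurable (lebesgue_on \<Omega>) \<and>
     (\<exists>M. AE x in lebesgue_on \<Omega>. norm (A x) \<le> M) \<and>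
     (AE x in lebesgue_on \<Omega>. transpose (A x) = A x) \<and>
     (AE x in lebesgue_on \<Omega>. mat_spectrum (A x) \<subseteq> {\<alpha>..\<beta>})"

subsection \<open>Sobolev spaces\<close>

definition partial_deriv :: "'n \<Rightarrow> (real^'n \<Rightarrow> real) \<Rightarrow> real^'n \<Rightarrow> real" where
  "partial_deriv i f x = frechet_derivative f (at x) (axis i 1)"

fun Ck :: "nat \<Rightarrow> (real^'n \<Rightarrow> real) \<Rightarrow> bool" where
  "Ck 0 f \<longleftrightarrow> continuous_on UNIV f"
| "Ck (Suc k) f \<longleftrightarrow> f differentiable_on UNIV \<and> (\<forall>i. Ck k (partial_deriv i f))"

definition test_functions :: "(real^'n) set \<Rightarrow> (real^'n \<Rightarrow> real) set" where
  "test_functions \<Omega> =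
     {\<phi>. (\<forall>k. Ck k \<phi>) \<and> compact (closure {x. \<phi> x \<noteq> 0}) \<and> closure {x. \<phi> x \<noteq> 0} \<subseteq> \<Omega>}"

definition L2 :: "(real^'n) set \<Rightarrow> (real^'n \<Rightarrow> 'b::euclidean_space) set" where
  "L2 \<Omega> = {f. f \<in> borel_measurable (lebesgue_on \<Omega>) \<and>
              integrable (lebesgue_on \<Omega>) (\<lambda>x. (norm (f x))\<^sup>2)}"

definition L2_inner :: "(real^'n) set \<Rightarrow> (real^'n \<Rightarrow> real) \<Rightarrow> (real^'n \<Rightarrow> real) \<Rightarrow> real" where
  "L2_inner \<Omega> u v = (LINT x|lebesgue_on \<Omega>. u x * v x)"

definition is_weak_gradient ::
    "(real^'n) set \<Rightarrow> (real^'n \<Rightarrow> real) \<Rightarrow> (real^'n \<Rightarrow> real^'n) \<Rightarrow> bool" where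
  "is_weak_gradient \<Omega> v g \<longleftrightarrow>
     (\<forall>\<phi>\<in>test_functions \<Omega>. \<forall>i.
        (LINT x|lebesgue_on \<Omega>. v x * partial_deriv i \<phi> x)
          = - (LINT x|lebesgue_on \<Omega>. g x $ i * \<phi> x))"

definition H1 :: "(real^'n) set \<Rightarrow> (real^'n \<Rightarrow> real) set" where
  "H1 \<Omega> = {v \<in> L2 \<Omega>. \<exists>g \<in> L2 \<Omega>. is_weak_gradient \<Omega> v g}"

text \<open>For \<open>v\<close> in \<open>H1 \<Omega>\<close> the weak gradient is unique up to null sets, and it is only used inside
  integrals, so the choice is immaterial.\<close>
definition weak_gradient :: "(real^'n) set \<Rightarrow> (real^'n \<Rightarrow> real) \<Rightarrow> real^'n \<Rightarrow> real^'n" where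
  "weak_gradient \<Omega> v = (SOME g. g \<in> L2 \<Omega> \<and> is_weak_gradient \<Omega> v g)"

definition H1_norm :: "(real^'n) set \<Rightarrow> (real^'n \<Rightarrow> real) \<Rightarrow> real" where
  "H1_norm \<Omega> v =
     sqrt ((LINT x|lebesgue_on \<Omega>. (v x)\<^sup>2) + (LINT x|lebesgue_on \<Omega>. (norm (weak_gradient \<Omega> v x))\<^sup>2))"

definition H1_tendsto ::
    "(real^'n) set \<Rightarrow> (nat \<Rightarrow> real^'n \<Rightarrow> real) \<Rightarrow> (real^'n \<Rightarrow> real) \<Rightarrow> bool" where
  "H1_tendsto \<Omega> s v \<longleftrightarrow> (\<lambda>k. H1_norm \<Omega> (\<lambda>x. s k x - v x)) \<longlonglongrightarrow> 0"

definition H10 :: "(real^'n) set \<Rightarrow> (real^'n \<Rightarrow> real) set" where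
  "H10 \<Omega> = {v \<in> H1 \<Omega>. \<exists>\<phi>. (\<forall>k. \<phi> k \<in> test_functions \<Omega>) \<and> H1_tendsto \<Omega> \<phi> v}"

definition closed_subspace_H10 :: "(real^'n) set \<Rightarrow> (real^'n \<Rightarrow> real) set \<Rightarrow> bool" where
  "closed_subspace_H10 \<Omega> W \<longleftrightarrow>
     W \<subseteq> H10 \<Omega> \<and> (\<lambda>x. 0) \<in> W \<and>
     (\<forall>u\<in>W. \<forall>v\<in>W. (\<lambda>x. u x + v x) \<in> W) \<and>
     (\<forall>c. \<forall>v\<in>W. (\<lambda>x. c * v x) \<in> W) \<and>
     (\<forall>s. \<forall>v\<in>H10 \<Omega>. (\<forall>k. s k \<in> W) \<and> H1_tendsto \<Omega> s v \<longrightarrow> v \<in> W)"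

definition energy ::
    "(real^'n) set \<Rightarrow> (real^'n \<Rightarrow> real^'n^'n) \<Rightarrow> (real^'n \<Rightarrow> real) \<Rightarrow> (real^'n \<Rightarrow> real) \<Rightarrow> real" where
  "energy \<Omega> A u v =
     (LINT x|lebesgue_on \<Omega>. (A x *v weak_gradient \<Omega> u x) \<bullet> weak_gradient \<Omega> v x)"

subsection \<open>Mesh and finite element space\<close>

text \<open>\<^const>\<open>triangulation\<close> says that the family is finite and that any two members meet in a common,
  possibly empty, face (no hanging nodes).\<close>
definition simplicial_mesh :: "(real^'n) set \<Rightarrow> (real^'n) set set \<Rightarrow> bool" where
  "simplicial_mesh \<Omega> \<T> \<longleftrightarrow>
     triangulation \<T> \<and> (\<forall>T\<in>\<T>. int CARD('n) simplex T) \<and> \<Union>\<T> = closure \<Omega>"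

definition mesh_size :: "(real^'n) set set \<Rightarrow> real" where
  "mesh_size \<T> = Max (diameter ` \<T>)"

definition inball_diameter :: "(real^'n) set \<Rightarrow> real" where
  "inball_diameter T = Sup {diameter (cball p r) | p r. 0 \<le> r \<and> cball p r \<subseteq> T}"

definition shape_parameter :: "(real^'n) set set \<Rightarrow> real" where
  "shape_parameter \<T> = Max ((\<lambda>T. diameter T / inball_diameter T) ` \<T>)"

definition mesh_vertices :: "(real^'n) set set \<Rightarrow> (real^'n) set" where
  "mesh_vertices \<T> = {z. \<exists>T\<in>\<T>. z extreme_point_of T}"

definition interior_vertices :: "(real^'n) set \<Rightarrow> (real^'n) set set \<Rightarrow> (real^'n) set" where
  "interior_vertices \<Omega> \<T> = mesh_vertices \<T> \<inter> \<Omega>"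

definition P1_space :: "(real^'n) set \<Rightarrow> (real^'n) set set \<Rightarrow> (real^'n \<Rightarrow> real) set" where
  "P1_space \<Omega> \<T> =
     {v \<in> H10 \<Omega>. \<forall>T\<in>\<T>. \<exists>p q. AE x in lebesgue_on T. v x = p \<bullet> x + q}"

text \<open>The values outside the mesh are fixed to make the hat function unique.\<close>
definition hat_function :: "(real^'n) set set \<Rightarrow> real^'n \<Rightarrow> real^'n \<Rightarrow> real" where
  "hat_function \<T> z =
     (THE \<phi>. (\<forall>T\<in>\<T>. \<exists>p q. \<forall>x\<in>T. \<phi> x = p \<bullet> x + q) \<and>
             (\<forall>y\<in>mesh_vertices \<T>. \<phi> y = (if y = z then 1 else 0)) \<and>
             (\<forall>x. x \<notin> \<Union>\<T> \<longrightarrow> \<phi> x = 0))"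

definition quasi_interpolation ::
    "(real^'n) set \<Rightarrow> (real^'n) set set \<Rightarrow> (real^'n \<Rightarrow> real) \<Rightarrow> real^'n \<Rightarrow> real" where
  "quasi_interpolation \<Omega> \<T> v =
     (\<lambda>x. \<Sum>z\<in>interior_vertices \<Omega> \<T>.
        L2_inner \<Omega> v (hat_function \<T> z) / L2_inner \<Omega> (\<lambda>_. 1) (hat_function \<T> z) * hat_function \<T> z x)"

subsection \<open>Fine and coarse spaces\<close>

definition fine_space ::
    "(real^'n) set \<Rightarrow> (real^'n) set set \<Rightarrow> (real^'n \<Rightarrow> real) set \<Rightarrow> (real^'n \<Rightarrow> real) set" where
  "fine_space \<Omega> \<T> Vh =
     {v \<in> Vh. AE x in lebesgue_on \<Omega>. quasi_interpolation \<Omega> \<T> v x = 0}"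

text \<open>\<open>w\<close> is (a representative of) the energy-orthogonal projection of \<open>v\<close> onto \<open>W\<close>; stated as a
  relation since \<open>w\<close> is only determined up to null sets.\<close>
definition is_energy_projection ::
    "(real^'n) set \<Rightarrow> (real^'n \<Rightarrow> real^'n^'n) \<Rightarrow> (real^'n \<Rightarrow> real) set
      \<Rightarrow> (real^'n \<Rightarrow> real) \<Rightarrow> (real^'n \<Rightarrow> real) \<Rightarrow> bool" where
  "is_energy_projection \<Omega> A W v w \<longleftrightarrow>
     w \<in> W \<and> (\<forall>w'\<in>W. energy \<Omega> A w w' = energy \<Omega> A v w')"

definition coarse_space ::
    "(real^'n) set \<Rightarrow> (real^'n \<Rightarrow> real^'n^'n) \<Rightarrow> (real^'n) set set
      \<Rightarrow> (real^'n \<Rightarrow> real) set \<Rightarrow> (real^'n \<Rightarrow> real) set" where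
  "coarse_space \<Omega> A \<T> Vh =
     {(\<lambda>x. v x - w x) | v w.
        v \<in> P1_space \<Omega> \<T> \<and> is_energy_projection \<Omega> A (fine_space \<Omega> \<T> Vh) v w}"

subsection \<open>Eigenvalues\<close>

text \<open>\<open>W\<close> has a basis of \<open>m\<close> elements modulo almost everywhere equality on \<open>\<Omega>\<close>.\<close>
definition has_ae_dimension :: "(real^'n) set \<Rightarrow> (real^'n \<Rightarrow> real) set \<Rightarrow> nat \<Rightarrow> bool" where
  "has_ae_dimension \<Omega> W m \<longleftrightarrow>
     (\<exists>b. (\<forall>i<m. b i \<in> W) \<and>
        (\<forall>c. (AE x in lebesgue_on \<Omega>. (\<Sum>i<m. c i * b i x) = 0) \<longrightarrow> (\<forall>i<m. c i = 0)) \<and>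
        (\<forall>w\<in>W. \<exists>c. AE x in lebesgue_on \<Omega>. w x = (\<Sum>i<m. c i * b i x)))"

text \<open>The eigenfunctions for \<open>\<mu>\<close> together with zero, so \<open>\<mu>\<close> is an eigenvalue iff this space
  does not have dimension \<open>0\<close>.\<close>
definition eigenspace ::
    "(real^'n) set \<Rightarrow> (real^'n \<Rightarrow> real^'n^'n) \<Rightarrow> (real^'n \<Rightarrow> real) set
      \<Rightarrow> real \<Rightarrow> (real^'n \<Rightarrow> real) set" where
  "eigenspace \<Omega> A W \<mu> = {u \<in> W. \<forall>v\<in>W. energy \<Omega> A u v = \<mu> * L2_inner \<Omega> u v}"

text \<open>Eigenvalues are numbered from \<open>1\<close> up to the dimension of \<open>W\<close>, or without end if \<open>W\<close> is
  infinite-dimensional.\<close>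
definition eigenvalue_indices :: "(real^'n) set \<Rightarrow> (real^'n \<Rightarrow> real) set \<Rightarrow> nat set" where
  "eigenvalue_indices \<Omega> W = {k. 1 \<le> k \<and> (\<forall>m. has_ae_dimension \<Omega> W m \<longrightarrow> k \<le> m)}"

text \<open>\<open>ev\<close> lists the eigenvalues on \<open>W\<close> in nondecreasing order, each \<open>\<mu>\<close> occurring exactly as often as
  its multiplicity, the dimension of its eigenspace (which is \<open>0\<close> if \<open>\<mu>\<close> is not an eigenvalue).
  Finiteness is needed because \<^const>\<open>card\<close> of an infinite set is \<open>0\<close>.\<close>
definition lists_eigenvalues ::
    "(real^'n) set \<Rightarrow> (real^'n \<Rightarrow> real^'n^'n) \<Rightarrow> (real^'n \<Rightarrow> real) set \<Rightarrow> (nat \<Rightarrow> real) \<Rightarrow> bool" where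
  "lists_eigenvalues \<Omega> A W ev \<longleftrightarrow>
     mono_on (eigenvalue_indices \<Omega> W) ev \<and>
     (\<forall>\<mu>. finite {k \<in> eigenvalue_indices \<Omega> W. ev k = \<mu>} \<and>
          has_ae_dimension \<Omega> (eigenspace \<Omega> A W \<mu>) (card {k \<in> eigenvalue_indices \<Omega> W. ev k = \<mu>}))"

end

theory Submission
  imports Defs
begin

text \<open>
  Let \<open>\<phi>\<^sub>z\<close> be the hat functions of the interior vertices. The fine space, the kernel of the
  quasi-interpolation in \<open>Vh\<close>, is the \<open>L\<^sup>2\<close>-orthogonal complement of their span. Assume that every
  \<open>v\<close> in \<open>H\<^sup>1\<^sub>0(\<Omega>)\<close> can be approximated in that span with an \<open>L\<^sup>2\<close> error of at most \<open>K H \<parallel>\<nabla>v\<parallel>\<close>. Then for \<open>f\<close> in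
  the fine space and any \<open>w\<close> the product \<open>(w, f)\<close> does not change if the approximation is subtracted
  from \<open>w\<close>, so it is at most \<open>K H \<parallel>\<nabla>w\<parallel> \<parallel>f\<parallel>\<close>. The case \<open>w = f\<close> gives \<open>\<parallel>f\<parallel> \<le> K H \<parallel>\<nabla>f\<parallel>\<close>, hence
  \<open>\<bar>(w, f)\<bar> \<le> K\<^sup>2 H\<^sup>2 \<parallel>\<nabla>w\<parallel> \<parallel>\<nabla>f\<parallel>\<close>. For a combination \<open>u\<close> of the first
  \<open>l\<close> eigenfunctions this shows that its fine part \<open>P\<^sub>f u\<close>, the energy projection to the fine space, has energy norm of order \<open>H\<^sup>2\<close> and that
  \<open>(u, P\<^sub>f u)\<close> is of order \<open>H\<^sup>4\<close>. The functions \<open>u - P\<^sub>f u\<close> form an \<open>l\<close>-dimensional subspace of the coarse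
  space on which the Rayleigh quotient is at most \<open>lam_h l\<close> times \<open>1 + O(H\<^sup>4)\<close>, and the min-max
  principle gives the claim. This argument is \<open>two_level_eigenvalue_bound\<close>; it is carried out for
  two semi-inner products on a space of functions, with the energy projection obtained from the
  parallelogram law (\<open>orthogonal_projection_exists\<close>).

  The approximation property (\<open>uniform_interpolation_error\<close>) has to hold with a constant that is
  uniform over all meshes. For a test function \<open>\<phi>\<close> the nodal value at \<open>z\<close> is taken to be the mean of \<open>\<phi>\<close> over a
  ball of radius \<open>\<theta> H\<close> near \<open>z\<close>, with \<open>H\<close> the global mesh size. A Lipschitz domain has, near
  each boundary point and on every scale up to its diameter, an exterior ball of comparable radius
  (\<open>uniform_exterior_ball\<close>); choosing such a ball at a boundary vertex makes the nodal value
  zero. The hat functions form a partition of unity, so the error at \<open>x\<close> is bounded by a mean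
  of differences \<open>\<phi>(x + s) - \<phi>(x)\<close> with \<open>\<bar>s\<bar> \<le> 2 H\<close>, and the \<open>L\<^sup>2\<close> norm of a difference of
  translates is at most \<open>\<bar>s\<bar> \<parallel>\<nabla>\<phi>\<parallel>\<close> (\<open>translation_estimate\<close>).

  The remaining work connects this with the concrete spaces. Weak gradients are unique by the
  fundamental lemma of the calculus of variations, so that \<open>H\<^sup>1\<^sub>0(\<Omega>)\<close> is the closure of the graph of the
  gradient on test functions (\<open>H10_pair\<close>). The hat functions belong to it
  (\<open>hat_H10_pair\<close>): the set where one of them is positive is open, since a homothety about the
  vertex contracts it into a neighbourhood of the vertex, and therefore it is contained in
  the domain; mollified cut-offs then approximate the function, with gradients converging by
  dominated convergence. Coercivity follows from the spectral bound on the coefficient by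
  minimizing the Rayleigh quotient of a matrix.
\<close>

section \<open>Semi-inner products and dimension\<close>

text \<open>Elimination of one unknown with the help of one equation. Every dimension count below is an
  application of this fact to a matrix of inner products or of coefficients.\<close>
lemma homogeneous_system_nontrivial_solution:
  fixes G :: "'i \<Rightarrow> 'j \<Rightarrow> real"
  assumes "finite I" "finite J" "card I < card J"
  shows "\<exists>x. (\<exists>j\<in>J. x j \<noteq> 0) \<and> (\<forall>i\<in>I. (\<Sum>j\<in>J. x j * G i j) = 0)"
  using assms
proof (induction I arbitrary: J G rule: finite_induct)
  case empty
  then obtain j where "j \<in> J" by fastforce
  then show ?case by (intro exI[of _ "\<lambda>_. 1"]) auto
next
  case (insert i0 I)
  show ?case
  proof (cases "\<forall>j\<in>J. G i0 j = 0")
    case True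
    have "card I < card J" using insert by simp
    from insert.IH[OF insert.prems(1) this, of G] True show ?thesis by auto
  next
    case False
    then obtain p where p: "p \<in> J" "G i0 p \<noteq> 0" by auto
    define G' where "G' i j = G i j - G i p * G i0 j / G i0 p" for i j
    have "card I < card (J - {p})" using insert p by (simp add: card_Diff_singleton)
    from insert.IH[OF _ this, of G'] insert.prems obtain y where
      y: "\<exists>j\<in>J - {p}. y j \<noteq> 0" "\<And>i. i \<in> I \<Longrightarrow> (\<Sum>j\<in>J-{p}. y j * G' i j) = 0" by auto
    define s where "s = (\<Sum>j\<in>J-{p}. y j * G i0 j)"
    define x where "x = y(p := - s / G i0 p)"
    have split: "(\<Sum>j\<in>J. x j * G i j) = - s / G i0 p * G i p + (\<Sum>j\<in>J-{p}. y j * G i j)" for i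
      using insert.prems(1) p(1) by (subst sum.remove[of J p]) (auto simp: x_def)
    have "(\<Sum>j\<in>J. x j * G i0 j) = 0"
      unfolding split using p by (simp add: s_def)
    moreover have "(\<Sum>j\<in>J. x j * G i j) = 0" if "i \<in> I" for i
    proof -
      have "0 = (\<Sum>j\<in>J-{p}. y j * G i j - G i p / G i0 p * (y j * G i0 j))"
        using y(2)[OF that] by (simp add: G'_def algebra_simps)
      also have "\<dots> = (\<Sum>j\<in>J-{p}. y j * G i j) - G i p / G i0 p * s"
        by (simp add: sum_subtractf sum_distrib_left s_def)
      finally show ?thesis unfolding split by simp
    qed
    moreover have "\<exists>j\<in>J. x j \<noteq> 0" using y(1) by (auto simp: x_def)
    ultimately show ?thesis by (intro exI[of _ x]) auto
  qed
qed

definition lincomb :: "'i set \<Rightarrow> ('i \<Rightarrow> real) \<Rightarrow> ('i \<Rightarrow> 'x \<Rightarrow> real) \<Rightarrow> 'x \<Rightarrow> real" where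
  "lincomb I c f = (\<lambda>x. \<Sum>i\<in>I. c i * f i x)"

definition lin_closed :: "('x \<Rightarrow> real) set \<Rightarrow> bool" where
  "lin_closed W \<longleftrightarrow> (\<lambda>x. 0) \<in> W \<and> (\<forall>u\<in>W. \<forall>v\<in>W. (\<lambda>x. u x + v x) \<in> W) \<and>
     (\<forall>c. \<forall>v\<in>W. (\<lambda>x. c * v x) \<in> W)"

lemma lin_closedD:
  assumes "lin_closed W"
  shows "(\<lambda>x. 0) \<in> W" "u \<in> W \<Longrightarrow> v \<in> W \<Longrightarrow> (\<lambda>x. u x + v x) \<in> W" "v \<in> W \<Longrightarrow> (\<lambda>x. c * v x) \<in> W"
  using assms by (auto simp: lin_closed_def)

lemma lin_closed_diff:
  assumes "lin_closed W" "u \<in> W" "v \<in> W" shows "(\<lambda>x. u x - v x) \<in> W"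
  using lin_closedD(2)[OF assms(1,2) lin_closedD(3)[OF assms(1,3), of "-1"]] by simp

lemma lin_closed_lincomb:
  assumes "lin_closed W" "finite I" "\<And>i. i \<in> I \<Longrightarrow> f i \<in> W" shows "lincomb I c f \<in> W"
  using assms(2,3)
proof (induction I rule: finite_induct)
  case empty then show ?case using lin_closedD(1)[OF assms(1)] by (simp add: lincomb_def)
next
  case (insert i I)
  have "(\<lambda>x. c i * f i x + lincomb I c f x) \<in> W"
    by (rule lin_closedD(2)[OF assms(1)]) (use insert lin_closedD(3)[OF assms(1)] in auto)
  then show ?case using insert by (simp add: lincomb_def)
qed

text \<open>Functions that are equal almost everywhere are kept apart as functions, so an inner product is
  only semidefinite. Statements about the quotient by the null functions are expressed through the
  form itself.\<close>
locale semi_inner =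
  fixes V :: "('x \<Rightarrow> real) set" and b :: "('x \<Rightarrow> real) \<Rightarrow> ('x \<Rightarrow> real) \<Rightarrow> real"
  assumes V: "lin_closed V"
    and add_left: "\<And>u v w. u \<in> V \<Longrightarrow> v \<in> V \<Longrightarrow> w \<in> V \<Longrightarrow> b (\<lambda>x. u x + v x) w = b u w + b v w"
    and scale_left: "\<And>c u w. u \<in> V \<Longrightarrow> w \<in> V \<Longrightarrow> b (\<lambda>x. c * u x) w = c * b u w"
    and sym: "\<And>u w. u \<in> V \<Longrightarrow> w \<in> V \<Longrightarrow> b u w = b w u"
    and nonneg: "\<And>u. u \<in> V \<Longrightarrow> 0 \<le> b u u"
begin

lemmas V_zero = lin_closedD(1)[OF V] and V_add = lin_closedD(2)[OF V] and V_scale = lin_closedD(3)[OF V]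
  and V_diff = lin_closed_diff[OF V] and V_lincomb = lin_closed_lincomb[OF V]

lemma diff_left: "u \<in> V \<Longrightarrow> v \<in> V \<Longrightarrow> w \<in> V \<Longrightarrow> b (\<lambda>x. u x - v x) w = b u w - b v w"
  using add_left[of u "\<lambda>x. -1 * v x" w] scale_left[of v w "-1"] V_scale[of v "-1"] by simp

lemma diff_right: "u \<in> V \<Longrightarrow> v \<in> V \<Longrightarrow> w \<in> V \<Longrightarrow> b w (\<lambda>x. u x - v x) = b w u - b w v"
  using diff_left[of u v w] sym[of w] V_diff by (metis (no_types, lifting))

lemma add_right: "u \<in> V \<Longrightarrow> v \<in> V \<Longrightarrow> w \<in> V \<Longrightarrow> b w (\<lambda>x. u x + v x) = b w u + b w v"
  using add_left[of u v w] sym[of w] V_add by (metis (no_types, lifting))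

lemma scale_right: "u \<in> V \<Longrightarrow> w \<in> V \<Longrightarrow> b w (\<lambda>x. c * u x) = c * b w u"
  using scale_left[of u w c] sym[of w] V_scale by (metis (no_types, lifting))

lemma lincomb_left:
  assumes "finite I" "\<And>i. i \<in> I \<Longrightarrow> f i \<in> V" "w \<in> V"
  shows "b (lincomb I c f) w = (\<Sum>i\<in>I. c i * b (f i) w)"
  using assms(1,2)
proof (induction I rule: finite_induct)
  case empty
  have "b (\<lambda>x. 0 * 0) w = 0" using scale_left[of "\<lambda>x. 0" w 0] V_zero assms(3) by simp
  then show ?case by (simp add: lincomb_def)
next
  case (insert i I)
  have eq: "lincomb (insert i I) c f = (\<lambda>x. c i * f i x + lincomb I c f x)"
    using insert by (simp add: lincomb_def)
  show ?case unfolding eq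
    using insert V_lincomb[of I f c] assms(3) V_scale[of "f i" "c i"]
    by (subst add_left) (auto simp: scale_left)
qed

lemma lincomb_right:
  assumes "finite I" "\<And>i. i \<in> I \<Longrightarrow> f i \<in> V" "w \<in> V"
  shows "b w (lincomb I c f) = (\<Sum>i\<in>I. c i * b w (f i))"
proof -
  have "b w (lincomb I c f) = b (lincomb I c f) w"
    by (rule sym) (auto intro: V_lincomb assms)
  also have "\<dots> = (\<Sum>i\<in>I. c i * b (f i) w)" by (rule lincomb_left) (use assms in auto)
  also have "\<dots> = (\<Sum>i\<in>I. c i * b w (f i))"
    by (rule sum.cong) (use sym assms in auto)
  finally show ?thesis .
qed

lemma diff_square: "u \<in> V \<Longrightarrow> v \<in> V \<Longrightarrow> b (\<lambda>x. u x - v x) (\<lambda>x. u x - v x) = b u u - 2 * b u v + b v v"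
  using diff_left[of u v "\<lambda>x. u x - v x"] diff_right[of u v u] diff_right[of u v v] V_diff[of u v] sym[of u v]
  by simp

lemma add_square: "u \<in> V \<Longrightarrow> v \<in> V \<Longrightarrow> b (\<lambda>x. u x + v x) (\<lambda>x. u x + v x) = b u u + 2 * b u v + b v v"
  using add_left[of u v "\<lambda>x. u x + v x"] add_right[of u v u] add_right[of u v v] V_add[of u v] sym[of u v]
  by simp

lemma cauchy_schwarz:
  assumes "u \<in> V" "v \<in> V" shows "(b u v)\<^sup>2 \<le> b u u * b v v"
proof -
  have q: "0 \<le> b u u - 2 * t * b u v + t\<^sup>2 * b v v" for t
  proof -
    have tv: "(\<lambda>x. t * v x) \<in> V" using V_scale assms by auto
    have "0 \<le> b (\<lambda>x. u x - t * v x) (\<lambda>x. u x - t * v x)"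
      using V_diff[OF assms(1) tv] by (rule nonneg)
    also have "\<dots> = b u u - 2 * b u (\<lambda>x. t * v x) + b (\<lambda>x. t * v x) (\<lambda>x. t * v x)"
      by (rule diff_square) (use assms tv in auto)
    also have "\<dots> = b u u - 2 * t * b u v + t\<^sup>2 * b v v"
      using assms tv by (simp add: scale_right scale_left power2_eq_square)
    finally show ?thesis .
  qed
  show ?thesis
  proof (cases "b v v = 0")
    case True
    have "b u v = 0"
    proof (rule ccontr)
      assume nz: "b u v \<noteq> 0"
      show False using q[of "(b u u + 1) / (2 * b u v)"] True nz by (simp add: field_simps)
    qed
    then show ?thesis using True by simp
  next
    case False
    then have pos: "b v v > 0" using nonneg[OF assms(2)] by simp
    have "0 \<le> b u u - (b u v)\<^sup>2 / b v v"
      using q[of "b u v / b v v"] pos by (simp add: power2_eq_square field_simps)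
    then show ?thesis using pos by (simp add: field_simps)
  qed
qed

lemma null_left: "u \<in> V \<Longrightarrow> v \<in> V \<Longrightarrow> b u u = 0 \<Longrightarrow> b u v = 0"
  using cauchy_schwarz[of u v] by simp

text \<open>By the parallelogram law two elements of \<open>F\<close> at nearly minimal distance from \<open>u\<close> are close to
  each other. So a sequence whose distances converge fast enough to the infimum is Cauchy with a
  geometric rate, and completeness along such sequences is all that is asked of \<open>F\<close>.\<close>
lemma orthogonal_projection_exists:
  assumes F: "lin_closed F" "F \<subseteq> V" and u: "u \<in> V"
    and complete: "\<And>s. (\<And>k. s k \<in> F) \<Longrightarrow>
        (\<And>k. b (\<lambda>x. s (Suc k) x - s k x) (\<lambda>x. s (Suc k) x - s k x) \<le> ((1/2)^k)\<^sup>2) \<Longrightarrow>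
        \<exists>w\<in>F. (\<lambda>k. b (\<lambda>x. s k x - w x) (\<lambda>x. s k x - w x)) \<longlonglongrightarrow> 0"
  shows "\<exists>w\<in>F. \<forall>w'\<in>F. b w w' = b u w'"
proof -
  define J where "J w = b (\<lambda>x. u x - w x) (\<lambda>x. u x - w x)" for w
  have FV: "w \<in> F \<Longrightarrow> w \<in> V" for w using F by auto
  define d where "d = Inf (J ` F)"
  have bdd: "bdd_below (J ` F)"
    by (rule bdd_belowI2[of _ 0]) (unfold J_def, intro nonneg V_diff u FV)
  have dle: "d \<le> J w" if "w \<in> F" for w unfolding d_def by (rule cInf_lower) (use bdd that in auto)
  have ne: "J ` F \<noteq> {}" using lin_closedD(1)[OF F(1)] by auto
  have "\<exists>w\<in>F. J w < d + ((1/2)^k)\<^sup>2 / 4" for k :: nat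
  proof -
    have "Inf (J ` F) < d + ((1/2)^k)\<^sup>2 / 4" by (simp add: d_def)
    then show ?thesis using cInf_lessD[OF ne] by auto
  qed
  then obtain s where s: "\<And>k. s k \<in> F" "\<And>k. J (s k) < d + ((1/2)^k)\<^sup>2 / 4" by metis
  have par: "b (\<lambda>x. w x - v x) (\<lambda>x. w x - v x) \<le> 2 * (J w - d) + 2 * (J v - d)"
    if "w \<in> F" "v \<in> F" for w v
  proof -
    define p where "p = (\<lambda>x. u x - w x)"
    define q where "q = (\<lambda>x. u x - v x)"
    have pq: "p \<in> V" "q \<in> V" unfolding p_def q_def using that FV u V_diff by auto
    define h where "h = (\<lambda>x. (1/2) * (w x + v x))"
    have h: "h \<in> F" unfolding h_def using that lin_closedD(2,3)[OF F(1)] by blast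
    have "J h = b (\<lambda>x. (1/2) * (p x + q x)) (\<lambda>x. (1/2) * (p x + q x))"
      unfolding J_def h_def p_def q_def by (simp add: field_simps)
    also have "\<dots> = 1/4 * b (\<lambda>x. p x + q x) (\<lambda>x. p x + q x)"
      using V_add[OF pq] by (simp only: scale_left scale_right V_scale)
    finally have Jh: "4 * J h = b p p + 2 * b p q + b q q" using add_square[OF pq] by simp
    have "b (\<lambda>x. w x - v x) (\<lambda>x. w x - v x) = b (\<lambda>x. q x - p x) (\<lambda>x. q x - p x)"
      unfolding p_def q_def by simp
    also have "\<dots> = b p p - 2 * b p q + b q q" using diff_square[OF pq(2,1)] sym[OF pq] by simp
    finally show ?thesis using Jh dle[OF h] by (simp add: J_def p_def q_def)
  qed
  have "b (\<lambda>x. s (Suc k) x - s k x) (\<lambda>x. s (Suc k) x - s k x) \<le> ((1/2)^k)\<^sup>2" for k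
  proof -
    define r r' :: real where "r = ((1/2)^k)\<^sup>2" and "r' = ((1/2)^Suc k)\<^sup>2"
    have "r' \<le> r" by (simp add: r_def r'_def power2_eq_square)
    moreover have "J (s k) < d + r / 4" "J (s (Suc k)) < d + r' / 4" using s(2) unfolding r_def r'_def by blast+
    moreover have "X \<le> r" if "X \<le> 2 * (p - d) + 2 * (q - d)" "r' \<le> r" "q < d + r / 4" "p < d + r' / 4"
      for X p q :: real using that by argo
    ultimately have "b (\<lambda>x. s (Suc k) x - s k x) (\<lambda>x. s (Suc k) x - s k x) \<le> r"
      using par[OF s(1)[of "Suc k"] s(1)[of k]] by blast
    then show ?thesis by (simp add: r_def)
  qed
  from complete[OF s(1) this] obtain w where w: "w \<in> F"
    and lim: "(\<lambda>k. b (\<lambda>x. s k x - w x) (\<lambda>x. s k x - w x)) \<longlonglongrightarrow> 0" by auto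
  have Jw: "J w \<le> d"
  proof -
    define e where "e k = b (\<lambda>x. s k x - w x) (\<lambda>x. s k x - w x)" for k
    have bound: "J w \<le> (d + ((1/2)^k)\<^sup>2/4) + 2 * sqrt ((d + ((1/2)^k)\<^sup>2/4) * e k) + e k" for k
    proof -
      define p where "p = (\<lambda>x. u x - s k x)"
      define q where "q = (\<lambda>x. s k x - w x)"
      have pq: "p \<in> V" "q \<in> V" unfolding p_def q_def using FV[OF s(1)] FV[OF w] u V_diff by auto
      have "J w = b (\<lambda>x. p x + q x) (\<lambda>x. p x + q x)" by (simp add: J_def p_def q_def)
      also have "\<dots> = b p p + 2 * b p q + b q q" by (rule add_square[OF pq])
      also have "b p q \<le> sqrt (b p p * b q q)"
        using cauchy_schwarz[OF pq] by (simp add: real_le_rsqrt)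
      also have "sqrt (b p p * b q q) \<le> sqrt ((d + ((1/2)^k)\<^sup>2/4) * e k)"
        using s(2)[of k] nonneg[OF pq(2)] by (auto simp: J_def p_def q_def e_def intro!: mult_right_mono)
      finally show ?thesis using s(2)[of k] by (simp add: J_def p_def q_def e_def)
    qed
    have pw: "(\<lambda>k. ((1/2)^k)\<^sup>2/4::real) \<longlonglongrightarrow> 0"
      using tendsto_divide[OF tendsto_power[OF LIMSEQ_realpow_zero[of "1/2"], of 2] tendsto_const, of 4] by simp
    have "(\<lambda>k. (d + ((1/2)^k)\<^sup>2/4) + 2 * sqrt ((d + ((1/2)^k)\<^sup>2/4) * e k) + e k)
        \<longlonglongrightarrow> (d + 0) + 2 * sqrt ((d + 0) * 0) + 0"
      by (intro tendsto_intros pw) (use lim in \<open>simp_all add: e_def\<close>)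
    then show ?thesis using bound by (intro LIMSEQ_le_const[of _ d]) auto
  qed
  have "b w w' = b u w'" if w': "w' \<in> F" for w'
  proof -
    define p where "p = (\<lambda>x. u x - w x)"
    have pV: "p \<in> V" unfolding p_def using V_diff u FV w by auto
    have q: "0 \<le> - 2 * t * b p w' + t\<^sup>2 * b w' w'" for t
    proof -
      have tw: "(\<lambda>x. t * w' x) \<in> F" using lin_closedD(3)[OF F(1)] w' by auto
      have "J w \<le> J (\<lambda>x. w x + t * w' x)"
        by (rule order_trans[OF Jw dle]) (use lin_closedD(2)[OF F(1)] w tw in auto)
      also have "J (\<lambda>x. w x + t * w' x) = b (\<lambda>x. p x - t * w' x) (\<lambda>x. p x - t * w' x)"
        by (simp add: J_def p_def algebra_simps)
      also have "\<dots> = b p p - 2 * b p (\<lambda>x. t * w' x) + b (\<lambda>x. t * w' x) (\<lambda>x. t * w' x)"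
        by (rule diff_square) (use pV tw FV in auto)
      also have "\<dots> = b p p - 2 * t * b p w' + t\<^sup>2 * b w' w'"
        using FV[OF w'] FV[OF tw] pV by (simp add: scale_right scale_left power2_eq_square)
      finally show ?thesis by (simp add: J_def p_def)
    qed
    have "b p w' = 0"
    proof (rule ccontr)
      assume nz: "b p w' \<noteq> 0"
      have nn: "b w' w' \<ge> 0" using nonneg FV w' by auto
      define t where "t = b p w' / (b w' w' + 1)"
      have e: "b p w' = t * (b w' w' + 1)" using nn by (simp add: t_def)
      have "- 2 * t * b p w' + t\<^sup>2 * b w' w' = - (t\<^sup>2 * (b w' w' + 2))"
        unfolding e by (simp add: power2_eq_square algebra_simps)
      moreover have "t\<^sup>2 * (b w' w' + 2) > 0" using nz e nn by auto
      ultimately show False using q[of t] by linarith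
    qed
    then show ?thesis using diff_left[OF u FV[OF w] FV[OF w']] by (simp add: p_def)
  qed
  then show ?thesis using w by auto
qed

text \<open>The dimension of the image of \<open>W\<close> in the quotient by the null functions of the form.\<close>
definition has_dim :: "('x \<Rightarrow> real) set \<Rightarrow> nat \<Rightarrow> bool" where
  "has_dim W n \<longleftrightarrow> (\<exists>f. (\<forall>i<n. f i \<in> W) \<and>
      (\<forall>c. b (lincomb {..<n} c f) (lincomb {..<n} c f) = 0 \<longrightarrow> (\<forall>i<n. c i = 0)) \<and>
      (\<forall>w\<in>W. \<exists>c. b (\<lambda>x. w x - lincomb {..<n} c f x) (\<lambda>x. w x - lincomb {..<n} c f x) = 0))"

definition orthonormal :: "'i set \<Rightarrow> ('i \<Rightarrow> 'x \<Rightarrow> real) \<Rightarrow> bool" where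
  "orthonormal I e \<longleftrightarrow> (\<forall>i\<in>I. \<forall>j\<in>I. b (e i) (e j) = (if i = j then 1 else 0))"

lemma orthonormal_lincomb_square:
  assumes "finite I" "\<And>i. i \<in> I \<Longrightarrow> e i \<in> V" "orthonormal I e"
  shows "b (lincomb I c e) (lincomb I d e) = (\<Sum>i\<in>I. c i * d i)"
proof -
  have "b (lincomb I c e) (lincomb I d e) = (\<Sum>i\<in>I. c i * b (e i) (lincomb I d e))"
    by (rule lincomb_left) (use assms V_lincomb in auto)
  also have "\<dots> = (\<Sum>i\<in>I. c i * d i)"
  proof (rule sum.cong[OF refl])
    fix i assume i: "i \<in> I"
    have "b (e i) (lincomb I d e) = (\<Sum>j\<in>I. d j * b (e i) (e j))"
      by (rule lincomb_right) (use assms i in auto)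
    also have "\<dots> = (\<Sum>j\<in>I. if i = j then d j else 0)"
      by (rule sum.cong) (use assms(3) i in \<open>auto simp: orthonormal_def\<close>)
    also have "\<dots> = d i" using assms(1) i by simp
    finally show "c i * b (e i) (lincomb I d e) = c i * d i" by simp
  qed
  finally show ?thesis .
qed

text \<open>The coefficients of the \<open>g j\<close> with respect to a basis form a matrix with more columns than rows,
  whose kernel gives a null combination.\<close>
lemma independent_card_le_dim:
  assumes W: "W \<subseteq> V" "has_dim W n" and J: "finite J" "\<And>j. j \<in> J \<Longrightarrow> g j \<in> W"
    and ind: "\<And>c. b (lincomb J c g) (lincomb J c g) = 0 \<Longrightarrow> \<forall>j\<in>J. c j = 0"
  shows "card J \<le> n"
proof (rule ccontr)
  assume "\<not> card J \<le> n"
  then have lt: "card {..<n} < card J" by simp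
  from W(2) obtain f where f: "\<And>i. i < n \<Longrightarrow> f i \<in> W"
    and span: "\<And>w. w \<in> W \<Longrightarrow> \<exists>c. b (\<lambda>x. w x - lincomb {..<n} c f x) (\<lambda>x. w x - lincomb {..<n} c f x) = 0"
    unfolding has_dim_def by blast
  have "\<forall>j. \<exists>c. j \<in> J \<longrightarrow> b (\<lambda>x. g j x - lincomb {..<n} c f x) (\<lambda>x. g j x - lincomb {..<n} c f x) = 0"
    using span J(2) by blast
  then obtain C where C: "\<And>j. j \<in> J \<Longrightarrow> b (\<lambda>x. g j x - lincomb {..<n} (C j) f x) (\<lambda>x. g j x - lincomb {..<n} (C j) f x) = 0"
    by metis
  obtain x where x: "\<exists>j\<in>J. x j \<noteq> 0" "\<And>i. i < n \<Longrightarrow> (\<Sum>j\<in>J. x j * C j i) = 0"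
    using homogeneous_system_nontrivial_solution[OF _ J(1) lt, of "\<lambda>i j. C j i"] by auto
  define v where "v = lincomb J x g"
  have gV: "j \<in> J \<Longrightarrow> g j \<in> V" and fV: "i < n \<Longrightarrow> f i \<in> V" for i j using J f W by auto
  have vV: "v \<in> V" unfolding v_def using V_lincomb J gV by auto
  have "b v v = (\<Sum>j\<in>J. x j * b (g j) v)"
    unfolding v_def by (rule lincomb_left) (use J gV vV in \<open>auto simp: v_def\<close>)
  also have "\<dots> = (\<Sum>j\<in>J. x j * (\<Sum>i<n. C j i * b (f i) v))"
  proof (rule sum.cong[OF refl])
    fix j assume j: "j \<in> J"
    have L: "lincomb {..<n} (C j) f \<in> V" using V_lincomb fV by auto
    have "b (\<lambda>x. g j x - lincomb {..<n} (C j) f x) v = 0"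
      using null_left[OF V_diff[OF gV[OF j] L] vV C[OF j]] .
    then have "b (g j) v = b (lincomb {..<n} (C j) f) v" using diff_left[OF gV[OF j] L vV] by simp
    also have "\<dots> = (\<Sum>i<n. C j i * b (f i) v)" by (rule lincomb_left) (use fV vV in auto)
    finally show "x j * b (g j) v = x j * (\<Sum>i<n. C j i * b (f i) v)" by simp
  qed
  also have "\<dots> = (\<Sum>i<n. (\<Sum>j\<in>J. x j * C j i) * b (f i) v)"
    by (simp add: sum_distrib_left sum_distrib_right mult.assoc) (rule sum.swap)
  also have "\<dots> = 0" using x(2) by simp
  finally have "\<forall>j\<in>J. x j = 0" using ind[of x] by (simp add: v_def)
  then show False using x(1) by auto
qed

lemma orthonormal_extend:
  assumes W: "W \<subseteq> V" "lin_closed W" and w: "w \<in> W" "b w w \<noteq> 0"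
    and e: "\<And>i. i < n \<Longrightarrow> e i \<in> W" "orthonormal {..<n} e" and orth: "\<And>i. i < n \<Longrightarrow> b w (e i) = 0"
  shows "\<exists>e'. (\<forall>i<Suc n. e' i \<in> W) \<and> orthonormal {..<Suc n} e'"
proof -
  define q where "q = (\<lambda>x. (1 / sqrt (b w w)) * w x)"
  have pos: "b w w > 0" using nonneg[of w] w W by force
  have qW: "q \<in> W" unfolding q_def by (rule lin_closedD(3)[OF W(2) w(1)])
  have wV: "w \<in> V" using w W by auto
  have qq: "b q q = 1" unfolding q_def using pos wV V_scale[OF wV]
    by (simp only: scale_left scale_right) (simp add: power2_eq_square[symmetric] real_sqrt_mult_self)
  have qe: "b q (e i) = 0" "b (e i) q = 0" if "i < n" for i
  proof -
    have eV: "e i \<in> V" using e that W by auto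
    show "b q (e i) = 0" unfolding q_def by (subst scale_left[OF wV eV]) (simp add: orth[OF that])
    then show "b (e i) q = 0" using sym[of q "e i"] eV qW W by auto
  qed
  define e' where "e' = e(n := q)"
  have "orthonormal {..<Suc n} e'"
    unfolding orthonormal_def
    using e(2) qe qq by (auto simp: e'_def orthonormal_def less_Suc_eq)
  moreover have "\<forall>i<Suc n. e' i \<in> W" using e qW by (auto simp: e'_def)
  ultimately show ?thesis by blast
qed

text \<open>Given \<open>k < n\<close> orthonormal vectors, some nontrivial combination of the \<open>n\<close> basis vectors is
  orthogonal to all of them; normalized, it is the next vector.\<close>
lemma has_dim_orthonormal_family:
  assumes W: "W \<subseteq> V" "lin_closed W" "has_dim W n"
  shows "\<exists>e. (\<forall>i<n. e i \<in> W) \<and> orthonormal {..<n} e"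
proof -
  from W(3) obtain f where f: "\<And>i. i < n \<Longrightarrow> f i \<in> W"
    and ind: "\<And>c. b (lincomb {..<n} c f) (lincomb {..<n} c f) = 0 \<Longrightarrow> \<forall>i<n. c i = 0"
    unfolding has_dim_def by blast
  have "\<exists>e. (\<forall>i<k. e i \<in> W) \<and> orthonormal {..<k} e" if "k \<le> n" for k
    using that
  proof (induction k)
    case 0 show ?case by (simp add: orthonormal_def)
  next
    case (Suc k)
    then obtain e where e: "\<And>i. i < k \<Longrightarrow> e i \<in> W" "orthonormal {..<k} e" by auto
    have lt: "card {..<k} < card {..<n}" using Suc by simp
    from homogeneous_system_nontrivial_solution[OF _ _ lt, of "\<lambda>i j. b (f j) (e i)"]
    obtain x where x: "\<exists>j<n. x j \<noteq> 0" "\<And>i. i < k \<Longrightarrow> (\<Sum>j<n. x j * b (f j) (e i)) = 0" by auto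
    define w where "w = lincomb {..<n} x f"
    have "b w (e i) = 0" if "i < k" for i
      unfolding w_def using x(2)[OF that] f e(1)[OF that] W(1) by (subst lincomb_left) auto
    moreover have "w \<in> W" unfolding w_def using lin_closed_lincomb[OF W(2)] f by auto
    moreover have "b w w \<noteq> 0" using ind[of x] x(1) by (auto simp: w_def)
    ultimately show ?case using orthonormal_extend[OF W(1,2) _ _ e] by blast
  qed
  then show ?thesis by blast
qed

lemma orthonormal_imp_independent:
  assumes "finite I" "\<And>i. i \<in> I \<Longrightarrow> e i \<in> V" "orthonormal I e" "b (lincomb I c e) (lincomb I c e) = 0"
  shows "\<forall>i\<in>I. c i = 0"
proof -
  have "(\<Sum>i\<in>I. c i * c i) = 0" using assms orthonormal_lincomb_square[of I e c c] by simp
  then show ?thesis using assms(1) by (simp add: sum_nonneg_eq_0_iff)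
qed

text \<open>An orthonormal family of maximal length spans: otherwise the residual of the expansion of some
  \<open>w\<close> could be normalized and appended.\<close>
lemma bounded_orthonormal_families_imp_dim:
  fixes N :: nat
  assumes W: "W \<subseteq> V" "lin_closed W"
    and bound: "\<And>n e. (\<And>i. i < n \<Longrightarrow> e i \<in> W) \<Longrightarrow> orthonormal {..<n} e \<Longrightarrow> n \<le> N"
  shows "\<exists>n. has_dim W n"
proof -
  define P where "P n \<longleftrightarrow> (\<exists>e. (\<forall>i<n::nat. e i \<in> W) \<and> orthonormal {..<n} e)" for n
  have P0: "P 0" by (simp add: P_def orthonormal_def)
  have PN: "n \<le> N" if "P n" for n using that bound by (auto simp: P_def)
  define n where "n = (GREATEST n. P n)"
  have Pn: "P n" unfolding n_def by (rule GreatestI_nat[of P 0 N]) (use P0 PN in auto)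
  have max: "k \<le> n" if "P k" for k unfolding n_def by (rule Greatest_le_nat[of P k N]) (use that PN in auto)
  from Pn obtain e where e: "\<And>i. i < n \<Longrightarrow> e i \<in> W" "orthonormal {..<n} e" by (auto simp: P_def)
  have eV: "i < n \<Longrightarrow> e i \<in> V" for i using e W by auto
  have "has_dim W n" unfolding has_dim_def
  proof (intro exI[of _ e] conjI allI impI ballI)
    show "i < n \<Longrightarrow> e i \<in> W" for i using e by auto
    show "c i = 0" if "b (lincomb {..<n} c e) (lincomb {..<n} c e) = 0" "i < n" for c i
      using orthonormal_imp_independent[of "{..<n}" e c] that e eV by auto
    fix w assume w: "w \<in> W"
    define c where "c i = b w (e i)" for i
    define r where "r = (\<lambda>x. w x - lincomb {..<n} c e x)"
    have L: "lincomb {..<n} c e \<in> W" using lin_closed_lincomb[OF W(2)] e by auto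
    have rW: "r \<in> W" unfolding r_def using lin_closed_diff[OF W(2) w L] .
    have "b r (e i) = 0" if i: "i < n" for i
    proof -
      have "b (lincomb {..<n} c e) (e i) = (\<Sum>j<n. c j * b (e j) (e i))"
        by (rule lincomb_left) (use eV i in auto)
      also have "\<dots> = (\<Sum>j<n. if j = i then c j else 0)"
        by (rule sum.cong) (use e(2) i in \<open>auto simp: orthonormal_def\<close>)
      also have "\<dots> = c i" using i by simp
      finally show ?thesis unfolding r_def using diff_left[of w "lincomb {..<n} c e" "e i"] w L W eV i
        by (auto simp: c_def)
    qed
    then have "b r r = 0" using orthonormal_extend[OF W rW _ e] max[of "Suc n"] by (auto simp: P_def)
    then show "\<exists>c. b (\<lambda>x. w x - lincomb {..<n} c e x) (\<lambda>x. w x - lincomb {..<n} c e x) = 0"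
      by (auto simp: r_def)
  qed
  then show ?thesis by blast
qed

end

section \<open>Eigenvalues on a corrected coarse space\<close>

locale two_forms = L: semi_inner V m + E: semi_inner V a
  for V :: "('x \<Rightarrow> real) set" and m a :: "('x \<Rightarrow> real) \<Rightarrow> ('x \<Rightarrow> real) \<Rightarrow> real"
begin

definition eig :: "('x \<Rightarrow> real) set \<Rightarrow> real \<Rightarrow> ('x \<Rightarrow> real) set" where
  "eig W \<mu> = {u\<in>W. \<forall>v\<in>W. a u v = \<mu> * m u v}"

definition indices :: "('x \<Rightarrow> real) set \<Rightarrow> nat set" where
  "indices W = {k. 1 \<le> k \<and> (\<forall>n. L.has_dim W n \<longrightarrow> k \<le> n)}"

definition lists_eigs :: "('x \<Rightarrow> real) set \<Rightarrow> (nat \<Rightarrow> real) \<Rightarrow> bool" where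
  "lists_eigs W ev \<longleftrightarrow> mono_on (indices W) ev \<and>
     (\<forall>\<mu>. finite {k\<in>indices W. ev k = \<mu>} \<and> L.has_dim (eig W \<mu>) (card {k\<in>indices W. ev k = \<mu>}))"

lemma lin_closed_eig:
  assumes "lin_closed W" "W \<subseteq> V" shows "lin_closed (eig W \<mu>)"
proof -
  have WV: "w \<in> W \<Longrightarrow> w \<in> V" for w using assms by auto
  have z: "a (\<lambda>x. 0) v = 0" "m (\<lambda>x. 0) v = 0" if "v \<in> V" for v
    using E.scale_left[of "\<lambda>x. 0" v 0] L.scale_left[of "\<lambda>x. 0" v 0] L.V_zero that by auto
  show ?thesis
    unfolding lin_closed_def eig_def
    using lin_closedD[OF assms(1)]
    by (auto simp: z WV E.add_left L.add_left E.scale_left L.scale_left algebra_simps)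
qed

text \<open>The eigenspaces are mutually orthogonal, so orthonormal bases of them, indexed by the
  positions at which the eigenvalue is listed, fit together.\<close>
lemma orthonormal_eigenvectors:
  assumes W: "lin_closed W" "W \<subseteq> V" and ev: "lists_eigs W ev"
  obtains e where "\<And>k. k \<in> indices W \<Longrightarrow> e k \<in> eig W (ev k)" "L.orthonormal (indices W) e"
proof -
  define K where "K \<mu> = {k\<in>indices W. ev k = \<mu>}" for \<mu>
  have fin: "finite (K \<mu>)" and dim: "L.has_dim (eig W \<mu>) (card (K \<mu>))" for \<mu>
    using ev by (auto simp: lists_eigs_def K_def)
  have sub: "eig W \<mu> \<subseteq> V" for \<mu> using W(2) by (auto simp: eig_def)
  have "\<exists>f. (\<forall>i<card (K \<mu>). f i \<in> eig W \<mu>) \<and> L.orthonormal {..<card (K \<mu>)} f" for \<mu>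
    by (rule L.has_dim_orthonormal_family[OF sub lin_closed_eig[OF W] dim])
  then obtain f where f: "\<And>\<mu> i. i < card (K \<mu>) \<Longrightarrow> f \<mu> i \<in> eig W \<mu>"
      "\<And>\<mu>. L.orthonormal {..<card (K \<mu>)} (f \<mu>)" by metis
  have "\<exists>h. bij_betw h (K \<mu>) {..<card (K \<mu>)}" for \<mu>
    using ex_bij_betw_finite_nat[OF fin[of \<mu>]] by (simp add: atLeast0LessThan)
  then obtain h where h: "\<And>\<mu>. bij_betw (h \<mu>) (K \<mu>) {..<card (K \<mu>)}" by metis
  define e where "e k = f (ev k) (h (ev k) k)" for k
  have hk: "h (ev k) k < card (K (ev k))" if "k \<in> indices W" for k
    using bij_betwE[OF h[of "ev k"]] that by (auto simp: K_def)
  have ek: "e k \<in> eig W (ev k)" if "k \<in> indices W" for k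
    unfolding e_def using f(1) hk[OF that] .
  have "m (e k) (e l) = (if k = l then 1 else 0)" if k: "k \<in> indices W" and l: "l \<in> indices W" for k l
  proof (cases "ev k = ev l")
    case True
    have "h (ev k) k = h (ev k) l \<longleftrightarrow> k = l"
      using bij_betw_imp_inj_on[OF h[of "ev k"]] k l True by (auto simp: K_def inj_on_def)
    then show ?thesis using f(2)[of "ev k"] hk[OF k] hk[OF l] True
      by (auto simp: L.orthonormal_def e_def)
  next
    case False
    have V: "e k \<in> W" "e l \<in> W" "e k \<in> V" "e l \<in> V" using ek[OF k] ek[OF l] W(2) by (auto simp: eig_def)
    have "a (e k) (e l) = ev k * m (e k) (e l)" "a (e l) (e k) = ev l * m (e l) (e k)"
      using ek[OF k] ek[OF l] V by (auto simp: eig_def)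
    then have "ev k * m (e k) (e l) = ev l * m (e k) (e l)"
      using E.sym[OF V(3,4)] L.sym[OF V(3,4)] by metis
    then show ?thesis using False by auto
  qed
  then have "L.orthonormal (indices W) e" by (simp add: L.orthonormal_def)
  with ek that show ?thesis by blast
qed

lemma eigenvector_lincomb_energy:
  assumes W: "W \<subseteq> V" and I: "finite I" and e: "\<And>k. k \<in> I \<Longrightarrow> e k \<in> eig W (ev k)"
    and v: "v \<in> W"
  shows "a (lincomb I c e) v = m (lincomb I (\<lambda>k. c k * ev k) e) v"
proof -
  have eV: "k \<in> I \<Longrightarrow> e k \<in> V" for k using e W by (auto simp: eig_def)
  have "a (lincomb I c e) v = (\<Sum>k\<in>I. c k * a (e k) v)"
    by (rule E.lincomb_left) (use I eV v W in auto)
  also have "\<dots> = (\<Sum>k\<in>I. (c k * ev k) * m (e k) v)"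
    by (rule sum.cong) (use e v in \<open>auto simp: eig_def\<close>)
  also have "\<dots> = m (lincomb I (\<lambda>k. c k * ev k) e) v"
    by (rule L.lincomb_left[symmetric]) (use I eV v W in auto)
  finally show ?thesis .
qed

text \<open>Courant--Fischer, upper bound: an \<open>l\<close>-dimensional space of trial functions contains one
  that is orthogonal to the first \<open>l - 1\<close> eigenvectors.\<close>
lemma min_max_upper_bound:
  assumes W: "lin_closed W" "W \<subseteq> V" and ev: "lists_eigs W ev" and dim: "L.has_dim W n"
    and l: "1 \<le> l" and y: "\<And>k. k \<in> {1..l} \<Longrightarrow> y k \<in> W"
    and pos: "\<And>x. \<exists>k\<in>{1..l}. x k \<noteq> 0 \<Longrightarrow> m (lincomb {1..l} x y) (lincomb {1..l} x y) > 0"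
  shows "\<exists>x. (\<exists>k\<in>{1..l}. x k \<noteq> 0) \<and>
    ev l * m (lincomb {1..l} x y) (lincomb {1..l} x y) \<le> a (lincomb {1..l} x y) (lincomb {1..l} x y)"
proof -
  from orthonormal_eigenvectors[OF W ev] obtain e where
    e: "\<And>k. k \<in> indices W \<Longrightarrow> e k \<in> eig W (ev k)" and on: "L.orthonormal (indices W) e" by blast
  have subeig: "eig W \<mu> \<subseteq> W" for \<mu> by (auto simp: eig_def)
  have eW: "k \<in> indices W \<Longrightarrow> e k \<in> W" for k using e subeig by blast
  have eV: "k \<in> indices W \<Longrightarrow> e k \<in> V" for k using eW W by auto
  have card_le: "card I \<le> n" if "finite I" "\<And>i. i \<in> I \<Longrightarrow> f i \<in> W" "L.orthonormal I f" for I :: "nat set" and f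
    by (rule L.independent_card_le_dim[OF W(2) dim that(1,2) L.orthonormal_imp_independent])
       (use that W(2) in auto)
  have dim_eq: "k = n" if "L.has_dim W k" for k
  proof -
    have 1: "p \<le> q" if p: "L.has_dim W p" and q: "L.has_dim W q" for p q
    proof -
      obtain f where f: "\<And>i. i < p \<Longrightarrow> f i \<in> W" "L.orthonormal {..<p} f"
        using L.has_dim_orthonormal_family[OF W(2,1) p] by auto
      have "card {..<p} \<le> q"
        by (rule L.independent_card_le_dim[OF W(2) q, of _ f])
          (use L.orthonormal_imp_independent[of "{..<p}" f] f W(2) in auto)
      then show ?thesis by simp
    qed
    from 1[OF that dim] 1[OF dim that] show ?thesis by simp
  qed
  have "(\<forall>k. L.has_dim W k \<longrightarrow> j \<le> k) \<longleftrightarrow> j \<le> n" for j using dim dim_eq by metis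
  then have idx: "indices W = {1..n}" by (auto simp: indices_def)
  define I0 where "I0 = {k\<in>{1..n}. k < l}"
  have "card I0 \<le> card {1..<l}" unfolding I0_def by (rule card_mono) auto
  then have lt: "card I0 < card {1..l}" using l by simp
  from homogeneous_system_nontrivial_solution[OF _ _ lt, of "\<lambda>i j. m (y j) (e i)"]
  obtain x where x: "\<exists>k\<in>{1..l}. x k \<noteq> 0" "\<And>i. i \<in> I0 \<Longrightarrow> (\<Sum>j\<in>{1..l}. x j * m (y j) (e i)) = 0"
    by (auto simp: I0_def)
  define w where "w = lincomb {1..l} x y"
  have wW: "w \<in> W" unfolding w_def by (rule lin_closed_lincomb[OF W(1)]) (use y in auto)
  then have wV: "w \<in> V" using W by auto
  define t where "t k = m w (e k)" for k
  have t0: "t k = 0" if "k \<in> I0" for k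
    unfolding t_def w_def
    using x(2)[OF that] y W eV[unfolded idx] that by (subst L.lincomb_left) (auto simp: I0_def)
  define z where "z = lincomb {1..n} t e"
  have zW: "z \<in> W" unfolding z_def by (rule lin_closed_lincomb[OF W(1)]) (use eW idx in auto)
  then have zV: "z \<in> V" using W by auto
  define r where "r = (\<lambda>x. w x - z x)"
  have rW: "r \<in> W" unfolding r_def by (rule lin_closed_diff[OF W(1) wW zW])
  then have rV: "r \<in> V" using W by auto
  have mze: "m z (e k) = t k" if k: "k \<in> {1..n}" for k
  proof -
    have "m z (e k) = (\<Sum>j\<in>{1..n}. t j * m (e j) (e k))"
      unfolding z_def by (rule L.lincomb_left) (use eV idx k in auto)
    also have "\<dots> = (\<Sum>j\<in>{1..n}. if j = k then t j else 0)"
      by (rule sum.cong) (use on k in \<open>auto simp: L.orthonormal_def idx\<close>)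
    also have "\<dots> = t k" using k by simp
    finally show ?thesis .
  qed
  have re: "m r (e k) = 0" if "k \<in> {1..n}" for k
    unfolding r_def using L.diff_left[OF wV zV eV] mze[OF that] that idx by (simp add: t_def)
  have rr: "m r r = 0"
  proof (rule ccontr)
    assume nz: "m r r \<noteq> 0"
    have "\<exists>e'. (\<forall>i<Suc n. e' i \<in> W) \<and> L.orthonormal {..<Suc n} e'"
      by (rule L.orthonormal_extend[OF W(2,1) rW nz, of n "\<lambda>i. e (Suc i)"])
        (use eW idx on re in \<open>auto simp: L.orthonormal_def\<close>)
    then obtain e' where "\<And>i. i < Suc n \<Longrightarrow> e' i \<in> W" "L.orthonormal {..<Suc n} e'" by blast
    then show False using card_le[of "{..<Suc n}" e'] by auto
  qed
  have w_eq: "w = (\<lambda>x. z x + r x)" by (simp add: r_def)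
  have zr: "m r z = 0" using L.null_left[OF rV zV rr] .
  have mzz: "m z z = (\<Sum>k\<in>{1..n}. t k * t k)"
    unfolding z_def by (rule L.orthonormal_lincomb_square) (use eV on idx in auto)
  have mww: "m w w = (\<Sum>k\<in>{1..n}. t k * t k)"
    unfolding w_eq using L.add_square[OF zV rV] rr zr L.sym[OF rV zV] mzz by simp
  have azr: "a z v = m (lincomb {1..n} (\<lambda>k. t k * ev k) e) v" if "v \<in> W" for v
    unfolding z_def by (rule eigenvector_lincomb_energy[OF W(2)]) (use e idx that in auto)
  have LV: "lincomb {1..n} (\<lambda>k. t k * ev k) e \<in> V" by (rule L.V_lincomb) (use eV idx in auto)
  have "a z r = 0" using azr[OF rW] L.sym[OF rV LV] L.null_left[OF rV LV rr] by simp
  moreover have "a z z = (\<Sum>k\<in>{1..n}. (t k * ev k) * t k)"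
    unfolding azr[OF zW] unfolding z_def by (rule L.orthonormal_lincomb_square) (use eV on idx in auto)
  ultimately have aww: "a w w \<ge> (\<Sum>k\<in>{1..n}. (t k * ev k) * t k)"
    unfolding w_eq using E.add_square[OF zV rV] E.nonneg[OF rV] by simp
  have "l \<le> n"
  proof (rule ccontr)
    assume "\<not> l \<le> n"
    then have "m w w = 0" unfolding mww using t0 by (auto simp: I0_def intro!: sum.neutral)
    then show False using pos[OF x(1)] by (simp add: w_def)
  qed
  have "ev l * m w w = (\<Sum>k\<in>{1..n}. ev l * (t k * t k))" unfolding mww by (simp add: sum_distrib_left)
  also have "\<dots> \<le> (\<Sum>k\<in>{1..n}. (t k * ev k) * t k)"
  proof (rule sum_mono)
    fix k assume k: "k \<in> {1..n}"
    show "ev l * (t k * t k) \<le> (t k * ev k) * t k"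
    proof (cases "k < l")
      case True then show ?thesis using t0 k by (simp add: I0_def)
    next
      case False
      then have "ev l \<le> ev k" using ev k l \<open>l \<le> n\<close> by (auto simp: lists_eigs_def idx mono_on_def)
      then have "ev l * (t k * t k) \<le> ev k * (t k * t k)" by (rule mult_right_mono) auto
      then show ?thesis by (simp add: mult_ac)
    qed
  qed
  also have "\<dots> \<le> a w w" by (rule aww)
  finally show ?thesis using x(1) by (auto simp: w_def)
qed

text \<open>The fine part \<open>p = P u\<close> of a combination \<open>u\<close> of the first \<open>l\<close> eigenvectors is of second order.
  Indeed \<open>a p p = a u p = m w p\<close> with \<open>w\<close> the combination of the \<open>ev k\<close>-multiples of the eigenvectors,
  and for \<open>f\<close> in \<open>F\<close> one has \<open>(m w f)\<^sup>2 \<le> \<kappa>\<^sup>2 * a w w * a f f\<close>. Writing \<open>\<lambda>\<close> for \<open>ev l\<close> and taking \<open>m u u = 1\<close>,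
  this gives \<open>a p p \<le> \<kappa>\<^sup>2 * \<lambda>\<^sup>3\<close> and then \<open>\<bar>m u p\<bar> \<le> \<kappa>\<^sup>2 * \<lambda>\<^sup>2\<close>. The trial functions \<open>u - p\<close> belong to \<open>Vc\<close>, have energy
  \<open>a u u - a p p \<le> \<lambda>\<close> and squared norm at least \<open>1 - 2 * \<kappa>\<^sup>2 * \<lambda>\<^sup>2\<close>, and Courant--Fischer concludes.\<close>
theorem two_level_eigenvalue_bound:
  assumes Vh: "lin_closed Vh" "Vh \<subseteq> V" and VH: "lin_closed VH" "VH \<subseteq> Vh"
    and Z: "finite Z" "\<And>c. lincomb Z c \<psi> \<in> VH" "\<And>z. z \<in> Z \<Longrightarrow> \<psi> z \<in> Vh"
    and ind: "\<And>c. m (lincomb Z c \<psi>) (lincomb Z c \<psi>) = 0 \<Longrightarrow> \<forall>z\<in>Z. c z = 0"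
    and F: "F = {v\<in>Vh. \<forall>z\<in>Z. m v (\<psi> z) = 0}"
    and approx: "\<And>v. v \<in> Vh \<Longrightarrow> \<exists>c. m (\<lambda>x. v x - lincomb Z c \<psi> x) (\<lambda>x. v x - lincomb Z c \<psi> x) \<le> \<kappa> * a v v"
    and kap: "0 \<le> \<kappa>"
    and complete: "\<And>s. (\<And>k. s k \<in> F) \<Longrightarrow>
        (\<And>k. a (\<lambda>x. s (Suc k) x - s k x) (\<lambda>x. s (Suc k) x - s k x) \<le> ((1/2)^k)\<^sup>2) \<Longrightarrow>
        \<exists>w\<in>F. (\<lambda>k. a (\<lambda>x. s k x - w x) (\<lambda>x. s k x - w x)) \<longlonglongrightarrow> 0"
    and Vc: "Vc = {(\<lambda>x. v x - w x) | v w. v \<in> VH \<and> w \<in> F \<and> (\<forall>w'\<in>F. a w w' = a v w')}"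
    and ev: "lists_eigs Vh ev" and EV: "lists_eigs Vc EV"
    and l: "l \<in> {1..card Z}" and small: "2 * \<kappa>\<^sup>2 * (ev l)\<^sup>2 \<le> 1/2"
  shows "EV l - ev l \<le> 4 * \<kappa>\<^sup>2 * (ev l)\<^sup>2 * ev l"
proof -
  have VhV: "v \<in> Vh \<Longrightarrow> v \<in> V" for v using Vh by auto
  have FVh: "F \<subseteq> Vh" and FV: "F \<subseteq> V" using F VhV by auto
  have zV: "z \<in> Z \<Longrightarrow> \<psi> z \<in> V" for z using Z(3) VhV by auto
  have zero: "m (\<lambda>x. 0) v = 0" if "v \<in> V" for v
    using L.scale_left[of "\<lambda>x. 0" v 0] L.V_zero that by auto
  have Fl: "lin_closed F"
    unfolding lin_closed_def F using lin_closedD[OF Vh(1)]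
    by (auto simp: zero zV VhV L.add_left L.scale_left)
  have PV: "lincomb Z c \<psi> \<in> Vh" for c using Z(2) VH by auto
  have Forth: "m f (lincomb Z c \<psi>) = 0" if "f \<in> F" for f c
    using that F zV VhV by (subst L.lincomb_right) (auto intro: Z(1))
  \<comment> \<open>\<open>f\<close> is orthogonal to the span of the \<open>\<psi>\<close>, so \<open>w\<close> may be replaced by its approximation error;
    with \<open>w = f\<close> this bounds \<open>m f f\<close> by \<open>\<kappa> * a f f\<close>.\<close>
  have one: "(m w f)\<^sup>2 \<le> \<kappa> * a w w * m f f" if w: "w \<in> Vh" and f: "f \<in> F" for w f
  proof -
    obtain c where c: "m (\<lambda>x. w x - lincomb Z c \<psi> x) (\<lambda>x. w x - lincomb Z c \<psi> x) \<le> \<kappa> * a w w"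
      using approx[OF w] by auto
    have V': "w \<in> V" "f \<in> V" "lincomb Z c \<psi> \<in> V" using w f FV PV VhV by auto
    have "m w f = m (\<lambda>x. w x - lincomb Z c \<psi> x) f"
      using L.diff_left[OF V'(1,3,2)] L.sym[OF V'(2,3)] Forth[OF f] by simp
    then have "(m w f)\<^sup>2 \<le> m (\<lambda>x. w x - lincomb Z c \<psi> x) (\<lambda>x. w x - lincomb Z c \<psi> x) * m f f"
      using L.cauchy_schwarz[of "\<lambda>x. w x - lincomb Z c \<psi> x" f] L.V_diff V' by simp
    also have "\<dots> \<le> \<kappa> * a w w * m f f" using c L.nonneg[OF V'(2)] by (rule mult_right_mono)
    finally show ?thesis .
  qed
  have poinc: "m f f \<le> \<kappa> * a f f" if f: "f \<in> F" for f
  proof (cases "m f f = 0")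
    case True then show ?thesis using kap E.nonneg f FV by auto
  next
    case False
    have "m f f * m f f \<le> \<kappa> * a f f * m f f" using one[of f f] f FVh by (auto simp: power2_eq_square)
    moreover have "m f f > 0" using False L.nonneg[of f] f FV by force
    ultimately show ?thesis by simp
  qed
  have two: "(m w f)\<^sup>2 \<le> \<kappa>\<^sup>2 * a w w * a f f" if w: "w \<in> Vh" and f: "f \<in> F" for w f
  proof -
    have "(m w f)\<^sup>2 \<le> \<kappa> * a w w * m f f" by (rule one[OF that])
    also have "\<dots> \<le> \<kappa> * a w w * (\<kappa> * a f f)"
      by (rule mult_left_mono[OF poinc[OF f]]) (use kap E.nonneg VhV w in auto)
    finally show ?thesis by (simp add: power2_eq_square mult_ac)
  qed
  have "\<exists>w\<in>F. \<forall>w'\<in>F. a w w' = a u w'" if "u \<in> V" for u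
    by (rule E.orthogonal_projection_exists[OF Fl FV that complete])
  then obtain P where P: "\<And>u. u \<in> V \<Longrightarrow> P u \<in> F" "\<And>u w'. u \<in> V \<Longrightarrow> w' \<in> F \<Longrightarrow> a (P u) w' = a u w'" by metis
  have azero: "a (\<lambda>x. 0) v = 0" if "v \<in> V" for v
    using E.scale_left[of "\<lambda>x. 0" v 0] L.V_zero that by auto
  have VcE: "\<exists>v w. y = (\<lambda>x. v x - w x) \<and> v \<in> VH \<and> w \<in> F \<and> (\<forall>f\<in>F. a w f = a v f)" if "y \<in> Vc" for y
    using that unfolding Vc by simp
  have Vcl: "lin_closed Vc"
  proof -
    have "(\<lambda>x. 0) \<in> Vc" unfolding Vc using lin_closedD(1)[OF VH(1)] lin_closedD(1)[OF Fl]
      by (intro CollectI exI[of _ "\<lambda>x. 0"]) auto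
    moreover have "(\<lambda>x. y x + y' x) \<in> Vc" if y: "y \<in> Vc" "y' \<in> Vc" for y y'
    proof -
      obtain v w where 1: "y = (\<lambda>x. v x - w x)" "v \<in> VH" "w \<in> F" "\<forall>f\<in>F. a w f = a v f"
        using VcE[OF y(1)] by auto
      obtain v' w' where 2: "y' = (\<lambda>x. v' x - w' x)" "v' \<in> VH" "w' \<in> F" "\<forall>f\<in>F. a w' f = a v' f"
        using VcE[OF y(2)] by auto
      note * = 1 2
      have V': "v \<in> V" "v' \<in> V" "w \<in> V" "w' \<in> V" using * FV VH VhV by auto
      show ?thesis unfolding Vc
      proof (intro CollectI exI conjI ballI)
        show "(\<lambda>x. y x + y' x) = (\<lambda>x. (v x + v' x) - (w x + w' x))" using * by auto
        show "(\<lambda>x. v x + v' x) \<in> VH" "(\<lambda>x. w x + w' x) \<in> F"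
          using lin_closedD(2)[OF VH(1)] lin_closedD(2)[OF Fl] * by auto
        fix f assume "f \<in> F"
        then show "a (\<lambda>x. w x + w' x) f = a (\<lambda>x. v x + v' x) f" using * V' FV by (simp add: E.add_left subset_iff)
      qed
    qed
    moreover have "(\<lambda>x. c * y x) \<in> Vc" if y: "y \<in> Vc" for y c
    proof -
      obtain v w where *: "y = (\<lambda>x. v x - w x)" "v \<in> VH" "w \<in> F" "\<forall>f\<in>F. a w f = a v f"
        using VcE[OF y] by auto
      have V': "v \<in> V" "w \<in> V" using * FV VH VhV by auto
      show ?thesis unfolding Vc
      proof (intro CollectI exI conjI ballI)
        show "(\<lambda>x. c * y x) = (\<lambda>x. (c * v x) - (c * w x))" using * by (auto simp: algebra_simps)
        show "(\<lambda>x. c * v x) \<in> VH" "(\<lambda>x. c * w x) \<in> F"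
          using lin_closedD(3)[OF VH(1)] lin_closedD(3)[OF Fl] * by auto
        fix f assume "f \<in> F"
        then show "a (\<lambda>x. c * w x) f = a (\<lambda>x. c * v x) f" using * V' FV by (simp add: E.scale_left subset_iff)
      qed
    qed
    ultimately show ?thesis by (simp add: lin_closed_def)
  qed
  have VcVh: "Vc \<subseteq> Vh" unfolding Vc using lin_closed_diff[OF Vh(1)] FVh VH(2) by blast
  then have VcV: "Vc \<subseteq> V" using VhV by auto
  have Vc_orth: "a y f = 0" if y: "y \<in> Vc" and f: "f \<in> F" for y f
  proof -
    obtain v w where *: "y = (\<lambda>x. v x - w x)" "v \<in> VH" "w \<in> F" "\<forall>f\<in>F. a w f = a v f"
        using VcE[OF y] by auto
    have V': "v \<in> V" "w \<in> V" "f \<in> V" using * FV VH VhV f by auto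
    show ?thesis unfolding *(1) using E.diff_left[OF V'] * f by simp
  qed
  have "\<exists>n. L.has_dim Vc n"
  proof (rule L.bounded_orthonormal_families_imp_dim[OF VcV Vcl])
    fix n and e :: "nat \<Rightarrow> 'x \<Rightarrow> real" assume e: "\<And>i. i < n \<Longrightarrow> e i \<in> Vc" "L.orthonormal {..<n} e"
    show "n \<le> card Z"
    proof (rule ccontr)
      assume "\<not> n \<le> card Z"
      then have lt: "card Z < card {..<n}" by simp
      from homogeneous_system_nontrivial_solution[OF Z(1) _ lt, of "\<lambda>z j. m (e j) (\<psi> z)"]
      obtain x where x: "\<exists>j<n. x j \<noteq> 0" "\<And>z. z \<in> Z \<Longrightarrow> (\<Sum>j<n. x j * m (e j) (\<psi> z)) = 0" by auto
      define y where "y = lincomb {..<n} x e"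
      have yVc: "y \<in> Vc" unfolding y_def using lin_closed_lincomb[OF Vcl] e by auto
      have "m y (\<psi> z) = 0" if "z \<in> Z" for z
        unfolding y_def using x(2)[OF that] e VcV zV[OF that] by (subst L.lincomb_left) auto
      then have yF: "y \<in> F" using F yVc VcVh by auto
      have "a y y = 0" by (rule Vc_orth[OF yVc yF])
      then have "m y y = 0" using poinc[OF yF] L.nonneg[of y] yF FV by force
      then show False using L.orthonormal_imp_independent[of "{..<n}" e x] e VcV x(1) by (auto simp: y_def)
    qed
  qed
  then obtain n where n: "L.has_dim Vc n" ..
  \<comment> \<open>If \<open>v\<close> is the \<open>m\<close>-projection of \<open>u\<close> onto the span of the \<open>\<psi>\<close>, then \<open>u - v\<close> lies in \<open>F\<close> and is
    annihilated by \<open>1 - P\<close>; hence \<open>u - P u = v - P v\<close>. The projection is found by counting: the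
    \<open>card Z + 1\<close> functions \<open>u\<close> and \<open>\<psi> z\<close> have a combination in \<open>F\<close>.\<close>
  have corr: "(\<lambda>x. u x - P u x) \<in> Vc" if u: "u \<in> Vh" for u
  proof -
    define g where "g j = (case j of None \<Rightarrow> u | Some z \<Rightarrow> \<psi> z)" for j
    define J where "J = insert None (Some ` Z)"
    have J: "finite J" using Z(1) by (simp add: J_def)
    have "card J = Suc (card Z)" unfolding J_def using Z(1) by (subst card_insert_disjoint) (auto simp: card_image)
    then have lt: "card Z < card J" by simp
    from homogeneous_system_nontrivial_solution[OF Z(1) J lt, of "\<lambda>z j. m (g j) (\<psi> z)"]
    obtain x where x: "\<exists>j\<in>J. x j \<noteq> 0" "\<And>z. z \<in> Z \<Longrightarrow> (\<Sum>j\<in>J. x j * m (g j) (\<psi> z)) = 0" by auto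
    define d where "d z = x (Some z)" for z
    have sum0: "x None * m u (\<psi> z) + m (lincomb Z d \<psi>) (\<psi> z) = 0" if z: "z \<in> Z" for z
    proof -
      have "(\<Sum>j\<in>J. x j * m (g j) (\<psi> z)) = x None * m u (\<psi> z) + (\<Sum>z'\<in>Z. d z' * m (\<psi> z') (\<psi> z))"
        unfolding J_def using Z(1) by (subst sum.insert) (auto simp: g_def d_def sum.reindex)
      moreover have "m (lincomb Z d \<psi>) (\<psi> z) = (\<Sum>z'\<in>Z. d z' * m (\<psi> z') (\<psi> z))"
        by (rule L.lincomb_left) (use Z(1) zV z in auto)
      ultimately show ?thesis using x(2)[OF z] by simp
    qed
    have xN: "x None \<noteq> 0"
    proof
      assume 0: "x None = 0"
      then have "m (lincomb Z d \<psi>) (lincomb Z d \<psi>) = 0"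
        using sum0 PV VhV zV by (subst L.lincomb_right) (auto intro: Z(1))
      then have "\<forall>z\<in>Z. d z = 0" by (rule ind)
      then show False using x(1) 0 by (auto simp: J_def d_def)
    qed
    define c where "c z = - d z / x None" for z
    define v where "v = lincomb Z c \<psi>"
    have v_eq: "v = (\<lambda>y. (- 1 / x None) * lincomb Z d \<psi> y)"
      by (auto simp: v_def lincomb_def c_def sum_distrib_left)
    have vH: "v \<in> VH" using Z(2) by (simp add: v_def)
    have vV: "v \<in> V" "v \<in> Vh" using vH VH VhV by auto
    have uV: "u \<in> V" using u VhV by auto
    have uvF: "(\<lambda>y. u y - v y) \<in> F"
      unfolding F
    proof (intro CollectI conjI ballI)
      show "(\<lambda>y. u y - v y) \<in> Vh" by (rule lin_closed_diff[OF Vh(1) u vV(2)])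
      fix z assume z: "z \<in> Z"
      have "m v (\<psi> z) = (- 1 / x None) * m (lincomb Z d \<psi>) (\<psi> z)"
        unfolding v_eq by (rule L.scale_left) (use PV VhV zV z in auto)
      moreover have "m (lincomb Z d \<psi>) (\<psi> z) = - (x None * m u (\<psi> z))" using sum0[OF z] by linarith
      ultimately have "m v (\<psi> z) = m u (\<psi> z)" using xN by simp
      then show "m (\<lambda>y. u y - v y) (\<psi> z) = 0"
        using L.diff_left[OF uV vV(1) zV[OF z]] by simp
    qed
    define w where "w = (\<lambda>y. P u y - (u y - v y))"
    have wF: "w \<in> F" unfolding w_def by (rule lin_closed_diff[OF Fl P(1)[OF uV] uvF])
    have "a w f = a v f" if f: "f \<in> F" for f
    proof -
      have fV: "f \<in> V" "P u \<in> V" using f FV P(1)[OF uV] by auto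
      show ?thesis unfolding w_def
        using E.diff_left[OF fV(2) E.V_diff[OF uV vV(1)] fV(1)] E.diff_left[OF uV vV(1) fV(1)] P(2)[OF uV f] by simp
    qed
    moreover have "(\<lambda>x. u x - P u x) = (\<lambda>x. v x - w x)" by (auto simp: w_def)
    ultimately show ?thesis unfolding Vc using vH wF by blast
  qed
  from orthonormal_eigenvectors[OF Vh ev] obtain e where
    e: "\<And>k. k \<in> indices Vh \<Longrightarrow> e k \<in> eig Vh (ev k)" and on: "L.orthonormal (indices Vh) e" by blast
  have dle: "card Z \<le> p" if "L.has_dim Vh p" for p
    by (rule L.independent_card_le_dim[OF Vh(2) that Z(1) Z(3) ind])
  have sub: "{1..l} \<subseteq> indices Vh" unfolding indices_def using dle l by fastforce
  define S where "S = {1..l}"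
  have S: "finite S" "S \<noteq> {}" "l \<in> S" using l by (auto simp: S_def)
  have eS: "\<And>k. k \<in> S \<Longrightarrow> e k \<in> eig Vh (ev k)" and onS: "L.orthonormal S e"
    using e on sub unfolding S_def L.orthonormal_def by (blast, meson subsetD)
  have eVh: "\<And>k. k \<in> S \<Longrightarrow> e k \<in> Vh" using eS by (auto simp: eig_def)
  then have eV: "\<And>k. k \<in> S \<Longrightarrow> e k \<in> V" using VhV by auto
  define lam where "lam = ev l"
  have ev0: "0 \<le> ev k" if "k \<in> S" for k
  proof -
    have "a (e k) (e k) = ev k * m (e k) (e k)" using eS[OF that] by (auto simp: eig_def)
    then show ?thesis using onS that E.nonneg[OF eV[OF that]] by (simp add: L.orthonormal_def)
  qed
  have evl: "ev k \<le> lam" if "k \<in> S" for k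
  proof -
    have "mono_on (indices Vh) ev" using ev by (simp add: lists_eigs_def)
    moreover have "k \<in> indices Vh" "l \<in> indices Vh" using sub that S(3) by (auto simp only: S_def)
    moreover have "k \<le> l" using that by (simp add: S_def)
    ultimately show ?thesis unfolding lam_def by (simp add: mono_on_def)
  qed
  have lam0: "0 \<le> lam" using ev0[OF S(3)] by (simp add: lam_def)
  define y where "y k = (\<lambda>x. e k x - P (e k) x)" for k
  have yVc: "y k \<in> Vc" if "k \<in> S" for k unfolding y_def using corr[OF eVh[OF that]] .
  define th where "th = \<kappa>\<^sup>2 * lam\<^sup>2"
  have th: "0 \<le> th" "2 * th \<le> 1/2" using small by (auto simp: th_def lam_def)
  have trial: "m (lincomb S x y) (lincomb S x y) \<ge> (1 - 2 * th) * (\<Sum>k\<in>S. x k * x k)"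
      "a (lincomb S x y) (lincomb S x y) \<le> lam * (\<Sum>k\<in>S. x k * x k)" for x
  proof -
    define N where "N = (\<Sum>k\<in>S. x k * x k)"
    have N0: "0 \<le> N" by (auto simp: N_def intro: sum_nonneg)
    define u p w where "u = lincomb S x e" and "p = lincomb S x (\<lambda>k. P (e k))"
      and "w = lincomb S (\<lambda>k. x k * ev k) e"
    have uV: "u \<in> V" and wV: "w \<in> V" unfolding u_def w_def by (rule L.V_lincomb[OF S(1) eV]; assumption)+
    have uVh: "u \<in> Vh" and wVh: "w \<in> Vh" unfolding u_def w_def
      by (rule lin_closed_lincomb[OF Vh(1) S(1) eVh]; assumption)+
    have pF: "p \<in> F" unfolding p_def by (rule lin_closed_lincomb[OF Fl S(1)]) (use P(1) eV in auto)
    then have pV: "p \<in> V" and pVh: "p \<in> Vh" using FV FVh by auto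
    have yeq: "lincomb S x y = (\<lambda>t. u t - p t)"
      by (auto simp: lincomb_def u_def p_def y_def algebra_simps sum_subtractf)
    have muu: "m u u = N" unfolding u_def N_def by (rule L.orthonormal_lincomb_square[OF S(1) eV onS])
    have auv: "a u v = m w v" if "v \<in> Vh" for v
      unfolding u_def w_def by (rule eigenvector_lincomb_energy[OF Vh(2) S(1) eS that])
    have awv: "a w v = m (lincomb S (\<lambda>k. x k * ev k * ev k) e) v" if "v \<in> Vh" for v
      unfolding w_def by (rule eigenvector_lincomb_energy[OF Vh(2) S(1) eS that])
    have "a u u = (\<Sum>k\<in>S. (x k * ev k) * x k)"
      unfolding auv[OF uVh] unfolding u_def w_def by (rule L.orthonormal_lincomb_square[OF S(1) eV onS])
    also have "\<dots> \<le> (\<Sum>k\<in>S. lam * (x k * x k))"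
    proof (rule sum_mono)
      fix k assume k: "k \<in> S"
      show "(x k * ev k) * x k \<le> lam * (x k * x k)"
        using mult_right_mono[OF evl[OF k], of "x k * x k"] by (simp add: mult_ac)
    qed
    finally have auu: "a u u \<le> lam * N" by (simp add: N_def sum_distrib_left)
    have "a w w = (\<Sum>k\<in>S. (x k * ev k * ev k) * (x k * ev k))"
      unfolding awv[OF wVh] unfolding w_def by (rule L.orthonormal_lincomb_square[OF S(1) eV onS])
    also have "\<dots> \<le> (\<Sum>k\<in>S. lam^3 * (x k * x k))"
    proof (rule sum_mono)
      fix k assume k: "k \<in> S"
      have "ev k ^ 3 \<le> lam ^ 3" using evl[OF k] ev0[OF k] by (rule power_mono)
      from mult_right_mono[OF this, of "x k * x k"]
      show "(x k * ev k * ev k) * (x k * ev k) \<le> lam^3 * (x k * x k)"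
        by (simp add: mult_ac power3_eq_cube)
    qed
    finally have aww: "a w w \<le> lam^3 * N" by (simp add: N_def sum_distrib_left)
    have apv: "a p f = a u f" if f: "f \<in> F" for f
    proof -
      have "a p f = (\<Sum>k\<in>S. x k * a (P (e k)) f)"
        unfolding p_def by (rule E.lincomb_left[OF S(1)]) (use P(1) eV FV f in auto)
      also have "\<dots> = (\<Sum>k\<in>S. x k * a (e k) f)" using P(2) eV f by simp
      also have "\<dots> = a u f" unfolding u_def by (rule E.lincomb_left[OF S(1) eV, symmetric]) (use f FV in auto)
      finally show ?thesis .
    qed
    have app: "a p p = m w p" using apv[OF pF] auv[OF pVh] by simp
    have app0: "0 \<le> a p p" using E.nonneg[OF pV] .
    have app_le: "a p p \<le> \<kappa>\<^sup>2 * lam^3 * N"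
    proof (cases "a p p = 0")
      case True then show ?thesis using lam0 N0 by simp
    next
      case False
      have "a p p * a p p \<le> \<kappa>\<^sup>2 * a w w * a p p" using two[OF wVh pF] app by (simp add: power2_eq_square)
      then have "a p p \<le> \<kappa>\<^sup>2 * a w w" using False app0 by simp
      also have "\<dots> \<le> \<kappa>\<^sup>2 * (lam^3 * N)" by (rule mult_left_mono[OF aww]) simp
      finally show ?thesis by simp
    qed
    have "(m u p)\<^sup>2 \<le> \<kappa>\<^sup>2 * a u u * a p p" by (rule two[OF uVh pF])
    also have "\<dots> \<le> (\<kappa>\<^sup>2 * (lam * N)) * (\<kappa>\<^sup>2 * lam^3 * N)"
      by (intro mult_mono mult_left_mono auu app_le) (use app0 lam0 N0 in auto)
    also have "\<dots> = (th * N)\<^sup>2" by (simp add: th_def power2_eq_square power3_eq_cube mult_ac)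
    finally have "\<bar>m u p\<bar> \<le> th * N" using th N0 by (simp add: abs_le_square_iff[symmetric])
    then have "m u p \<le> th * N" by simp
    then have "m (\<lambda>t. u t - p t) (\<lambda>t. u t - p t) \<ge> N - 2 * (th * N)"
      using L.diff_square[OF uV pV] L.nonneg[OF pV] muu by simp
    then show "m (lincomb S x y) (lincomb S x y) \<ge> (1 - 2 * th) * (\<Sum>k\<in>S. x k * x k)"
      unfolding yeq by (simp add: N_def[symmetric] algebra_simps)
    have "a (\<lambda>t. u t - p t) (\<lambda>t. u t - p t) = a u u - a p p"
      using E.diff_square[OF uV pV] apv[OF pF] by simp
    then show "a (lincomb S x y) (lincomb S x y) \<le> lam * (\<Sum>k\<in>S. x k * x k)"
      unfolding yeq using auu app0 by (simp add: N_def[symmetric])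
  qed
  have Npos: "(\<Sum>k\<in>S. x k * x k) > 0" if "\<exists>k\<in>S. x k \<noteq> 0" for x :: "nat \<Rightarrow> real"
    using that S(1) by (metis (no_types, lifting) not_real_square_gt_zero sum_pos2 zero_le_square)
  have "\<exists>x. (\<exists>k\<in>S. x k \<noteq> 0) \<and> EV l * m (lincomb S x y) (lincomb S x y) \<le> a (lincomb S x y) (lincomb S x y)"
    unfolding S_def
  proof (rule min_max_upper_bound[OF Vcl VcV EV n])
    show "1 \<le> l" using l by auto
    show "y k \<in> Vc" if "k \<in> {1..l}" for k using yVc that by (simp add: S_def)
    fix x assume "\<exists>k\<in>{1..l}. x k \<noteq> (0::real)"
    then have "(\<Sum>k\<in>S. x k * x k) > 0" using Npos by (simp add: S_def)
    then have "0 < (1 - 2 * th) * (\<Sum>k\<in>S. x k * x k)" using th by simp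
    then show "0 < m (lincomb {1..l} x y) (lincomb {1..l} x y)" using trial(1)[of x] by (simp add: S_def)
  qed
  then obtain x where x: "\<exists>k\<in>S. x k \<noteq> 0"
    "EV l * m (lincomb S x y) (lincomb S x y) \<le> a (lincomb S x y) (lincomb S x y)" by blast
  define N where "N = (\<Sum>k\<in>S. x k * x k)"
  have N: "N > 0" using Npos[OF x(1)] by (simp add: N_def)
  show ?thesis
  proof (cases "EV l \<le> 0")
    case True
    then show ?thesis using lam0 by (simp add: lam_def) (smt (verit) mult_nonneg_nonneg zero_le_power2)
  next
    case False
    have "EV l * ((1 - 2 * th) * N) \<le> EV l * m (lincomb S x y) (lincomb S x y)"
      using trial(1)[of x] False by (simp add: N_def)
    also have "\<dots> \<le> lam * N" using x(2) trial(2)[of x] by (simp add: N_def)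
    finally have "(EV l * (1 - 2 * th)) * N \<le> lam * N" by (simp add: mult_ac)
    then have le: "EV l * (1 - 2 * th) \<le> lam" using N by simp
    have "EV l * (1 - 2 * th) * (1 + 4 * th) \<le> lam * (1 + 4 * th)"
      by (rule mult_right_mono[OF le]) (use th in simp)
    moreover have "EV l * 1 \<le> EV l * ((1 - 2 * th) * (1 + 4 * th))"
    proof (rule mult_left_mono)
      have "(1 - 2 * th) * (1 + 4 * th) = 1 + 2 * th * (1 - 4 * th)" by (simp add: algebra_simps)
      moreover have "0 \<le> 2 * th * (1 - 4 * th)" using th by (intro mult_nonneg_nonneg) auto
      ultimately show "1 \<le> (1 - 2 * th) * (1 + 4 * th)" by linarith
    qed (use False in simp)
    ultimately have "EV l \<le> lam * (1 + 4 * th)" by (simp add: mult_ac)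
    then show ?thesis by (simp add: th_def lam_def algebra_simps)
  qed
qed

end

section \<open>Square integrable functions\<close>

definition square_integrable :: "'a measure \<Rightarrow> ('a \<Rightarrow> 'b::euclidean_space) \<Rightarrow> bool" where
  "square_integrable M f \<longleftrightarrow> f \<in> borel_measurable M \<and> integrable M (\<lambda>x. (norm (f x))\<^sup>2)"

definition l2norm :: "'a measure \<Rightarrow> ('a \<Rightarrow> 'b::euclidean_space) \<Rightarrow> real" where
  "l2norm M f = sqrt (LINT x|M. (norm (f x))\<^sup>2)"

lemma square_integrable_inner:
  fixes f g :: "'a \<Rightarrow> 'b::euclidean_space"
  assumes "square_integrable M f" "square_integrable M g"
  shows "integrable M (\<lambda>x. f x \<bullet> g x)"
proof (rule Bochner_Integration.integrable_bound)
  show "integrable M (\<lambda>x. (norm (f x))\<^sup>2 + (norm (g x))\<^sup>2)"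
    using assms by (auto simp: square_integrable_def)
  show "(\<lambda>x. f x \<bullet> g x) \<in> borel_measurable M" using assms by (auto simp: square_integrable_def)
  have "\<bar>f x \<bullet> g x\<bar> \<le> (norm (f x))\<^sup>2 + (norm (g x))\<^sup>2" for x
  proof -
    have "\<bar>f x \<bullet> g x\<bar> \<le> norm (f x) * norm (g x)" by (rule Cauchy_Schwarz_ineq2)
    also have "2 * (norm (f x) * norm (g x)) \<le> (norm (f x))\<^sup>2 + (norm (g x))\<^sup>2"
      using sum_squares_bound[of "norm (f x)" "norm (g x)"] by (simp add: mult.assoc)
    then have "norm (f x) * norm (g x) \<le> (norm (f x))\<^sup>2 + (norm (g x))\<^sup>2"
      using mult_nonneg_nonneg[of "norm (f x)" "norm (g x)"] by (smt (verit) norm_ge_zero)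
    finally show ?thesis .
  qed
  then show "AE x in M. norm (f x \<bullet> g x) \<le> norm ((norm (f x))\<^sup>2 + (norm (g x))\<^sup>2)" by simp
qed

lemma square_integrable_add:
  fixes f g :: "'a \<Rightarrow> 'b::euclidean_space"
  assumes "square_integrable M f" "square_integrable M g"
  shows "square_integrable M (\<lambda>x. f x + g x)"
proof -
  have eq: "(norm (f x + g x))\<^sup>2 = (norm (f x))\<^sup>2 + 2 * (f x \<bullet> g x) + (norm (g x))\<^sup>2" for x
    by (simp add: power2_norm_eq_inner inner_add_left inner_add_right inner_commute)
  show ?thesis unfolding square_integrable_def eq
    using assms square_integrable_inner[OF assms] by (auto simp: square_integrable_def)
qed

lemma square_integrable_scaleR:
  "square_integrable M f \<Longrightarrow> square_integrable M (\<lambda>x. c *\<^sub>R f x)"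
  by (auto simp: square_integrable_def power_mult_distrib)

lemma square_integrable_cmult:
  fixes f :: "'a \<Rightarrow> real"
  shows "square_integrable M f \<Longrightarrow> square_integrable M (\<lambda>x. c * f x)"
  using square_integrable_scaleR[of M f c] by simp

lemma square_integrable_diff:
  assumes "square_integrable M f" "square_integrable M g"
  shows "square_integrable M (\<lambda>x. f x - g x)"
  using square_integrable_add[OF assms(1) square_integrable_scaleR[OF assms(2), of "-1"]] by simp

lemma l2norm_cong_AE:
  fixes f g :: "'a \<Rightarrow> 'b::euclidean_space"
  assumes "f \<in> borel_measurable M" "g \<in> borel_measurable M" "AE x in M. f x = g x"
  shows "l2norm M f = l2norm M g"
  unfolding l2norm_def by (intro arg_cong[of _ _ sqrt] integral_cong_AE) (use assms in auto)

lemma l2norm_nonneg [simp]: "0 \<le> l2norm M f" by (simp add: l2norm_def)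

lemma l2norm_square: "(l2norm M f)\<^sup>2 = (LINT x|M. (norm (f x))\<^sup>2)"
  by (simp add: l2norm_def)

lemma l2norm_uminus_diff: "l2norm M (\<lambda>x. f x - g x) = l2norm M (\<lambda>x. g x - f x)"
  by (simp add: l2norm_def norm_minus_commute)

lemma l2norm_scaleR: "l2norm M (\<lambda>x. c *\<^sub>R f x) = \<bar>c\<bar> * l2norm M f"
  by (simp add: l2norm_def power_mult_distrib real_sqrt_mult)

lemma l2_cauchy_schwarz:
  fixes f g :: "'a \<Rightarrow> 'b::euclidean_space"
  assumes f: "square_integrable M f" and g: "square_integrable M g"
  shows "\<bar>LINT x|M. f x \<bullet> g x\<bar> \<le> l2norm M f * l2norm M g"
proof -
  define p q r where "p = (LINT x|M. (norm (f x))\<^sup>2)" and "q = (LINT x|M. (norm (g x))\<^sup>2)"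
    and "r = (LINT x|M. f x \<bullet> g x)"
  have int: "integrable M (\<lambda>x. f x \<bullet> g x)" "integrable M (\<lambda>x. (norm (f x))\<^sup>2)" "integrable M (\<lambda>x. (norm (g x))\<^sup>2)"
    using square_integrable_inner[OF f g] f g by (auto simp: square_integrable_def)
  have quad: "0 \<le> p - 2 * t * r + t\<^sup>2 * q" for t
  proof -
    have "0 \<le> (LINT x|M. (norm (f x - t *\<^sub>R g x))\<^sup>2)" by simp
    also have "\<dots> = (LINT x|M. (norm (f x))\<^sup>2 - 2 * t * (f x \<bullet> g x) + t\<^sup>2 * (norm (g x))\<^sup>2)"
      unfolding power2_norm_eq_inner
      by (intro arg_cong[of _ _ "integral\<^sup>L M"] ext)
         (simp add: inner_diff_left inner_diff_right inner_commute power2_eq_square algebra_simps)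
    also have "\<dots> = p - 2 * t * r + t\<^sup>2 * q"
      using int by (simp add: p_def q_def r_def)
    finally show ?thesis .
  qed
  have pq: "0 \<le> p" "0 \<le> q" by (auto simp: p_def q_def)
  have "r\<^sup>2 \<le> p * q"
  proof (cases "q = 0")
    case True
    have "r = 0"
    proof (rule ccontr)
      assume "r \<noteq> 0" then show False using quad[of "(p + 1) / (2 * r)"] True by (simp add: field_simps)
    qed
    then show ?thesis using pq by simp
  next
    case False
    then have "0 \<le> p - r\<^sup>2 / q" using quad[of "r / q"] pq by (simp add: power2_eq_square field_simps)
    then show ?thesis using False pq by (simp add: field_simps)
  qed
  then have "sqrt (r\<^sup>2) \<le> sqrt (p * q)" by (rule real_sqrt_le_mono)
  then show ?thesis by (simp add: l2norm_def p_def q_def r_def real_sqrt_mult)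
qed

lemma l2norm_triangle:
  fixes f g :: "'a \<Rightarrow> 'b::euclidean_space"
  assumes f: "square_integrable M f" and g: "square_integrable M g"
  shows "l2norm M (\<lambda>x. f x + g x) \<le> l2norm M f + l2norm M g"
proof (rule power2_le_imp_le)
  have "(l2norm M (\<lambda>x. f x + g x))\<^sup>2 = (LINT x|M. (norm (f x))\<^sup>2 + 2 * (f x \<bullet> g x) + (norm (g x))\<^sup>2)"
    unfolding l2norm_square by (intro arg_cong[of _ _ "integral\<^sup>L M"] ext)
       (simp add: power2_norm_eq_inner inner_add_left inner_add_right inner_commute)
  also have "\<dots> = (l2norm M f)\<^sup>2 + 2 * (LINT x|M. f x \<bullet> g x) + (l2norm M g)\<^sup>2"
    using square_integrable_inner[OF f g] f g by (simp add: square_integrable_def l2norm_square)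
  also have "\<dots> \<le> (l2norm M f + l2norm M g)\<^sup>2"
    using l2_cauchy_schwarz[OF f g] by (simp add: power2_sum)
  finally show "(l2norm M (\<lambda>x. f x + g x))\<^sup>2 \<le> (l2norm M f + l2norm M g)\<^sup>2" .
qed auto

lemma l2norm_triangle_diff:
  fixes f g h :: "'a \<Rightarrow> 'b::euclidean_space"
  assumes "square_integrable M f" "square_integrable M g" "square_integrable M h"
  shows "l2norm M (\<lambda>x. f x - h x) \<le> l2norm M (\<lambda>x. f x - g x) + l2norm M (\<lambda>x. g x - h x)"
  using l2norm_triangle[OF square_integrable_diff[OF assms(1,2)] square_integrable_diff[OF assms(2,3)]] by simp

lemma l2norm_eq_0_iff:
  fixes f :: "'a \<Rightarrow> 'b::euclidean_space"
  assumes "square_integrable M f"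
  shows "l2norm M f = 0 \<longleftrightarrow> (AE x in M. f x = 0)"
  using integral_nonneg_eq_0_iff_AE[of M "\<lambda>x. (norm (f x))\<^sup>2"] assms
  by (simp add: l2norm_def square_integrable_def)

lemma l2_inner_tendsto:
  fixes f :: "'a \<Rightarrow> 'b::euclidean_space"
  assumes s: "\<And>k. square_integrable M (s k)" and f: "square_integrable M f" and g: "square_integrable M g"
    and lim: "(\<lambda>k. l2norm M (\<lambda>x. s k x - f x)) \<longlonglongrightarrow> 0"
  shows "(\<lambda>k. LINT x|M. s k x \<bullet> g x) \<longlonglongrightarrow> (LINT x|M. f x \<bullet> g x)"
proof (rule LIM_zero_cancel, rule tendsto_rabs_zero_cancel, rule tendsto_sandwich[OF _ _ tendsto_const])
  show "\<forall>\<^sub>F k in sequentially. 0 \<le> \<bar>(LINT x|M. s k x \<bullet> g x) - (LINT x|M. f x \<bullet> g x)\<bar>" by simp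
  show "\<forall>\<^sub>F k in sequentially. \<bar>(LINT x|M. s k x \<bullet> g x) - (LINT x|M. f x \<bullet> g x)\<bar>
      \<le> l2norm M (\<lambda>x. s k x - f x) * l2norm M g"
  proof (intro always_eventually allI)
    fix k
    have "(LINT x|M. s k x \<bullet> g x) - (LINT x|M. f x \<bullet> g x) = (LINT x|M. (s k x - f x) \<bullet> g x)"
      using square_integrable_inner[OF s g] square_integrable_inner[OF f g] by (simp add: inner_diff_left)
    then show "\<bar>(LINT x|M. s k x \<bullet> g x) - (LINT x|M. f x \<bullet> g x)\<bar> \<le> l2norm M (\<lambda>x. s k x - f x) * l2norm M g"
      using l2_cauchy_schwarz[OF square_integrable_diff[OF s[of k] f] g] by simp
  qed
  show "(\<lambda>k. l2norm M (\<lambda>x. s k x - f x) * l2norm M g) \<longlonglongrightarrow> 0"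
    using tendsto_mult[OF lim tendsto_const, of "l2norm M g"] by simp
qed

lemma l2norm_tendsto:
  fixes f :: "'a \<Rightarrow> 'b::euclidean_space"
  assumes s: "\<And>k. square_integrable M (s k)" and f: "square_integrable M f"
    and lim: "(\<lambda>k. l2norm M (\<lambda>x. s k x - f x)) \<longlonglongrightarrow> 0"
  shows "(\<lambda>k. l2norm M (s k)) \<longlonglongrightarrow> l2norm M f"
proof (rule LIM_zero_cancel, rule tendsto_rabs_zero_cancel, rule tendsto_sandwich[OF _ _ tendsto_const lim])
  show "\<forall>\<^sub>F k in sequentially. \<bar>l2norm M (s k) - l2norm M f\<bar> \<le> l2norm M (\<lambda>x. s k x - f x)"
  proof (intro always_eventually allI)
    fix k
    have "l2norm M (s k) \<le> l2norm M (\<lambda>x. s k x - f x) + l2norm M f"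
      using l2norm_triangle[OF square_integrable_diff[OF s[of k] f] f] by simp
    moreover have "l2norm M f \<le> l2norm M (\<lambda>x. f x - s k x) + l2norm M (s k)"
      using l2norm_triangle[OF square_integrable_diff[OF f s[of k]] s[of k]] by simp
    ultimately show "\<bar>l2norm M (s k) - l2norm M f\<bar> \<le> l2norm M (\<lambda>x. s k x - f x)"
      using l2norm_uminus_diff[of M f "s k"] by linarith
  qed
qed auto

lemma nn_integral_square_l2norm:
  fixes f :: "'a \<Rightarrow> 'b::euclidean_space"
  assumes "square_integrable M f"
  shows "(\<integral>\<^sup>+x. ennreal ((norm (f x))\<^sup>2) \<partial>M) = ennreal ((l2norm M f)\<^sup>2)"
  unfolding l2norm_square using assms by (intro nn_integral_eq_integral) (auto simp: square_integrable_def)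

text \<open>On a finite measure space the increments are also summable in mean, hence their norms are
  summable at almost every point. This gives a pointwise limit, which is the limit in the mean square
  by Fatou's lemma.\<close>
lemma l2_complete:
  fixes f :: "nat \<Rightarrow> 'a \<Rightarrow> 'b::euclidean_space"
  assumes fin: "finite_measure M" and f: "\<And>k. square_integrable M (f k)"
    and cauchy: "\<And>k. l2norm M (\<lambda>x. f (Suc k) x - f k x) \<le> B * (1/2)^k"
  shows "\<exists>g. square_integrable M g \<and> (\<lambda>k. l2norm M (\<lambda>x. f k x - g x)) \<longlonglongrightarrow> 0"
proof -
  interpret finite_measure M by (rule fin)
  have fm [measurable]: "f k \<in> borel_measurable M" for k using f by (auto simp: square_integrable_def)
  have B0: "0 \<le> B" using order_trans[OF l2norm_nonneg cauchy[of 0]] by simp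
  define d where "d k x = norm (f (Suc k) x - f k x)" for k x
  have one: "square_integrable M (\<lambda>x. 1::real)" by (simp add: square_integrable_def)
  define K where "K = B * l2norm M (\<lambda>x. 1::real)"
  have dk: "(\<integral>\<^sup>+x. ennreal (d k x) \<partial>M) \<le> ennreal (K * (1/2)^k)" for k
  proof -
    have sd: "square_integrable M (\<lambda>x. f (Suc k) x - f k x)" by (rule square_integrable_diff[OF f f])
    then have sd': "square_integrable M (d k)"
      unfolding d_def[abs_def] by (auto simp: square_integrable_def)
    have eq: "l2norm M (d k) = l2norm M (\<lambda>x. f (Suc k) x - f k x)" by (simp add: l2norm_def d_def)
    have int: "integrable M (d k)" using square_integrable_inner[OF sd' one] by simp
    have "(\<integral>\<^sup>+x. ennreal (d k x) \<partial>M) = ennreal (LINT x|M. d k x)"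
      by (rule nn_integral_eq_integral[OF int]) (simp add: d_def)
    also have "(LINT x|M. d k x) \<le> l2norm M (d k) * l2norm M (\<lambda>x. 1::real)"
      using l2_cauchy_schwarz[OF sd' one] by simp
    also have "\<dots> \<le> (B * (1/2)^k) * l2norm M (\<lambda>x. 1::real)"
      unfolding eq by (rule mult_right_mono[OF cauchy]) simp
    finally show ?thesis by (simp add: K_def mult_ac ennreal_leI)
  qed
  have K0: "0 \<le> K" using B0 by (simp add: K_def)
  have "(\<integral>\<^sup>+x. (\<Sum>k. ennreal (d k x)) \<partial>M) = (\<Sum>k. \<integral>\<^sup>+x. ennreal (d k x) \<partial>M)"
    by (rule nn_integral_suminf) (simp add: d_def)
  also have "\<dots> \<le> (\<Sum>k. ennreal (K * (1/2)^k))" by (rule suminf_le[OF dk]) auto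
  also have "\<dots> = ennreal (\<Sum>k. K * (1/2)^k)"
    by (rule suminf_ennreal2) (use K0 in \<open>auto intro: summable_mult\<close>)
  also have "\<dots> < \<infinity>" by simp
  finally have "AE x in M. (\<Sum>k. ennreal (d k x)) \<noteq> \<infinity>"
    by (intro nn_integral_PInf_AE) (auto simp: d_def)
  then have conv: "AE x in M. convergent (\<lambda>k. f k x)"
  proof eventually_elim
    case (elim x)
    then have "summable (\<lambda>k. d k x)" by (intro summable_suminf_not_top) (auto simp: d_def)
    then have "summable (\<lambda>k. f (Suc k) x - f k x)" unfolding d_def by (rule summable_norm_cancel)
    then have "convergent (\<lambda>n. \<Sum>k<n. f (Suc k) x - f k x)" by (simp add: summable_iff_convergent)
    moreover have "(\<Sum>k<n. f (Suc k) x - f k x) = f n x - f 0 x" for n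
      using sum_lessThan_telescope[of "\<lambda>k. f k x" n] .
    ultimately have "convergent (\<lambda>n. f n x - f 0 x)" by simp
    then show ?case using convergent_diff_const_right_iff[of "\<lambda>n. f n x" "f 0 x"] by blast
  qed
  define g where "g x = lim (\<lambda>k. f k x)" for x
  have gm [measurable]: "g \<in> borel_measurable M" unfolding g_def[abs_def] by measurable
  have lim: "AE x in M. (\<lambda>k. f k x) \<longlonglongrightarrow> g x"
    using conv by eventually_elim (simp add: g_def convergent_LIMSEQ_iff)
  have tail: "l2norm M (\<lambda>x. f j x - f k x) \<le> 2 * B * (1/2)^k - 2 * B * (1/2)^j" if "k \<le> j" for j k
    using that
  proof (induction j rule: dec_induct)
    case base then show ?case by (simp add: l2norm_def)
  next
    case (step j)
    have "l2norm M (\<lambda>x. f (Suc j) x - f k x) \<le> l2norm M (\<lambda>x. f (Suc j) x - f j x) + l2norm M (\<lambda>x. f j x - f k x)"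
      by (rule l2norm_triangle_diff[OF f f f])
    also have "\<dots> \<le> B * (1/2)^j + (2 * B * (1/2)^k - 2 * B * (1/2)^j)"
      using cauchy[of j] step by (intro add_mono)
    finally show ?case by simp
  qed
  have dist: "(\<integral>\<^sup>+x. ennreal ((norm (f k x - g x))\<^sup>2) \<partial>M) \<le> ennreal ((2 * B * (1/2)^k)\<^sup>2)" for k
  proof -
    have "(\<integral>\<^sup>+x. ennreal ((norm (f k x - g x))\<^sup>2) \<partial>M)
        = (\<integral>\<^sup>+x. liminf (\<lambda>j. ennreal ((norm (f j x - f k x))\<^sup>2)) \<partial>M)"
    proof (rule nn_integral_cong_AE)
      show "AE x in M. ennreal ((norm (f k x - g x))\<^sup>2) = liminf (\<lambda>j. ennreal ((norm (f j x - f k x))\<^sup>2))"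
        using lim
      proof eventually_elim
        case (elim x)
        have "(\<lambda>j. ennreal ((norm (f j x - f k x))\<^sup>2)) \<longlonglongrightarrow> ennreal ((norm (g x - f k x))\<^sup>2)"
          by (intro tendsto_intros elim)
        from lim_imp_Liminf[OF sequentially_bot this] show ?case by (metis norm_minus_commute)
      qed
    qed
    also have "\<dots> \<le> liminf (\<lambda>j. \<integral>\<^sup>+x. ennreal ((norm (f j x - f k x))\<^sup>2) \<partial>M)"
      by (rule nn_integral_liminf) simp
    also have "\<dots> \<le> ennreal ((2 * B * (1/2)^k)\<^sup>2)"
    proof (rule Liminf_le)
      show "\<forall>\<^sub>F j in sequentially. (\<integral>\<^sup>+x. ennreal ((norm (f j x - f k x))\<^sup>2) \<partial>M) \<le> ennreal ((2 * B * (1/2)^k)\<^sup>2)"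
        using eventually_ge_at_top[of k]
      proof eventually_elim
        case (elim j)
        have "l2norm M (\<lambda>x. f j x - f k x) \<le> 2 * B * (1/2)^k - 2 * B * (1/2)^j" by (rule tail[OF elim])
        also have "\<dots> \<le> 2 * B * (1/2)^k" using B0 by simp
        finally have "(l2norm M (\<lambda>x. f j x - f k x))\<^sup>2 \<le> (2 * B * (1/2)^k)\<^sup>2" by (rule power_mono) simp
        then show ?case unfolding nn_integral_square_l2norm[OF square_integrable_diff[OF f f]] by (rule ennreal_leI)
      qed
    qed simp
    finally show ?thesis .
  qed
  have sq: "square_integrable M (\<lambda>x. f k x - g x)" for k
    unfolding square_integrable_def
  proof
    show "integrable M (\<lambda>x. (norm (f k x - g x))\<^sup>2)"
      using dist[of k] by (intro integrableI_nonneg) (auto intro: le_less_trans)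
  qed simp
  have "square_integrable M g" using square_integrable_diff[OF f[of 0] sq[of 0]] by simp
  moreover have "(\<lambda>k. l2norm M (\<lambda>x. f k x - g x)) \<longlonglongrightarrow> 0"
  proof (rule tendsto_sandwich[OF _ _ tendsto_const])
    show "\<forall>\<^sub>F k in sequentially. l2norm M (\<lambda>x. f k x - g x) \<le> 2 * B * (1/2)^k"
    proof (intro always_eventually allI)
      fix k
      have "(l2norm M (\<lambda>x. f k x - g x))\<^sup>2 \<le> (2 * B * (1/2)^k)\<^sup>2"
        using dist[of k] unfolding nn_integral_square_l2norm[OF sq] by (simp add: ennreal_le_iff)
      then show "l2norm M (\<lambda>x. f k x - g x) \<le> 2 * B * (1/2)^k"
        by (rule power2_le_imp_le) (use B0 in simp)
    qed
    show "(\<lambda>k. 2 * B * (1/2)^k) \<longlonglongrightarrow> 0"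
      using tendsto_mult[OF tendsto_const LIMSEQ_realpow_zero[of "1/2"], of "2*B"] by simp
  qed auto
  ultimately show ?thesis by blast
qed

section \<open>Smooth bump functions\<close>

lemma partial_deriv_eq: "(f has_derivative D) (at x) \<Longrightarrow> partial_deriv i f x = D (axis i 1)"
  unfolding partial_deriv_def using frechet_derivative_at by metis

lemma Ck_SucI:
  assumes "\<And>x. (f has_derivative D x) (at x)" "\<And>i. Ck k (\<lambda>x. D x (axis i 1))"
  shows "Ck (Suc k) f"
proof -
  have "partial_deriv i f = (\<lambda>x. D x (axis i 1))" for i using partial_deriv_eq[OF assms(1)] by auto
  moreover have "f differentiable_on UNIV"
    using assms(1) by (auto simp: differentiable_on_def differentiable_def)
  ultimately show ?thesis using assms(2) by simp
qed

lemma Ck_Suc_has_derivative: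
  assumes "Ck (Suc k) f" shows "(f has_derivative frechet_derivative f (at x)) (at x)"
  using assms frechet_derivative_works by (auto simp: differentiable_on_def)

lemma Ck_imp_continuous: "Ck k f \<Longrightarrow> continuous_on UNIV f"
  by (cases k) (auto intro: differentiable_imp_continuous_on)

lemma Ck_Suc_imp_Ck: "Ck (Suc k) f \<Longrightarrow> Ck k f"
proof (induction k arbitrary: f)
  case 0 then show ?case using Ck_imp_continuous[of "Suc 0"] by simp
next
  case (Suc k)
  have "Ck k (partial_deriv i f)" for i using Suc.prems by (intro Suc.IH) simp
  then show ?case using Suc.prems by simp
qed

lemma Ck_const: "Ck k (\<lambda>x. c)"
proof (induction k arbitrary: c)
  case (Suc k)
  show ?case by (rule Ck_SucI[of _ "\<lambda>x h. 0"]) (auto intro: Suc)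
qed simp

lemma Ck_add: "Ck k f \<Longrightarrow> Ck k g \<Longrightarrow> Ck k (\<lambda>x. f x + g x)"
proof (induction k arbitrary: f g)
  case 0 then show ?case by (auto intro: continuous_intros)
next
  case (Suc k)
  show ?case
  proof (rule Ck_SucI)
    show "((\<lambda>x. f x + g x) has_derivative (\<lambda>h. frechet_derivative f (at x) h + frechet_derivative g (at x) h)) (at x)" for x
      by (intro has_derivative_add Ck_Suc_has_derivative[of k] Suc.prems)
    show "Ck k (\<lambda>x. frechet_derivative f (at x) (axis i 1) + frechet_derivative g (at x) (axis i 1))" for i
      using Suc.IH[of "partial_deriv i f" "partial_deriv i g"] Suc.prems by (simp add: partial_deriv_def[abs_def])
  qed
qed

lemma Ck_mult: "Ck k f \<Longrightarrow> Ck k g \<Longrightarrow> Ck k (\<lambda>x. f x * g x)"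
proof (induction k arbitrary: f g)
  case 0 then show ?case by (auto intro: continuous_intros)
next
  case (Suc k)
  show ?case
  proof (rule Ck_SucI)
    show "((\<lambda>x. f x * g x) has_derivative (\<lambda>h. f x * frechet_derivative g (at x) h + frechet_derivative f (at x) h * g x)) (at x)" for x
      by (intro has_derivative_mult Ck_Suc_has_derivative[of k] Suc.prems)
    show "Ck k (\<lambda>x. f x * frechet_derivative g (at x) (axis i 1) + frechet_derivative f (at x) (axis i 1) * g x)" for i
      using Suc.IH[of f "partial_deriv i g"] Suc.IH[of "partial_deriv i f" g] Suc.prems Ck_Suc_imp_Ck
      by (intro Ck_add) (auto simp: partial_deriv_def[abs_def])
  qed
qed

lemma Ck_prod: "finite I \<Longrightarrow> (\<And>i. i \<in> I \<Longrightarrow> Ck k (f i)) \<Longrightarrow> Ck k (\<lambda>x. \<Prod>i\<in>I. f i x)"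
  by (induction I rule: finite_induct) (auto intro: Ck_const Ck_mult)

text \<open>The family \<open>t\<^sup>-\<^sup>n exp (-1/t)\<close>, extended by zero to the left: the derivative of a member is a
  combination of two members, so smoothness of all of them follows by a single induction.\<close>
definition flat :: "nat \<Rightarrow> real \<Rightarrow> real" where
  "flat n t = (if t > 0 then inverse t ^ n * exp (- inverse t) else 0)"

lemma flat_has_derivative:
  "(flat n has_real_derivative (flat (n + 2) t - real n * flat (n + 1) t)) (at t)"
proof -
  consider "t > 0" | "t < 0" | "t = 0" by linarith
  then show ?thesis
  proof cases
    case 1
    have "((\<lambda>t. inverse t ^ n * exp (- inverse t)) has_real_derivative
        (flat (n + 2) t - real n * flat (n + 1) t)) (at t)"
    proof (cases n)
      case 0
      show ?thesis using 1 unfolding 0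
        by (auto intro!: derivative_eq_intros simp: flat_def field_simps power2_eq_square)
    next
      case (Suc m)
      have "((\<lambda>t. inverse t ^ Suc m) has_real_derivative
          real (Suc m) * (- (inverse t ^ Suc (Suc 0)) * inverse t ^ m)) (at t)"
        using DERIV_power[OF DERIV_inverse[of t UNIV], of "Suc m"] 1 by simp
      moreover have "((\<lambda>t. exp (- inverse t)) has_real_derivative exp (- inverse t) * (inverse t ^ Suc (Suc 0))) (at t)"
        using 1 by (auto intro!: derivative_eq_intros)
      ultimately have "((\<lambda>t. inverse t ^ Suc m * exp (- inverse t)) has_real_derivative
          real (Suc m) * (- (inverse t ^ Suc (Suc 0)) * inverse t ^ m) * exp (- inverse t)
          + exp (- inverse t) * (inverse t ^ Suc (Suc 0)) * inverse t ^ Suc m) (at t)"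
        by (rule DERIV_mult)
      then show ?thesis using 1 unfolding Suc by (simp add: flat_def algebra_simps)
    qed
    then show ?thesis
      by (rule DERIV_cong_ev[THEN iffD1, rotated 3])
         (use eventually_nhds_in_open[of "{0<..}" t] 1 in \<open>auto elim!: eventually_mono simp: flat_def\<close>)
  next
    case 2
    have "((\<lambda>t. 0) has_real_derivative (flat (n + 2) t - real n * flat (n + 1) t)) (at t)"
      using 2 by (auto simp: flat_def)
    then show ?thesis
      by (rule DERIV_cong_ev[THEN iffD1, rotated 3])
         (use eventually_nhds_in_open[of "{..<0}" t] 2 in \<open>auto elim!: eventually_mono simp: flat_def\<close>)
  next
    case 3
    have r: "((\<lambda>h. (flat n (t + h) - flat n t) / h) \<longlongrightarrow> 0) (at_right 0)"
    proof -
      have "((\<lambda>x::real. x ^ (n+1) / exp x) \<longlongrightarrow> 0) at_top" by (rule tendsto_power_div_exp_0)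
      then have "((\<lambda>h::real. inverse h ^ (n+1) / exp (inverse h)) \<longlongrightarrow> 0) (at_right 0)"
        by (rule filterlim_compose[OF _ filterlim_inverse_at_top_right])
      then show ?thesis
        by (rule Lim_transform_eventually)
           (auto simp: eventually_at_filter flat_def 3 exp_minus field_simps intro!: always_eventually)
    qed
    have l: "((\<lambda>h. (flat n (t + h) - flat n t) / h) \<longlongrightarrow> 0) (at_left 0)"
      by (rule Lim_transform_eventually[OF tendsto_const])
         (auto simp: eventually_at_filter flat_def 3 intro!: always_eventually)
    have "((\<lambda>h. (flat n (t + h) - flat n t) / h) \<longlongrightarrow> 0) (at 0)"
      using r l by (simp add: filterlim_at_split)
    moreover have "flat (n + 2) t - real n * flat (n + 1) t = 0" by (simp add: flat_def 3)
    ultimately show ?thesis by (simp add: DERIV_def)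
  qed
qed

lemma flat_0_bounds: "0 \<le> flat 0 t" "flat 0 t \<le> 1" "flat 0 t > 0 \<longleftrightarrow> t > 0"
  by (auto simp: flat_def)

lemma Ck_flat: "Ck k (\<lambda>x. flat n (c * x $ i + d))"
proof (induction k arbitrary: n)
  have D: "((\<lambda>x::real^'a. flat n (c * x $ i + d)) has_derivative
     (\<lambda>h. (flat (n+2) (c * x $ i + d) - real n * flat (n+1) (c * x $ i + d)) * (c * h $ i))) (at x)" for n x
  proof -
    have a: "((\<lambda>x::real^'a. c * x $ i + d) has_derivative (\<lambda>h. c * h $ i)) (at x)"
      by (auto intro!: derivative_eq_intros has_derivative_const bounded_linear_imp_has_derivative
         bounded_linear_vec_nth bounded_linear_mult_right)
    show ?thesis
      using has_derivative_compose[OF a flat_has_derivative[of n, unfolded has_field_derivative_def]]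
      by (simp add: o_def mult.commute)
  qed
  {
    case 0
    have "continuous_on UNIV (\<lambda>x::real^'a. flat n (c * x $ i + d))"
      by (auto simp: continuous_on_eq_continuous_at intro: has_derivative_continuous[OF D])
    then show ?case by simp
  next
    case (Suc k)
    show ?case
    proof (rule Ck_SucI[OF D])
      fix j
      have "Ck k (\<lambda>x. (flat (n + 2) (c * x $ i + d) + (- real n) * flat (n + 1) (c * x $ i + d)) * (c * (axis j 1 :: real^'a) $ i))"
        by (intro Ck_mult Ck_add Ck_const Suc)
      then show "Ck k (\<lambda>x. (flat (n + 2) (c * x $ i + d) - real n * flat (n + 1) (c * x $ i + d)) * (c * (axis j 1 :: real^'a) $ i))"
        by simp
    qed
  }
qed

text \<open>For positive \<open>N\<close> a smooth approximation from below to the indicator of the box from \<open>a\<close> to \<open>b\<close>,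
  which becomes sharper as \<open>N\<close> grows.\<close>
definition bump :: "real \<Rightarrow> real^'n \<Rightarrow> real^'n \<Rightarrow> real^'n \<Rightarrow> real" where
  "bump N a b x = (\<Prod>i\<in>UNIV. flat 0 (N * (x $ i - a $ i)) * flat 0 (N * (b $ i - x $ i)))"

lemma Ck_bump: "Ck k (bump N a b)"
proof -
  have "Ck k (\<lambda>x. \<Prod>i\<in>UNIV. flat 0 (N * x $ i + (- N * a $ i)) * flat 0 ((-N) * x $ i + N * b $ i))"
    by (intro Ck_prod Ck_mult Ck_flat) auto
  then show ?thesis unfolding bump_def[abs_def] by (simp add: algebra_simps)
qed

lemma bump_bounds: "0 \<le> bump N a b x" "bump N a b x \<le> 1"
  unfolding bump_def
  by (auto intro!: prod_nonneg prod_le_1 mult_nonneg_nonneg mult_le_one simp: flat_0_bounds)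

lemma bump_pos_iff:
  assumes "N > 0" shows "bump N a b x > 0 \<longleftrightarrow> x \<in> box a b"
proof -
  have "bump N a b x \<noteq> 0 \<longleftrightarrow> (\<forall>i. flat 0 (N * (x $ i - a $ i)) > 0 \<and> flat 0 (N * (b $ i - x $ i)) > 0)"
    unfolding bump_def using flat_0_bounds(1) by (auto simp: less_le)
  also have "\<dots> \<longleftrightarrow> x \<in> box a b"
    using assms by (auto simp: flat_0_bounds mem_box_cart zero_less_mult_iff)
  finally show ?thesis using bump_bounds(1)[of N a b x] by linarith
qed

lemma bump_tendsto_indicator:
  "(\<lambda>N. bump (real (Suc N)) a b x) \<longlonglongrightarrow> indicator (box a b) x"
proof (cases "x \<in> box a b")
  case False
  then have "bump (real (Suc N)) a b x = 0" for N
    using bump_pos_iff[of "real (Suc N)" a b x] bump_bounds(1)[of "real (Suc N)" a b x] by simp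
  then show ?thesis using False by simp
next
  case True
  have lim: "(\<lambda>N. flat 0 (real (Suc N) * t)) \<longlonglongrightarrow> 1" if "t > 0" for t
  proof -
    have "(\<lambda>N. exp (- (inverse (real (Suc N)) * inverse t))) \<longlonglongrightarrow> exp (- (0 * inverse t))"
      by (intro tendsto_intros LIMSEQ_inverse_real_of_nat)
    then show ?thesis using that by (simp add: flat_def)
  qed
  have "(\<lambda>N. bump (real (Suc N)) a b x) \<longlonglongrightarrow> (\<Prod>i\<in>(UNIV::'a set). 1 * 1)"
    unfolding bump_def by (intro tendsto_intros lim) (use True in \<open>auto simp: mem_box_cart\<close>)
  then show ?thesis using True by simp
qed

lemma bump_mem_test_functions:
  assumes "N > 0" "cbox a b \<subseteq> \<Omega>" shows "bump N a b \<in> test_functions \<Omega>"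
proof -
  have "{x. bump N a b x \<noteq> 0} \<subseteq> cbox a b"
    using bump_pos_iff[OF assms(1), of a b] bump_bounds(1)[of N a b] box_subset_cbox[of a b]
    by (auto simp: less_le)
  then have "closure {x. bump N a b x \<noteq> 0} \<subseteq> cbox a b" by (simp add: closure_minimal closed_cbox)
  moreover have "compact (closure {x. bump N a b x \<noteq> 0})"
    using bounded_subset[OF bounded_cbox calculation] by (simp add: compact_eq_bounded_closed)
  ultimately show ?thesis using assms(2) Ck_bump by (auto simp: test_functions_def)
qed

definition grad :: "(real^'n \<Rightarrow> real) \<Rightarrow> real^'n \<Rightarrow> real^'n" where
  "grad f x = (\<chi> i. partial_deriv i f x)"

lemma test_function_Ck: "\<phi> \<in> test_functions \<Omega> \<Longrightarrow> Ck k \<phi>"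
  by (simp add: test_functions_def)

lemma has_derivative_imp_grad:
  assumes "(f has_derivative D) (at x)" shows "D = (\<lambda>h. grad f x \<bullet> h)"
proof
  fix h
  have lin: "linear D" using assms has_derivative_linear by blast
  have "D h = D (\<Sum>i\<in>UNIV. h $ i *\<^sub>R axis i 1)" by (simp add: basis_expansion scalar_mult_eq_scaleR[symmetric])
  also have "\<dots> = (\<Sum>i\<in>UNIV. h $ i * D (axis i 1))" using lin by (simp add: linear_sum linear_scale)
  also have "\<dots> = grad f x \<bullet> h" using partial_deriv_eq[OF assms] by (simp add: grad_def inner_vec_def mult.commute)
  finally show "D h = grad f x \<bullet> h" .
qed

lemma has_derivative_inner_imp_grad:
  assumes "(f has_derivative (\<lambda>h. p \<bullet> h)) (at x)" shows "grad f x = p"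
proof -
  have "(\<lambda>h. p \<bullet> h) = (\<lambda>h. grad f x \<bullet> h)" by (rule has_derivative_imp_grad[OF assms])
  then have "p \<bullet> h = grad f x \<bullet> h" for h by metis
  then show ?thesis using inner_eq_zero_iff[of "grad f x - p"] by (simp add: inner_diff_left)
qed

lemma Ck_has_derivative_grad:
  assumes "Ck (Suc k) f" shows "(f has_derivative (\<lambda>h. grad f x \<bullet> h)) (at x)"
  using Ck_Suc_has_derivative[OF assms, of x] has_derivative_imp_grad[OF Ck_Suc_has_derivative[OF assms, of x]] by simp

lemma Ck_continuous_grad:
  assumes "Ck (Suc k) f" shows "continuous_on UNIV (grad f)"
  unfolding grad_def[abs_def]
  by (intro continuous_on_vec_lambda) (use assms Ck_imp_continuous[of k] in auto)

lemma grad_eq_0_outside_support: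
  assumes "x \<notin> closure {x. f x \<noteq> 0}" shows "grad f x = 0"
proof (rule has_derivative_inner_imp_grad)
  have "open (- closure {x. f x \<noteq> 0})" by auto
  then have "((\<lambda>x. 0) has_derivative (\<lambda>h. 0 \<bullet> h)) (at x)" by simp
  then show "(f has_derivative (\<lambda>h. 0 \<bullet> h)) (at x)"
    by (rule has_derivative_transform_within_open[of _ _ _ _ "- closure {x. f x \<noteq> 0}"])
       (use assms closure_subset[of "{x. f x \<noteq> 0}"] in auto)
qed

lemma test_functions_mult:
  assumes "\<phi> \<in> test_functions \<Omega>" "\<And>k. Ck k f" shows "(\<lambda>x. f x * \<phi> x) \<in> test_functions \<Omega>"
proof -
  have "closure {x. f x * \<phi> x \<noteq> 0} \<subseteq> closure {x. \<phi> x \<noteq> 0}" by (rule closure_mono) auto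
  moreover have "compact (closure {x. f x * \<phi> x \<noteq> 0})"
    using assms(1) bounded_subset[OF _ calculation]
    by (auto simp: test_functions_def compact_eq_bounded_closed)
  ultimately show ?thesis using assms by (auto simp: test_functions_def intro: Ck_mult)
qed

section \<open>Calculus of test functions\<close>

lemma integrable_continuous_compact_support:
  fixes f :: "real^'n \<Rightarrow> 'b::euclidean_space"
  assumes "continuous_on UNIV f" "\<And>x. x \<notin> cball 0 R \<Longrightarrow> f x = 0"
  shows "integrable lborel f"
proof -
  have "integrable lborel (\<lambda>x. indicator (cball 0 R) x *\<^sub>R f x)"
    by (rule borel_integrable_compact) (use assms(1) in \<open>auto intro: continuous_on_subset\<close>)
  moreover have "(\<lambda>x. indicator (cball 0 R) x *\<^sub>R f x) = f"
    using assms(2) by (auto simp: indicator_def)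
  ultimately show ?thesis by simp
qed

lemma square_integrable_continuous_compact_support:
  fixes f :: "real^'n \<Rightarrow> 'b::euclidean_space"
  assumes "continuous_on UNIV f" "\<And>x. x \<notin> cball 0 R \<Longrightarrow> f x = 0"
  shows "square_integrable lborel f"
  unfolding square_integrable_def
proof
  show "integrable lborel (\<lambda>x. (norm (f x))\<^sup>2)"
    by (rule integrable_continuous_compact_support[of _ R]) (use assms in \<open>auto intro!: continuous_intros\<close>)
  show "f \<in> borel_measurable lborel" using borel_measurable_continuous_onI[OF assms(1)] by simp
qed

lemma bounded_continuous_compact_support:
  fixes f :: "real^'n \<Rightarrow> 'b::euclidean_space"
  assumes "continuous_on UNIV f" "\<And>x. x \<notin> cball 0 R \<Longrightarrow> f x = 0"
  shows "\<exists>B\<ge>0. \<forall>x. norm (f x) \<le> B"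
proof -
  have "bounded (f ` cball 0 R)"
    by (intro compact_imp_bounded compact_continuous_image continuous_on_subset[OF assms(1)]) auto
  then obtain B where "\<forall>y\<in>f ` cball 0 R. norm y \<le> B" unfolding bounded_iff by blast
  then have B: "\<And>x. x \<in> cball 0 R \<Longrightarrow> norm (f x) \<le> B" by blast
  then have "norm (f x) \<le> max B 0" for x using assms(2)[of x] by (cases "x \<in> cball 0 R") (auto simp: le_max_iff_disj)
  then show ?thesis by (intro exI[of _ "max B 0"]) auto
qed

lemma lborel_integral_translation:
  fixes f :: "'a::euclidean_space \<Rightarrow> 'b::{banach, second_countable_topology}"
  assumes "f \<in> borel_measurable borel"
  shows "(LINT x|lborel. f (c + x)) = (LINT x|lborel. f x)"
proof -
  have "(LINT x|lborel. f x) = (LINT x|distr lborel borel ((+) c). f x)" by (simp add: lborel_distr_plus)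
  also have "\<dots> = (LINT x|lborel. f (c + x))" by (rule integral_distr) (use assms in auto)
  finally show ?thesis by simp
qed

text \<open>Difference quotients of a compactly supported \<open>C\<^sup>1\<close> function converge boundedly to the
  directional derivative. The integral of a difference quotient vanishes by translation
  invariance. By the triangle inequality and translation invariance, the \<open>L\<^sup>2\<close> norm of the difference for
  the full step \<open>s\<close> is at most that of the difference quotient for the step \<open>s / (m + 1)\<close>.\<close>
lemma
  fixes \<phi> :: "real^'n \<Rightarrow> real"
  assumes C1: "Ck (Suc 0) \<phi>" and supp: "\<And>x. x \<notin> cball 0 R \<Longrightarrow> \<phi> x = 0"
  shows integral_directional_derivative: "(LINT x|lborel. grad \<phi> x \<bullet> s) = 0"
    and translation_estimate: "(LINT x|lborel. (\<phi> (x + s) - \<phi> x)\<^sup>2) \<le> (norm s)\<^sup>2 * (LINT x|lborel. (norm (grad \<phi> x))\<^sup>2)"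
proof -
  have der: "(\<phi> has_derivative (\<lambda>h. grad \<phi> x \<bullet> h)) (at x)" for x by (rule Ck_has_derivative_grad[OF C1])
  have cg: "continuous_on UNIV (grad \<phi>)" by (rule Ck_continuous_grad[OF C1])
  have c: "continuous_on UNIV \<phi>" by (rule Ck_imp_continuous[OF C1])
  have gsupp: "grad \<phi> x = 0" if "x \<notin> cball 0 R" for x
  proof (rule grad_eq_0_outside_support)
    have "{x. \<phi> x \<noteq> 0} \<subseteq> cball 0 R" using supp by blast
    then have "closure {x. \<phi> x \<noteq> 0} \<subseteq> cball 0 R" by (simp add: closure_minimal)
    then show "x \<notin> closure {x. \<phi> x \<noteq> 0}" using that by auto
  qed
  obtain B where B: "B \<ge> 0" "\<And>x. norm (grad \<phi> x) \<le> B"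
    using bounded_continuous_compact_support[OF cg gsupp] by blast
  have lip: "\<bar>\<phi> (x + h) - \<phi> x\<bar> \<le> B * norm h" for x h
  proof -
    have "norm (\<phi> (x + h) - \<phi> x) \<le> B * norm ((x + h) - x)"
    proof (rule differentiable_bound[where S = UNIV and f' = "\<lambda>x h. grad \<phi> x \<bullet> h"])
      show "onorm (\<lambda>h. grad \<phi> x \<bullet> h) \<le> B" for x
      proof (rule onorm_bound[OF B(1)])
        show "norm (grad \<phi> x \<bullet> h) \<le> B * norm h" for h
          using Cauchy_Schwarz_ineq2[of "grad \<phi> x" h] mult_right_mono[OF B(2)[of x] norm_ge_zero[of h]] by simp
      qed
    qed (use der in auto)
    then show ?thesis by simp
  qed
  have cs: "continuous_on UNIV (\<lambda>x. \<phi> (x + h))" for h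
    by (rule continuous_on_compose2[OF c]) (auto intro!: continuous_intros)
  define q where "q m x = real (Suc m) * (\<phi> (x + inverse (real (Suc m)) *\<^sub>R s) - \<phi> x)" for m x
  have cq: "continuous_on UNIV (q m)" for m
    unfolding q_def[abs_def] by (intro continuous_intros cs c)
  have q_lim: "(\<lambda>m. q m x) \<longlonglongrightarrow> grad \<phi> x \<bullet> s" for x
  proof -
    have d1: "((\<lambda>t. x + t *\<^sub>R s) has_derivative (\<lambda>t. t *\<^sub>R s)) (at 0)"
      by (auto intro!: derivative_eq_intros)
    have d2: "(\<lambda>t. grad \<phi> x \<bullet> (t *\<^sub>R s)) = (*) (grad \<phi> x \<bullet> s)" by (auto simp: mult.commute)
    have "((\<lambda>t. \<phi> (x + t *\<^sub>R s)) has_derivative (\<lambda>t. grad \<phi> x \<bullet> (t *\<^sub>R s))) (at 0)"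
      using has_derivative_compose[OF d1, of \<phi> "\<lambda>h. grad \<phi> x \<bullet> h"] der by simp
    then have "((\<lambda>t. \<phi> (x + t *\<^sub>R s)) has_real_derivative (grad \<phi> x \<bullet> s)) (at 0)"
      unfolding has_field_derivative_def d2 .
    then have "((\<lambda>h. (\<phi> (x + h *\<^sub>R s) - \<phi> x) / h) \<longlongrightarrow> grad \<phi> x \<bullet> s) (at 0)"
      by (simp add: DERIV_def)
    moreover have "filterlim (\<lambda>m. inverse (real (Suc m))) (at 0) sequentially"
      unfolding filterlim_at using LIMSEQ_inverse_real_of_nat by (auto intro: always_eventually)
    ultimately have "(\<lambda>m. (\<phi> (x + inverse (real (Suc m)) *\<^sub>R s) - \<phi> x) / inverse (real (Suc m))) \<longlonglongrightarrow> grad \<phi> x \<bullet> s"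
      by (rule filterlim_compose)
    then show ?thesis by (simp add: q_def divide_inverse mult.commute)
  qed
  have q_bound: "\<bar>q m x\<bar> \<le> B * norm s" for m x
  proof -
    have "\<bar>q m x\<bar> = real (Suc m) * \<bar>\<phi> (x + inverse (real (Suc m)) *\<^sub>R s) - \<phi> x\<bar>"
      by (simp add: q_def abs_mult)
    also have "\<dots> \<le> real (Suc m) * (B * norm (inverse (real (Suc m)) *\<^sub>R s))"
      by (rule mult_left_mono[OF lip]) simp
    also have "\<dots> = B * norm s" by (simp add: field_simps)
    finally show ?thesis .
  qed
  define R' where "R' = R + norm s"
  have q_supp: "q m x = 0" if "x \<notin> cball 0 R'" for m x
  proof -
    have n: "norm x > R + norm s" using that by (simp add: R'_def)
    have "norm (inverse (real (Suc m)) *\<^sub>R s) \<le> norm s"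
      by (simp add: mult_left_le_one_le inverse_le_1_iff)
    then have "norm (x + inverse (real (Suc m)) *\<^sub>R s) > R"
      using n norm_diff_ineq[of x "inverse (real (Suc m)) *\<^sub>R s"] by linarith
    moreover have "norm x > R" using n norm_ge_zero[of s] by linarith
    ultimately show ?thesis unfolding q_def by (subst (1 2) supp) auto
  qed
  define D where "D x = B * norm s * indicator (cball 0 R') x" for x :: "real^'n"
  have q_dom: "\<bar>q m x\<bar> \<le> D x" for m x
    using q_bound[of m x] q_supp[of x m] by (auto simp: D_def indicator_def split: if_splits)
  have intind: "integrable lborel (\<lambda>x. c * indicator (cball (0::real^'n) R') x)" for c :: real
    by (intro integrable_mult_right integrable_real_indicator emeasure_bounded_finite) auto
  have dint: "integrable lborel D" unfolding D_def[abs_def] by (rule intind)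
  have cgs: "continuous_on UNIV (\<lambda>x. grad \<phi> x \<bullet> s)" by (intro continuous_intros cg)
  have meas: "f \<in> borel_measurable borel" if "continuous_on UNIV f" for f :: "real^'n \<Rightarrow> real"
    using borel_measurable_continuous_onI[OF that] by simp
  have "(\<lambda>m. LINT x|lborel. q m x) \<longlonglongrightarrow> (LINT x|lborel. grad \<phi> x \<bullet> s)"
    by (rule integral_dominated_convergence[where w = D])
      (use q_lim q_dom dint in \<open>auto intro: meas cq cgs\<close>)
  moreover have "(LINT x|lborel. q m x) = 0" for m
  proof -
    let ?h = "inverse (real (Suc m)) *\<^sub>R s"
    have i0: "integrable lborel \<phi>" by (rule integrable_continuous_compact_support[OF c supp])
    have bm: "\<phi> \<in> borel_measurable borel" by (rule meas[OF c])
    have i1: "integrable lborel (\<lambda>x. \<phi> (x + ?h))"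
    proof (rule integrable_continuous_compact_support[OF cs, of "R + norm ?h"])
      fix x :: "real^'n" assume "x \<notin> cball 0 (R + norm ?h)"
      then have "norm (x + ?h) > R" using norm_diff_ineq[of x ?h] by auto
      then show "\<phi> (x + ?h) = 0" by (intro supp) auto
    qed
    have "(LINT x|lborel. \<phi> (x + ?h)) = (LINT x|lborel. \<phi> x)"
      using lborel_integral_translation[OF bm, of ?h] by (simp add: add.commute)
    then show ?thesis using i0 i1 by (simp add: q_def[abs_def])
  qed
  ultimately show "(LINT x|lborel. grad \<phi> x \<bullet> s) = 0" by (simp add: LIMSEQ_const_iff)
  have q2lim: "(\<lambda>m. LINT x|lborel. (q m x)\<^sup>2) \<longlonglongrightarrow> (LINT x|lborel. (grad \<phi> x \<bullet> s)\<^sup>2)"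
  proof (rule integral_dominated_convergence[where w = "\<lambda>x. (B * norm s)\<^sup>2 * indicator (cball 0 R') x"])
    show "AE x in lborel. norm ((q m x)\<^sup>2) \<le> (B * norm s)\<^sup>2 * indicator (cball 0 R') x" for m
    proof (intro always_eventually allI)
      fix x
      have "(q m x)\<^sup>2 \<le> (B * norm s)\<^sup>2" using q_bound[of m x] by (metis abs_ge_zero power2_abs power_mono)
      then show "norm ((q m x)\<^sup>2) \<le> (B * norm s)\<^sup>2 * indicator (cball 0 R') x"
        using q_supp[of x m] by (auto simp: indicator_def)
    qed
  qed (use q_lim intind in \<open>auto intro!: meas continuous_intros cq cg tendsto_power\<close>)
  define d where "d h = l2norm lborel (\<lambda>x. \<phi> (x + h) - \<phi> x)" for h
  have sqs: "square_integrable lborel (\<lambda>x. \<phi> (x + h))" for h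
  proof (rule square_integrable_continuous_compact_support[OF cs, of "R + norm h"])
    fix x :: "real^'n" assume "x \<notin> cball 0 (R + norm h)"
    then have "norm (x + h) > R" using norm_diff_ineq[of x h] by auto
    then show "\<phi> (x + h) = 0" by (intro supp) auto
  qed
  have iter: "d (real k *\<^sub>R h) \<le> real k * d h" for k h
  proof (induction k)
    case 0 show ?case by (simp add: d_def l2norm_def)
  next
    case (Suc k)
    have "d (real (Suc k) *\<^sub>R h) \<le> l2norm lborel (\<lambda>x. \<phi> (x + real (Suc k) *\<^sub>R h) - \<phi> (x + h)) + d h"
      unfolding d_def using sqs[of 0] by (intro l2norm_triangle_diff sqs) simp
    also have "l2norm lborel (\<lambda>x. \<phi> (x + real (Suc k) *\<^sub>R h) - \<phi> (x + h)) = d (real k *\<^sub>R h)"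
    proof -
      have "(LINT x|lborel. (norm (\<phi> ((h + x) + real k *\<^sub>R h) - \<phi> (h + x)))\<^sup>2)
          = (LINT x|lborel. (norm (\<phi> (x + real k *\<^sub>R h) - \<phi> x))\<^sup>2)"
        by (rule lborel_integral_translation[of "\<lambda>x. (norm (\<phi> (x + real k *\<^sub>R h) - \<phi> x))\<^sup>2"])
           (intro borel_measurable_continuous_onI continuous_intros cs c)
      then show ?thesis by (simp add: d_def l2norm_def algebra_simps)
    qed
    finally show ?case using Suc by (simp add: algebra_simps)
  qed
  have "(LINT x|lborel. (\<phi> (x + s) - \<phi> x)\<^sup>2) \<le> (LINT x|lborel. (q m x)\<^sup>2)" for m
  proof -
    let ?h = "inverse (real (Suc m)) *\<^sub>R s"
    have "d s \<le> real (Suc m) * d ?h" using iter[of "Suc m" ?h] by simp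
    then have "(d s)\<^sup>2 \<le> (real (Suc m) * d ?h)\<^sup>2" by (rule power_mono) (simp add: d_def)
    also have "\<dots> = (LINT x|lborel. (q m x)\<^sup>2)"
      by (simp add: d_def l2norm_def q_def power_mult_distrib)
    finally show ?thesis by (simp add: d_def l2norm_def)
  qed
  then have "(LINT x|lborel. (\<phi> (x + s) - \<phi> x)\<^sup>2) \<le> (LINT x|lborel. (grad \<phi> x \<bullet> s)\<^sup>2)"
    by (intro LIMSEQ_le_const[OF q2lim]) auto
  also have "\<dots> \<le> (LINT x|lborel. (norm s)\<^sup>2 * (norm (grad \<phi> x))\<^sup>2)"
  proof (rule integral_mono)
    show "integrable lborel (\<lambda>x. (grad \<phi> x \<bullet> s)\<^sup>2)"
      by (rule integrable_continuous_compact_support[of _ R]) (use gsupp in \<open>auto intro!: continuous_intros cg\<close>)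
    show "integrable lborel (\<lambda>x. (norm s)\<^sup>2 * (norm (grad \<phi> x))\<^sup>2)"
      by (rule integrable_continuous_compact_support[of _ R]) (use gsupp in \<open>auto intro!: continuous_intros cg\<close>)
    fix x
    have "(grad \<phi> x \<bullet> s)\<^sup>2 \<le> (norm (grad \<phi> x) * norm s)\<^sup>2"
      using Cauchy_Schwarz_ineq2[of "grad \<phi> x" s] by (metis abs_ge_zero power2_abs power_mono)
    then show "(grad \<phi> x \<bullet> s)\<^sup>2 \<le> (norm s)\<^sup>2 * (norm (grad \<phi> x))\<^sup>2" by (simp add: power_mult_distrib mult.commute)
  qed
  finally show "(LINT x|lborel. (\<phi> (x + s) - \<phi> x)\<^sup>2) \<le> (norm s)\<^sup>2 * (LINT x|lborel. (norm (grad \<phi> x))\<^sup>2)" by simp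
qed

section \<open>Integrals over the domain\<close>

lemma
  fixes f :: "real^'n \<Rightarrow> 'b::euclidean_space"
  assumes "open \<Omega>" "f \<in> borel_measurable borel" "\<And>x. x \<notin> \<Omega> \<Longrightarrow> f x = 0"
  shows integral_lebesgue_on_eq_lborel: "(LINT x|lebesgue_on \<Omega>. f x) = (LINT x|lborel. f x)"
    and integrable_lebesgue_on_iff_lborel: "integrable (lebesgue_on \<Omega>) f \<longleftrightarrow> integrable lborel f"
proof -
  have O: "\<Omega> \<inter> space lebesgue \<in> sets lebesgue" using assms(1) by simp
  have eq: "(\<lambda>x. indicator \<Omega> x *\<^sub>R f x) = f" using assms(3) by (auto simp: indicator_def)
  show "(LINT x|lebesgue_on \<Omega>. f x) = (LINT x|lborel. f x)"
    unfolding integral_restrict_space[OF O] eq using assms(2) by (intro integral_completion) simp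
  show "integrable (lebesgue_on \<Omega>) f \<longleftrightarrow> integrable lborel f"
    unfolding integrable_restrict_space[OF O] eq using assms(2) by (intro integrable_completion) simp
qed

lemma test_function_support_radius:
  assumes "\<phi> \<in> test_functions \<Omega>"
  shows "\<exists>R. \<forall>x. x \<notin> cball 0 R \<longrightarrow> \<phi> x = 0 \<and> grad \<phi> x = 0"
proof -
  let ?K = "closure {x. \<phi> x \<noteq> 0}"
  have "bounded ?K" using assms by (auto simp: test_functions_def compact_imp_bounded)
  then obtain R where R: "?K \<subseteq> cball 0 R" unfolding bounded_iff by (auto simp: subset_iff)
  have "\<phi> x = 0" if "x \<notin> cball 0 R" for x using that R closure_subset[of "{x. \<phi> x \<noteq> 0}"] by auto
  moreover have "grad \<phi> x = 0" if "x \<notin> cball 0 R" for x using that R by (intro grad_eq_0_outside_support) auto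
  ultimately show ?thesis by blast
qed

lemma test_function_zero_outside:
  assumes "\<phi> \<in> test_functions \<Omega>" "x \<notin> \<Omega>" shows "\<phi> x = 0" "grad \<phi> x = 0"
proof -
  have n: "x \<notin> closure {x. \<phi> x \<noteq> 0}" using assms by (auto simp: test_functions_def)
  then show "grad \<phi> x = 0" by (rule grad_eq_0_outside_support)
  show "\<phi> x = 0" using n closure_subset[of "{x. \<phi> x \<noteq> 0}"] by auto
qed

lemma test_function_continuous:
  assumes "\<phi> \<in> test_functions \<Omega>" shows "continuous_on UNIV \<phi>" "continuous_on UNIV (grad \<phi>)"
  using Ck_imp_continuous[OF test_function_Ck[OF assms, of 0]] Ck_continuous_grad[OF test_function_Ck[OF assms, of "Suc 0"]]
  by auto

lemma borel_imp_lebesgue_on: "f \<in> borel_measurable borel \<Longrightarrow> f \<in> borel_measurable (lebesgue_on \<Omega>)"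
  by (intro measurable_restrict_space1) (auto intro: measurable_completion)

lemma test_function_square_integrable:
  assumes O: "open \<Omega>" and \<phi>: "\<phi> \<in> test_functions \<Omega>"
  shows "square_integrable (lebesgue_on \<Omega>) \<phi>" "square_integrable (lebesgue_on \<Omega>) (grad \<phi>)"
proof -
  note c = test_function_continuous[OF \<phi>]
  obtain R where R: "\<And>x. x \<notin> cball 0 R \<Longrightarrow> \<phi> x = 0" "\<And>x. x \<notin> cball 0 R \<Longrightarrow> grad \<phi> x = 0"
    using test_function_support_radius[OF \<phi>] by blast
  note z = test_function_zero_outside[OF \<phi>]
  show "square_integrable (lebesgue_on \<Omega>) \<phi>"
    unfolding square_integrable_def
  proof
    show "\<phi> \<in> borel_measurable (lebesgue_on \<Omega>)"
      by (rule borel_imp_lebesgue_on[OF borel_measurable_continuous_onI[OF c(1)]])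
    show "integrable (lebesgue_on \<Omega>) (\<lambda>x. (norm (\<phi> x))\<^sup>2)"
      using square_integrable_continuous_compact_support[OF c(1) R(1)] z(1)
      by (subst integrable_lebesgue_on_iff_lborel[OF O])
         (auto simp: square_integrable_def intro!: borel_measurable_continuous_onI continuous_intros c)
  qed
  show "square_integrable (lebesgue_on \<Omega>) (grad \<phi>)"
    unfolding square_integrable_def
  proof
    show "grad \<phi> \<in> borel_measurable (lebesgue_on \<Omega>)"
      by (rule borel_imp_lebesgue_on[OF borel_measurable_continuous_onI[OF c(2)]])
    show "integrable (lebesgue_on \<Omega>) (\<lambda>x. (norm (grad \<phi> x))\<^sup>2)"
      using square_integrable_continuous_compact_support[OF c(2) R(2)] z(2)
      by (subst integrable_lebesgue_on_iff_lborel[OF O])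
         (auto simp: square_integrable_def intro!: borel_measurable_continuous_onI continuous_intros c)
  qed
qed

lemma square_integrable_component:
  fixes f :: "'a \<Rightarrow> real^'n"
  assumes "square_integrable M f" shows "square_integrable M (\<lambda>x. f x $ i)"
proof -
  have m: "(\<lambda>x. f x $ i) \<in> borel_measurable M"
    using assms measurable_compose[of f M borel "\<lambda>x. x $ i" borel] by (auto simp: square_integrable_def)
  have "integrable M (\<lambda>x. (norm (f x $ i))\<^sup>2)"
  proof (rule Bochner_Integration.integrable_bound)
    show "integrable M (\<lambda>x. (norm (f x))\<^sup>2)" using assms by (simp add: square_integrable_def)
    show "(\<lambda>x. (norm (f x $ i))\<^sup>2) \<in> borel_measurable M" using m by measurable
    have "(norm (f x $ i))\<^sup>2 \<le> (norm (f x))\<^sup>2" for x by (intro power_mono Finite_Cartesian_Product.norm_nth_le) auto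
    then show "AE x in M. norm ((norm (f x $ i))\<^sup>2) \<le> norm ((norm (f x))\<^sup>2)" by simp
  qed
  with m show ?thesis by (simp add: square_integrable_def)
qed

lemma grad_nth: "grad f x $ i = partial_deriv i f x" by (simp add: grad_def)

lemma grad_mult:
  assumes "(f has_derivative Df) (at x)" "(g has_derivative Dg) (at x)"
  shows "grad (\<lambda>x. f x * g x) x = f x *\<^sub>R grad g x + g x *\<^sub>R grad f x"
proof (rule has_derivative_inner_imp_grad)
  have "((\<lambda>x. f x * g x) has_derivative (\<lambda>h. f x * Dg h + Df h * g x)) (at x)"
    by (rule has_derivative_mult[OF assms])
  moreover have "(\<lambda>h. f x * Dg h + Df h * g x) = (\<lambda>h. (f x *\<^sub>R grad g x + g x *\<^sub>R grad f x) \<bullet> h)"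
    unfolding has_derivative_imp_grad[OF assms(1)] has_derivative_imp_grad[OF assms(2)]
    by (auto simp: inner_add_left)
  ultimately show "((\<lambda>x. f x * g x) has_derivative (\<lambda>h. (f x *\<^sub>R grad g x + g x *\<^sub>R grad f x) \<bullet> h)) (at x)" by simp
qed

text \<open>The integral of a partial derivative of the test function \<open>u \<phi>\<close> vanishes.\<close>
lemma integration_by_parts:
  assumes O: "open \<Omega>" and u: "u \<in> test_functions \<Omega>" and \<phi>: "\<phi> \<in> test_functions \<Omega>"
  shows "(LINT x|lebesgue_on \<Omega>. u x * partial_deriv i \<phi> x) = - (LINT x|lebesgue_on \<Omega>. grad u x $ i * \<phi> x)"
proof -
  have t: "(\<lambda>x. u x * \<phi> x) \<in> test_functions \<Omega>" by (rule test_functions_mult[OF \<phi> test_function_Ck[OF u]])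
  obtain R where R: "\<And>x. x \<notin> cball 0 R \<Longrightarrow> u x * \<phi> x = 0"
    using test_function_support_radius[OF t] by meson
  have g: "grad (\<lambda>x. u x * \<phi> x) x \<bullet> axis i 1 = u x * partial_deriv i \<phi> x + grad u x $ i * \<phi> x" for x
    by (subst grad_mult[OF Ck_has_derivative_grad[OF test_function_Ck[OF u]] Ck_has_derivative_grad[OF test_function_Ck[OF \<phi>]]])
       (simp add: inner_axis grad_nth mult.commute)
  have "0 = (LINT x|lborel. grad (\<lambda>x. u x * \<phi> x) x \<bullet> axis i 1)"
    using integral_directional_derivative[OF test_function_Ck[OF t] R] by simp
  also have "\<dots> = (LINT x|lebesgue_on \<Omega>. grad (\<lambda>x. u x * \<phi> x) x \<bullet> axis i 1)"
    by (rule integral_lebesgue_on_eq_lborel[OF O, symmetric])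
       (use test_function_zero_outside[OF t] in \<open>auto intro!: borel_measurable_continuous_onI continuous_intros test_function_continuous[OF t]\<close>)
  also have "\<dots> = (LINT x|lebesgue_on \<Omega>. u x * partial_deriv i \<phi> x) + (LINT x|lebesgue_on \<Omega>. grad u x $ i * \<phi> x)"
  proof -
    note su = test_function_square_integrable[OF O u]
    note sp = test_function_square_integrable[OF O \<phi>]
    have "integrable (lebesgue_on \<Omega>) (\<lambda>x. u x * partial_deriv i \<phi> x)" "integrable (lebesgue_on \<Omega>) (\<lambda>x. grad u x $ i * \<phi> x)"
      using square_integrable_inner[OF su(1) square_integrable_component[OF sp(2)]]
        square_integrable_inner[OF square_integrable_component[OF su(2)] sp(1)]
      by (simp_all add: grad_nth)
    then show ?thesis unfolding g by simp
  qed
  finally show ?thesis by simp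
qed

section \<open>The fundamental lemma of the calculus of variations\<close>

text \<open>The positive and the negative part are densities of two finite measures that agree on boxes.\<close>
lemma AE_zero_if_integral_boxes_zero:
  fixes h :: "real^'n \<Rightarrow> real"
  assumes h: "integrable lborel h" and zero: "\<And>c d. (LINT x|lborel. h x * indicator (box c d) x) = 0"
  shows "AE x in lborel. h x = 0"
proof -
  have hm [measurable]: "h \<in> borel_measurable borel" using h by auto
  let ?p = "\<lambda>x. ennreal (max 0 (h x))" and ?n = "\<lambda>x. ennreal (max 0 (- h x))"
  let ?E = "range (\<lambda>(a, b). box a b::(real^'n) set)"
  let ?A = "\<lambda>n::nat. box (- (real n *\<^sub>R One)) (real n *\<^sub>R One) :: (real^'n) set"
  have ip: "integrable lborel (\<lambda>x. max 0 (h x))" "integrable lborel (\<lambda>x. max 0 (- h x))" using h by auto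
  have fin: "integral\<^sup>N lborel ?p \<noteq> \<infinity>" using ip(1) by (subst nn_integral_eq_integral) auto
  have box: "emeasure (density lborel ?p) (box c d) = ennreal (LINT x|lborel. max 0 (h x) * indicator (box c d) x)"
       "emeasure (density lborel ?n) (box c d) = ennreal (LINT x|lborel. max 0 (- h x) * indicator (box c d) x)" for c d
  proof -
    have *: "emeasure (density lborel (\<lambda>x. ennreal (f x))) (box c d) = ennreal (LINT x|lborel. f x * indicator (box c d) x)"
      if f: "integrable lborel f" "\<And>x. 0 \<le> f x" for f
    proof -
      have "emeasure (density lborel (\<lambda>x. ennreal (f x))) (box c d) = (\<integral>\<^sup>+x. ennreal (f x) * indicator (box c d) x \<partial>lborel)"
        using f by (intro emeasure_density) auto
      also have "\<dots> = (\<integral>\<^sup>+x. ennreal (f x * indicator (box c d) x) \<partial>lborel)"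
        by (intro nn_integral_cong) (auto simp: indicator_def)
      also have "\<dots> = ennreal (LINT x|lborel. f x * indicator (box c d) x)"
        using f by (intro nn_integral_eq_integral integrable_real_mult_indicator) auto
      finally show ?thesis .
    qed
    show "emeasure (density lborel ?p) (box c d) = ennreal (LINT x|lborel. max 0 (h x) * indicator (box c d) x)"
      "emeasure (density lborel ?n) (box c d) = ennreal (LINT x|lborel. max 0 (- h x) * indicator (box c d) x)"
      by (intro * ip; simp)+
  qed
  have "density lborel ?p = density lborel ?n"
  proof (rule measure_eqI_generator_eq[where E = ?E and \<Omega> = UNIV and A = ?A])
    show "Int_stable ?E" by (auto simp: Int_stable_def box_Int_box)
    show "?E \<subseteq> Pow UNIV" "sets (density lborel ?p) = sigma_sets UNIV ?E" "sets (density lborel ?n) = sigma_sets UNIV ?E"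
      by (simp_all add: borel_eq_box)
    show "range ?A \<subseteq> ?E" "(\<Union>i. ?A i) = UNIV" unfolding UN_box_eq_UNIV by auto
    show "emeasure (density lborel ?p) (?A i) \<noteq> \<infinity>" for i unfolding box by simp
    fix X assume "X \<in> ?E"
    then obtain c d where X: "X = box c d" by auto
    have "(LINT x|lborel. max 0 (h x) * indicator X x) - (LINT x|lborel. max 0 (- h x) * indicator X x)
        = (LINT x|lborel. max 0 (h x) * indicator X x - max 0 (- h x) * indicator X x)"
      using ip by (intro Bochner_Integration.integral_diff[symmetric] integrable_real_mult_indicator) (auto simp: X)
    also have "\<dots> = (LINT x|lborel. h x * indicator X x)"
      by (intro Bochner_Integration.integral_cong) (auto simp: indicator_def)
    also have "\<dots> = 0" using zero by (simp add: X)
    finally show "emeasure (density lborel ?p) X = emeasure (density lborel ?n) X" unfolding X box by simp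
  qed
  then have "AE x in lborel. ?p x = ?n x"
    using finite_density_unique[of ?p lborel ?n] fin by simp
  then show ?thesis by eventually_elim (auto simp: max_def split: if_splits)
qed

text \<open>Bump functions converge boundedly to the indicator of a box inside \<open>\<Omega>\<close>, so the integrals of \<open>g\<close>
  over such boxes vanish, and countably many boxes cover \<open>\<Omega>\<close>.\<close>
lemma fundamental_lemma:
  fixes g :: "real^'n \<Rightarrow> real"
  assumes O: "open \<Omega>" and g: "integrable (lebesgue_on \<Omega>) g"
    and zero: "\<And>\<phi>. \<phi> \<in> test_functions \<Omega> \<Longrightarrow> (LINT x|lebesgue_on \<Omega>. g x * \<phi> x) = 0"
  shows "AE x in lebesgue_on \<Omega>. g x = 0"
proof -
  have Os: "\<Omega> \<inter> space lebesgue \<in> sets lebesgue" using O by simp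
  have gm [measurable]: "g \<in> borel_measurable (lebesgue_on \<Omega>)" using g by auto
  have box0: "(LINT x|lebesgue_on \<Omega>. g x * indicator (box a b) x) = 0" if ab: "cbox a b \<subseteq> \<Omega>" for a b
  proof -
    have bm: "bump N a b \<in> borel_measurable (lebesgue_on \<Omega>)" for N
      by (intro borel_imp_lebesgue_on borel_measurable_continuous_onI Ck_imp_continuous[OF Ck_bump])
    have im: "(indicator (box a b) :: real^'n \<Rightarrow> real) \<in> borel_measurable (lebesgue_on \<Omega>)"
      by (intro borel_imp_lebesgue_on) auto
    have "(\<lambda>N. LINT x|lebesgue_on \<Omega>. g x * bump (real (Suc N)) a b x) \<longlonglongrightarrow> (LINT x|lebesgue_on \<Omega>. g x * indicator (box a b) x)"
    proof (rule integral_dominated_convergence[where w = "\<lambda>x. \<bar>g x\<bar>"])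
      show "AE x in lebesgue_on \<Omega>. norm (g x * bump (real (Suc N)) a b x) \<le> \<bar>g x\<bar>" for N
        by (intro always_eventually allI) (simp add: abs_mult mult_left_le bump_bounds)
      show "AE x in lebesgue_on \<Omega>. (\<lambda>N. g x * bump (real (Suc N)) a b x) \<longlonglongrightarrow> g x * indicator (box a b) x"
        by (intro always_eventually allI tendsto_mult tendsto_const bump_tendsto_indicator)
    qed (use g im in \<open>auto intro!: borel_measurable_times bm\<close>)
    moreover have "(LINT x|lebesgue_on \<Omega>. g x * bump (real (Suc N)) a b x) = 0" for N
      by (rule zero, rule bump_mem_test_functions[OF _ ab]) simp
    ultimately show ?thesis by (simp add: LIMSEQ_const_iff)
  qed
  have onbox: "AE x in lebesgue. x \<in> box a b \<longrightarrow> g x = 0" if ab: "cbox a b \<subseteq> \<Omega>" for a b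
  proof -
    define G where "G x = g x * indicator (box a b) x" for x
    have sub: "box a b \<subseteq> \<Omega>" using ab box_subset_cbox by blast
    have Gint: "integrable lebesgue G"
    proof -
      have "integrable (lebesgue_on \<Omega>) G" unfolding G_def[abs_def]
        by (rule integrable_real_mult_indicator[OF _ g]) (use sub in \<open>auto simp: sets_restrict_space\<close>)
      then have "integrable lebesgue (\<lambda>x. indicator \<Omega> x *\<^sub>R G x)" by (simp add: integrable_restrict_space[OF Os])
      moreover have "(\<lambda>x. indicator \<Omega> x *\<^sub>R G x) = G" using sub by (auto simp: fun_eq_iff G_def indicator_def)
      ultimately show ?thesis by simp
    qed
    then obtain h where h: "h \<in> borel_measurable lborel" "AE x in lborel. G x = h x"
      using completion_ex_borel_measurable_real[OF borel_measurable_integrable] by blast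
    have ae: "AE x in lebesgue. G x = h x" using h(2) by (rule AE_completion)
    have hm: "h \<in> borel_measurable lebesgue" using h(1) by (rule measurable_completion)
    have hint: "integrable lebesgue h" using integrable_cong_AE_imp[OF Gint hm] ae by (auto simp: eq_commute)
    then have hint': "integrable lborel h" using integrable_completion[of h lborel] h(1) by simp
    have "AE x in lborel. h x = 0"
    proof (rule AE_zero_if_integral_boxes_zero[OF hint'])
      fix c d :: "real^'n"
      have mi: "(\<lambda>x. h x * indicator (box c d) x) \<in> borel_measurable lborel" using h(1) by auto
      have "(LINT x|lborel. h x * indicator (box c d) x) = (LINT x|lebesgue. h x * indicator (box c d) x)"
        using integral_completion[OF mi] by simp
      also have "\<dots> = (LINT x|lebesgue. G x * indicator (box c d) x)"
      proof (rule integral_cong_AE)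
        show "AE x in lebesgue. h x * indicator (box c d) x = G x * indicator (box c d) x"
          using ae by eventually_elim simp
      qed (use hm Gint in \<open>auto intro!: borel_measurable_times borel_measurable_indicator\<close>)
      also have "\<dots> = (LINT x|lebesgue_on \<Omega>. g x * indicator (box a b \<inter> box c d) x)"
        unfolding integral_restrict_space[OF Os]
        by (intro Bochner_Integration.integral_cong) (use sub in \<open>auto simp: G_def indicator_def\<close>)
      also have "\<dots> = 0"
      proof -
        let ?m = "(\<chi> i. max (a $ i) (c $ i)) :: real^'n" and ?M = "(\<chi> i. min (b $ i) (d $ i)) :: real^'n"
        have eq: "box a b \<inter> box c d = box ?m ?M" by (auto simp: mem_box_cart)
        have "cbox ?m ?M \<subseteq> cbox a b" by (auto simp: mem_box_cart)
        then show ?thesis unfolding eq using ab by (intro box0) auto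
      qed
      finally show "(LINT x|lborel. h x * indicator (box c d) x) = 0" .
    qed
    then have "AE x in lebesgue. h x = 0" by (rule AE_completion)
    with ae show ?thesis by eventually_elim (auto simp: G_def)
  qed
  obtain \<D> where D: "countable \<D>" "\<And>X. X \<in> \<D> \<Longrightarrow> X \<subseteq> \<Omega>" "\<And>X. X \<in> \<D> \<Longrightarrow> \<exists>a b. X = cbox a b" "\<Union>\<D> = \<Omega>"
    using open_countable_Union_open_cbox[OF O] by (metis PowD subsetD)
  have "AE x in lebesgue. x \<in> X \<longrightarrow> g x = 0" if XD: "X \<in> \<D>" for X
  proof -
    obtain a b where X: "X = cbox a b" using D(3)[OF XD] by auto
    have "negligible (cbox a b - box a b)"
      using negligible_frontier_interval[of a b] by simp
    then have "AE x in lebesgue. x \<notin> cbox a b - box a b"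
      by (simp only: negligible_iff_null_sets AE_not_in)
    moreover have "AE x in lebesgue. x \<in> box a b \<longrightarrow> g x = 0" using onbox D(2)[OF XD] by (simp add: X)
    ultimately show ?thesis unfolding X by eventually_elim auto
  qed
  then have "AE x in lebesgue. \<forall>X\<in>\<D>. x \<in> X \<longrightarrow> g x = 0" by (subst AE_ball_countable[OF D(1)]) blast
  then have "AE x in lebesgue. x \<in> \<Omega> \<longrightarrow> g x = 0" using D(4) by (auto elim!: eventually_mono)
  then show ?thesis by (subst AE_restrict_space_iff[OF Os])
qed

section \<open>The Sobolev space as a closure of test functions\<close>

lemma L2_iff: "f \<in> L2 \<Omega> \<longleftrightarrow> square_integrable (lebesgue_on \<Omega>) f"
  by (simp add: L2_def square_integrable_def)

lemma finite_measure_domain: "open \<Omega> \<Longrightarrow> bounded \<Omega> \<Longrightarrow> finite_measure (lebesgue_on (\<Omega> :: (real^'n) set))"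
  by (intro finite_measure_lebesgue_on bounded_set_imp_lmeasurable) auto

lemma square_integrable_scaleR_const:
  fixes f :: "'a \<Rightarrow> real" and v :: "'b::euclidean_space"
  assumes "square_integrable M f" shows "square_integrable M (\<lambda>x. f x *\<^sub>R v)"
proof -
  have "f \<in> borel_measurable M" using assms by (simp add: square_integrable_def)
  then have "(\<lambda>x. f x *\<^sub>R v) \<in> borel_measurable M" by simp
  then show ?thesis using assms by (simp add: square_integrable_def power_mult_distrib)
qed

lemma square_integrable_imp_integrable:
  fixes f :: "'a \<Rightarrow> real"
  assumes "finite_measure M" "square_integrable M f" shows "integrable M f"
proof -
  interpret finite_measure M by fact
  have "square_integrable M (\<lambda>x. 1::real)" by (simp add: square_integrable_def)
  from square_integrable_inner[OF assms(2) this] show ?thesis by simp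
qed

lemma is_weak_gradient_diff:
  assumes O: "open \<Omega>" and sq: "square_integrable (lebesgue_on \<Omega>) u" "square_integrable (lebesgue_on \<Omega>) f"
    "square_integrable (lebesgue_on \<Omega>) v" "square_integrable (lebesgue_on \<Omega>) g"
    and w: "is_weak_gradient \<Omega> u f" "is_weak_gradient \<Omega> v g"
  shows "is_weak_gradient \<Omega> (\<lambda>x. u x - v x) (\<lambda>x. f x - g x)"
  unfolding is_weak_gradient_def
proof (intro ballI allI)
  fix \<phi> i assume \<phi>: "\<phi> \<in> test_functions \<Omega>"
  note sp = test_function_square_integrable[OF O \<phi>]
  have sd: "square_integrable (lebesgue_on \<Omega>) (\<lambda>x. partial_deriv i \<phi> x)"
    using square_integrable_component[OF sp(2), of i] by (simp add: grad_nth)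
  have i1: "integrable (lebesgue_on \<Omega>) (\<lambda>x. u x * partial_deriv i \<phi> x)" "integrable (lebesgue_on \<Omega>) (\<lambda>x. v x * partial_deriv i \<phi> x)"
    using square_integrable_inner[OF sq(1) sd] square_integrable_inner[OF sq(3) sd] by simp_all
  have i2: "integrable (lebesgue_on \<Omega>) (\<lambda>x. f x $ i * \<phi> x)" "integrable (lebesgue_on \<Omega>) (\<lambda>x. g x $ i * \<phi> x)"
    using square_integrable_inner[OF square_integrable_component[OF sq(2)] sp(1)]
      square_integrable_inner[OF square_integrable_component[OF sq(4)] sp(1)] by simp_all
  have "(LINT x|lebesgue_on \<Omega>. (u x - v x) * partial_deriv i \<phi> x)
      = (LINT x|lebesgue_on \<Omega>. u x * partial_deriv i \<phi> x) - (LINT x|lebesgue_on \<Omega>. v x * partial_deriv i \<phi> x)"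
    using i1 by (simp add: left_diff_distrib)
  also have "\<dots> = - (LINT x|lebesgue_on \<Omega>. f x $ i * \<phi> x) + (LINT x|lebesgue_on \<Omega>. g x $ i * \<phi> x)"
    using w \<phi> by (simp add: is_weak_gradient_def)
  also have "\<dots> = - (LINT x|lebesgue_on \<Omega>. (f x - g x) $ i * \<phi> x)"
    using i2 by (simp add: left_diff_distrib)
  finally show "(LINT x|lebesgue_on \<Omega>. (u x - v x) * partial_deriv i \<phi> x) = - (LINT x|lebesgue_on \<Omega>. (f x - g x) $ i * \<phi> x)" .
qed

lemma weak_gradient_unique:
  fixes f g :: "real^'n \<Rightarrow> real^'n"
  assumes O: "open \<Omega>" "bounded \<Omega>" and sq: "square_integrable (lebesgue_on \<Omega>) f" "square_integrable (lebesgue_on \<Omega>) g"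
    and w: "is_weak_gradient \<Omega> v f" "is_weak_gradient \<Omega> v g"
  shows "AE x in lebesgue_on \<Omega>. f x = g x"
proof -
  have "AE x in lebesgue_on \<Omega>. f x $ i - g x $ i = 0" for i
  proof (rule fundamental_lemma[OF O(1)])
    have s: "square_integrable (lebesgue_on \<Omega>) (\<lambda>x. f x $ i - g x $ i)"
      by (intro square_integrable_diff square_integrable_component sq)
    then show "integrable (lebesgue_on \<Omega>) (\<lambda>x. f x $ i - g x $ i)"
      by (rule square_integrable_imp_integrable[OF finite_measure_domain[OF O]])
    fix \<phi> assume \<phi>: "\<phi> \<in> test_functions \<Omega>"
    note sp = test_function_square_integrable[OF O(1) \<phi>]
    have i2: "integrable (lebesgue_on \<Omega>) (\<lambda>x. f x $ i * \<phi> x)" "integrable (lebesgue_on \<Omega>) (\<lambda>x. g x $ i * \<phi> x)"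
      using square_integrable_inner[OF square_integrable_component[OF sq(1)] sp(1)]
        square_integrable_inner[OF square_integrable_component[OF sq(2)] sp(1)] by simp_all
    have "(LINT x|lebesgue_on \<Omega>. v x * partial_deriv i \<phi> x) = - (LINT x|lebesgue_on \<Omega>. f x $ i * \<phi> x)"
      "(LINT x|lebesgue_on \<Omega>. v x * partial_deriv i \<phi> x) = - (LINT x|lebesgue_on \<Omega>. g x $ i * \<phi> x)"
      using w \<phi> unfolding is_weak_gradient_def by blast+
    then have "(LINT x|lebesgue_on \<Omega>. f x $ i * \<phi> x) = (LINT x|lebesgue_on \<Omega>. g x $ i * \<phi> x)" by linarith
    then show "(LINT x|lebesgue_on \<Omega>. (f x $ i - g x $ i) * \<phi> x) = 0"
      using i2 by (simp add: left_diff_distrib)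
  qed
  then have "AE x in lebesgue_on \<Omega>. \<forall>i. f x $ i - g x $ i = 0" by (simp add: AE_all_countable)
  then show ?thesis by eventually_elim (simp add: vec_eq_iff)
qed

lemma weak_gradient_props:
  assumes "square_integrable (lebesgue_on \<Omega>) g" "is_weak_gradient \<Omega> v g"
  shows "square_integrable (lebesgue_on \<Omega>) (weak_gradient \<Omega> v)" "is_weak_gradient \<Omega> v (weak_gradient \<Omega> v)"
proof -
  have "\<exists>g. g \<in> L2 \<Omega> \<and> is_weak_gradient \<Omega> v g" using assms by (auto simp: L2_iff)
  from someI_ex[OF this] show "square_integrable (lebesgue_on \<Omega>) (weak_gradient \<Omega> v)" "is_weak_gradient \<Omega> v (weak_gradient \<Omega> v)"
    by (auto simp: weak_gradient_def L2_iff)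
qed

lemma H1_norm_eq:
  assumes O: "open \<Omega>" "bounded \<Omega>" and g: "square_integrable (lebesgue_on \<Omega>) g" "is_weak_gradient \<Omega> v g"
  shows "H1_norm \<Omega> v = sqrt ((l2norm (lebesgue_on \<Omega>) v)\<^sup>2 + (l2norm (lebesgue_on \<Omega>) g)\<^sup>2)"
proof -
  note w = weak_gradient_props[OF g]
  have "AE x in lebesgue_on \<Omega>. weak_gradient \<Omega> v x = g x" by (rule weak_gradient_unique[OF O w(1) g(1) w(2) g(2)])
  then have "l2norm (lebesgue_on \<Omega>) (weak_gradient \<Omega> v) = l2norm (lebesgue_on \<Omega>) g"
    by (intro l2norm_cong_AE) (use w g in \<open>auto simp: square_integrable_def\<close>)
  then show ?thesis unfolding H1_norm_def l2norm_square[symmetric] by (simp add: l2norm_square)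
qed

text \<open>An element of \<open>H10 \<Omega>\<close> together with its weak gradient, as the closure of the graph of the
  gradient on test functions.\<close>
definition H10_pair :: "(real^'n) set \<Rightarrow> (real^'n \<Rightarrow> real) \<Rightarrow> (real^'n \<Rightarrow> real^'n) \<Rightarrow> bool" where
  "H10_pair \<Omega> v g \<longleftrightarrow> square_integrable (lebesgue_on \<Omega>) v \<and> square_integrable (lebesgue_on \<Omega>) g \<and>
     (\<exists>\<phi>. (\<forall>k. \<phi> k \<in> test_functions \<Omega>) \<and> (\<lambda>k. l2norm (lebesgue_on \<Omega>) (\<lambda>x. \<phi> k x - v x)) \<longlonglongrightarrow> 0 \<and>
        (\<lambda>k. l2norm (lebesgue_on \<Omega>) (\<lambda>x. grad (\<phi> k) x - g x)) \<longlonglongrightarrow> 0)"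

lemma H10_pair_is_weak_gradient:
  assumes O: "open \<Omega>" and p: "H10_pair \<Omega> v g" shows "is_weak_gradient \<Omega> v g"
  unfolding is_weak_gradient_def
proof (intro ballI allI)
  fix \<psi> i assume \<psi>: "\<psi> \<in> test_functions \<Omega>"
  from p obtain \<phi> where \<phi>: "\<And>k. \<phi> k \<in> test_functions \<Omega>"
    and l: "(\<lambda>k. l2norm (lebesgue_on \<Omega>) (\<lambda>x. \<phi> k x - v x)) \<longlonglongrightarrow> 0"
      "(\<lambda>k. l2norm (lebesgue_on \<Omega>) (\<lambda>x. grad (\<phi> k) x - g x)) \<longlonglongrightarrow> 0" by (auto simp: H10_pair_def)
  have s: "square_integrable (lebesgue_on \<Omega>) v" "square_integrable (lebesgue_on \<Omega>) g" using p by (auto simp: H10_pair_def)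
  note sp = test_function_square_integrable[OF O \<psi>]
  have sd: "square_integrable (lebesgue_on \<Omega>) (\<lambda>x. partial_deriv i \<psi> x)"
    using square_integrable_component[OF sp(2), of i] by (simp add: grad_nth)
  have 1: "(\<lambda>k. LINT x|lebesgue_on \<Omega>. \<phi> k x \<bullet> partial_deriv i \<psi> x) \<longlonglongrightarrow> (LINT x|lebesgue_on \<Omega>. v x \<bullet> partial_deriv i \<psi> x)"
    by (rule l2_inner_tendsto[OF test_function_square_integrable(1)[OF O \<phi>] s(1) sd l(1)])
  have 2: "(\<lambda>k. LINT x|lebesgue_on \<Omega>. grad (\<phi> k) x \<bullet> (\<psi> x *\<^sub>R axis i 1)) \<longlonglongrightarrow> (LINT x|lebesgue_on \<Omega>. g x \<bullet> (\<psi> x *\<^sub>R axis i 1))"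
    by (rule l2_inner_tendsto[OF test_function_square_integrable(2)[OF O \<phi>] s(2) square_integrable_scaleR_const[OF sp(1)] l(2)])
  have e: "(LINT x|lebesgue_on \<Omega>. \<phi> k x * partial_deriv i \<psi> x) = - (LINT x|lebesgue_on \<Omega>. grad (\<phi> k) x $ i * \<psi> x)" for k
    by (rule integration_by_parts[OF O \<phi> \<psi>])
  have "(\<lambda>k. LINT x|lebesgue_on \<Omega>. \<phi> k x * partial_deriv i \<psi> x) \<longlonglongrightarrow> - (LINT x|lebesgue_on \<Omega>. g x $ i * \<psi> x)"
    unfolding e using tendsto_minus[OF 2] by (simp add: inner_axis mult.commute)
  then show "(LINT x|lebesgue_on \<Omega>. v x * partial_deriv i \<psi> x) = - (LINT x|lebesgue_on \<Omega>. g x $ i * \<psi> x)"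
    using 1 LIMSEQ_unique by simp blast
qed

lemma H10_pair_test_function:
  assumes "open \<Omega>" "\<phi> \<in> test_functions \<Omega>" shows "H10_pair \<Omega> \<phi> (grad \<phi>)"
  using assms test_function_square_integrable[OF assms]
  by (auto simp: H10_pair_def l2norm_def intro!: exI[of _ "\<lambda>k. \<phi>"])

lemma H1_norm_tendsto_iff:
  assumes O: "open \<Omega>" "bounded \<Omega>" and u: "\<And>k. H10_pair \<Omega> (u k) (f k)"
    and v: "square_integrable (lebesgue_on \<Omega>) v" "square_integrable (lebesgue_on \<Omega>) g" "is_weak_gradient \<Omega> v g"
  shows "H1_tendsto \<Omega> u v \<longleftrightarrow> (\<lambda>k. l2norm (lebesgue_on \<Omega>) (\<lambda>x. u k x - v x)) \<longlonglongrightarrow> 0 \<and>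
      (\<lambda>k. l2norm (lebesgue_on \<Omega>) (\<lambda>x. f k x - g x)) \<longlonglongrightarrow> 0"
proof -
  define p q where "p k = l2norm (lebesgue_on \<Omega>) (\<lambda>x. u k x - v x)"
    and "q k = l2norm (lebesgue_on \<Omega>) (\<lambda>x. f k x - g x)" for k
  have eq: "H1_norm \<Omega> (\<lambda>x. u k x - v x) = sqrt ((p k)\<^sup>2 + (q k)\<^sup>2)" for k
    unfolding p_def q_def using u[of k] v H10_pair_is_weak_gradient[OF O(1) u]
    by (intro H1_norm_eq[OF O] square_integrable_diff is_weak_gradient_diff[OF O(1)]) (auto simp: H10_pair_def)
  have pq: "0 \<le> p k" "0 \<le> q k" for k by (auto simp: p_def q_def)
  show ?thesis unfolding H1_tendsto_def eq p_def[symmetric] q_def[symmetric]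
  proof safe
    assume lim: "(\<lambda>k. sqrt ((p k)\<^sup>2 + (q k)\<^sup>2)) \<longlonglongrightarrow> 0"
    show "p \<longlonglongrightarrow> 0" by (rule tendsto_sandwich[OF _ _ tendsto_const lim]) (use pq in \<open>auto intro!: always_eventually real_le_rsqrt\<close>)
    show "q \<longlonglongrightarrow> 0" by (rule tendsto_sandwich[OF _ _ tendsto_const lim]) (use pq in \<open>auto intro!: always_eventually real_le_rsqrt\<close>)
  next
    assume "p \<longlonglongrightarrow> 0" "q \<longlonglongrightarrow> 0"
    then have "(\<lambda>k. sqrt ((p k)\<^sup>2 + (q k)\<^sup>2)) \<longlonglongrightarrow> sqrt (0\<^sup>2 + 0\<^sup>2)" by (intro tendsto_intros)
    then show "(\<lambda>k. sqrt ((p k)\<^sup>2 + (q k)\<^sup>2)) \<longlonglongrightarrow> 0" by simp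
  qed
qed

lemma H10_pair_imp_H10:
  assumes O: "open \<Omega>" "bounded \<Omega>" and p: "H10_pair \<Omega> v g"
  shows "v \<in> H10 \<Omega>" "AE x in lebesgue_on \<Omega>. weak_gradient \<Omega> v x = g x"
    "square_integrable (lebesgue_on \<Omega>) (weak_gradient \<Omega> v)"
proof -
  have s: "square_integrable (lebesgue_on \<Omega>) v" "square_integrable (lebesgue_on \<Omega>) g" using p by (auto simp: H10_pair_def)
  have w: "is_weak_gradient \<Omega> v g" by (rule H10_pair_is_weak_gradient[OF O(1) p])
  from p obtain \<phi> where \<phi>: "\<And>k. \<phi> k \<in> test_functions \<Omega>"
    and l: "(\<lambda>k. l2norm (lebesgue_on \<Omega>) (\<lambda>x. \<phi> k x - v x)) \<longlonglongrightarrow> 0"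
      "(\<lambda>k. l2norm (lebesgue_on \<Omega>) (\<lambda>x. grad (\<phi> k) x - g x)) \<longlonglongrightarrow> 0" by (auto simp: H10_pair_def)
  have "H1_tendsto \<Omega> \<phi> v"
    using H1_norm_tendsto_iff[where u = \<phi> and f = "\<lambda>k. grad (\<phi> k)", OF O H10_pair_test_function[OF O(1) \<phi>] s w] l by blast
  then show "v \<in> H10 \<Omega>" using s w \<phi> by (auto simp: H10_def H1_def L2_iff)
  show "square_integrable (lebesgue_on \<Omega>) (weak_gradient \<Omega> v)" by (rule weak_gradient_props[OF s(2) w])
  show "AE x in lebesgue_on \<Omega>. weak_gradient \<Omega> v x = g x"
    by (rule weak_gradient_unique[OF O weak_gradient_props(1)[OF s(2) w] s(2) weak_gradient_props(2)[OF s(2) w] w])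
qed

lemma H10_imp_pair:
  assumes O: "open \<Omega>" "bounded \<Omega>" and v: "v \<in> H10 \<Omega>"
  shows "H10_pair \<Omega> v (weak_gradient \<Omega> v)"
proof -
  from v obtain g where g: "square_integrable (lebesgue_on \<Omega>) v" "square_integrable (lebesgue_on \<Omega>) g" "is_weak_gradient \<Omega> v g"
    by (auto simp: H10_def H1_def L2_iff)
  note w = weak_gradient_props[OF g(2,3)]
  from v obtain \<phi> where \<phi>: "\<And>k. \<phi> k \<in> test_functions \<Omega>" "H1_tendsto \<Omega> \<phi> v" by (auto simp: H10_def)
  show ?thesis unfolding H10_pair_def
    using g(1) w(1) \<phi> H1_norm_tendsto_iff[where u = \<phi> and f = "\<lambda>k. grad (\<phi> k)",
      OF O H10_pair_test_function[OF O(1) \<phi>(1)] g(1) w] by blast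
qed

text \<open>A diagonal argument: each \<open>v k\<close> is replaced by a test function at distance at most \<open>1 / (k + 1)\<close>.\<close>
lemma H10_pair_limit:
  assumes O: "open \<Omega>" and p: "\<And>k. H10_pair \<Omega> (v k) (g k)"
    and s: "square_integrable (lebesgue_on \<Omega>) w" "square_integrable (lebesgue_on \<Omega>) h"
    and l: "(\<lambda>k. l2norm (lebesgue_on \<Omega>) (\<lambda>x. v k x - w x)) \<longlonglongrightarrow> 0"
      "(\<lambda>k. l2norm (lebesgue_on \<Omega>) (\<lambda>x. g k x - h x)) \<longlonglongrightarrow> 0"
  shows "H10_pair \<Omega> w h"
proof -
  have sv: "square_integrable (lebesgue_on \<Omega>) (v k)" "square_integrable (lebesgue_on \<Omega>) (g k)" for k
    using p by (auto simp: H10_pair_def)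
  define Q where "Q k \<phi> \<longleftrightarrow> \<phi> \<in> test_functions \<Omega> \<and> l2norm (lebesgue_on \<Omega>) (\<lambda>x. \<phi> x - v k x) < inverse (real (Suc k)) \<and>
      l2norm (lebesgue_on \<Omega>) (\<lambda>x. grad \<phi> x - g k x) < inverse (real (Suc k))" for k \<phi>
  have "\<exists>\<phi>. Q k \<phi>" for k
  proof -
    from p[of k] obtain \<phi> where \<phi>: "\<And>j. \<phi> j \<in> test_functions \<Omega>"
      and l: "(\<lambda>j. l2norm (lebesgue_on \<Omega>) (\<lambda>x. \<phi> j x - v k x)) \<longlonglongrightarrow> 0"
        "(\<lambda>j. l2norm (lebesgue_on \<Omega>) (\<lambda>x. grad (\<phi> j) x - g k x)) \<longlonglongrightarrow> 0" by (auto simp: H10_pair_def)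
    have e: "inverse (real (Suc k)) > 0" by simp
    from order_tendstoD(2)[OF l(1) e] order_tendstoD(2)[OF l(2) e]
    have "\<forall>\<^sub>F j in sequentially. l2norm (lebesgue_on \<Omega>) (\<lambda>x. \<phi> j x - v k x) < inverse (real (Suc k)) \<and>
      l2norm (lebesgue_on \<Omega>) (\<lambda>x. grad (\<phi> j) x - g k x) < inverse (real (Suc k))" by (rule eventually_conj)
    then obtain j where "l2norm (lebesgue_on \<Omega>) (\<lambda>x. \<phi> j x - v k x) < inverse (real (Suc k)) \<and>
      l2norm (lebesgue_on \<Omega>) (\<lambda>x. grad (\<phi> j) x - g k x) < inverse (real (Suc k))"
      using eventually_happens'[OF sequentially_bot] by force
    then show ?thesis using \<phi>[of j] unfolding Q_def by (intro exI[of _ "\<phi> j"]) simp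
  qed
  then obtain \<phi> where Q: "\<And>k. Q k (\<phi> k)" by metis
  have \<phi>: "\<And>k. \<phi> k \<in> test_functions \<Omega>"
    "\<And>k. l2norm (lebesgue_on \<Omega>) (\<lambda>x. \<phi> k x - v k x) < inverse (real (Suc k))"
    "\<And>k. l2norm (lebesgue_on \<Omega>) (\<lambda>x. grad (\<phi> k) x - g k x) < inverse (real (Suc k))"
    using Q unfolding Q_def by blast+
  note t = test_function_square_integrable[OF O \<phi>(1)]
  have "(\<lambda>k. l2norm (lebesgue_on \<Omega>) (\<lambda>x. \<phi> k x - w x)) \<longlonglongrightarrow> 0"
  proof (rule tendsto_sandwich[OF _ _ tendsto_const])
    show "\<forall>\<^sub>F k in sequentially. l2norm (lebesgue_on \<Omega>) (\<lambda>x. \<phi> k x - w x)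
        \<le> inverse (real (Suc k)) + l2norm (lebesgue_on \<Omega>) (\<lambda>x. v k x - w x)"
    proof (intro always_eventually allI)
      fix k show "l2norm (lebesgue_on \<Omega>) (\<lambda>x. \<phi> k x - w x) \<le> inverse (real (Suc k)) + l2norm (lebesgue_on \<Omega>) (\<lambda>x. v k x - w x)"
        using l2norm_triangle_diff[OF t(1)[of k] sv(1)[of k] s(1)] \<phi>(2)[of k] by linarith
    qed
    show "(\<lambda>k. inverse (real (Suc k)) + l2norm (lebesgue_on \<Omega>) (\<lambda>x. v k x - w x)) \<longlonglongrightarrow> 0"
      using tendsto_add[OF LIMSEQ_inverse_real_of_nat l(1)] by simp
  qed auto
  moreover have "(\<lambda>k. l2norm (lebesgue_on \<Omega>) (\<lambda>x. grad (\<phi> k) x - h x)) \<longlonglongrightarrow> 0"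
  proof (rule tendsto_sandwich[OF _ _ tendsto_const])
    show "\<forall>\<^sub>F k in sequentially. l2norm (lebesgue_on \<Omega>) (\<lambda>x. grad (\<phi> k) x - h x)
        \<le> inverse (real (Suc k)) + l2norm (lebesgue_on \<Omega>) (\<lambda>x. g k x - h x)"
    proof (intro always_eventually allI)
      fix k show "l2norm (lebesgue_on \<Omega>) (\<lambda>x. grad (\<phi> k) x - h x) \<le> inverse (real (Suc k)) + l2norm (lebesgue_on \<Omega>) (\<lambda>x. g k x - h x)"
        using l2norm_triangle_diff[OF t(2)[of k] sv(2)[of k] s(2)] \<phi>(3)[of k] by linarith
    qed
    show "(\<lambda>k. inverse (real (Suc k)) + l2norm (lebesgue_on \<Omega>) (\<lambda>x. g k x - h x)) \<longlonglongrightarrow> 0"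
      using tendsto_add[OF LIMSEQ_inverse_real_of_nat l(2)] by simp
  qed auto
  ultimately show ?thesis using \<phi>(1) s by (auto simp: H10_pair_def)
qed

lemma test_functions_add:
  assumes "\<phi> \<in> test_functions \<Omega>" "\<psi> \<in> test_functions \<Omega>"
  shows "(\<lambda>x. \<phi> x + \<psi> x) \<in> test_functions \<Omega>"
proof -
  have "closure {x. \<phi> x + \<psi> x \<noteq> 0} \<subseteq> closure ({x. \<phi> x \<noteq> 0} \<union> {x. \<psi> x \<noteq> 0})"
    by (rule closure_mono) auto
  then have sub: "closure {x. \<phi> x + \<psi> x \<noteq> 0} \<subseteq> closure {x. \<phi> x \<noteq> 0} \<union> closure {x. \<psi> x \<noteq> 0}" by simp
  have "bounded (closure {x. \<phi> x \<noteq> 0} \<union> closure {x. \<psi> x \<noteq> 0})"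
    using assms by (intro bounded_Un[THEN iffD2] conjI compact_imp_bounded) (auto simp: test_functions_def)
  then have "compact (closure {x. \<phi> x + \<psi> x \<noteq> 0})"
    using bounded_subset[OF _ sub] by (simp add: compact_eq_bounded_closed)
  then show ?thesis using assms sub by (auto simp: test_functions_def Ck_add)
qed

lemma test_functions_cmult:
  assumes "\<phi> \<in> test_functions \<Omega>" shows "(\<lambda>x. c * \<phi> x) \<in> test_functions \<Omega>"
  by (rule test_functions_mult[OF assms Ck_const])

lemma grad_add: 
  assumes "\<phi> \<in> test_functions \<Omega>" "\<psi> \<in> test_functions \<Omega>"
  shows "grad (\<lambda>x. \<phi> x + \<psi> x) x = grad \<phi> x + grad \<psi> x"
  by (rule has_derivative_inner_imp_grad)
    (use has_derivative_add[OF Ck_has_derivative_grad[OF test_function_Ck[OF assms(1)]]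
      Ck_has_derivative_grad[OF test_function_Ck[OF assms(2)]]] in \<open>simp add: inner_add_left\<close>)

lemma grad_cmult: 
  assumes "\<phi> \<in> test_functions \<Omega>"
  shows "grad (\<lambda>x. c * \<phi> x) x = c *\<^sub>R grad \<phi> x"
  by (rule has_derivative_inner_imp_grad)
    (use has_derivative_mult_right[OF Ck_has_derivative_grad[OF test_function_Ck[OF assms(1)]], of c] in simp)

lemma H10_pair_add:
  assumes O: "open \<Omega>" and p: "H10_pair \<Omega> u f" "H10_pair \<Omega> v g"
  shows "H10_pair \<Omega> (\<lambda>x. u x + v x) (\<lambda>x. f x + g x)"
proof -
  let ?M = "lebesgue_on \<Omega>"
  from p(1) obtain \<phi> where \<phi>: "\<And>k. \<phi> k \<in> test_functions \<Omega>" "(\<lambda>k. l2norm ?M (\<lambda>x. \<phi> k x - u x)) \<longlonglongrightarrow> 0"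
      "(\<lambda>k. l2norm ?M (\<lambda>x. grad (\<phi> k) x - f x)) \<longlonglongrightarrow> 0" by (auto simp: H10_pair_def)
  from p(2) obtain \<psi> where \<psi>: "\<And>k. \<psi> k \<in> test_functions \<Omega>" "(\<lambda>k. l2norm ?M (\<lambda>x. \<psi> k x - v x)) \<longlonglongrightarrow> 0"
      "(\<lambda>k. l2norm ?M (\<lambda>x. grad (\<psi> k) x - g x)) \<longlonglongrightarrow> 0" by (auto simp: H10_pair_def)
  have s: "square_integrable ?M u" "square_integrable ?M v" "square_integrable ?M f" "square_integrable ?M g"
    using p by (auto simp: H10_pair_def)
  have gen: "(\<lambda>k. l2norm ?M (\<lambda>x. (a k x + b k x) - (c x + d x))) \<longlonglongrightarrow> 0"
    if "\<And>k. square_integrable ?M (a k)" "\<And>k. square_integrable ?M (b k)" "square_integrable ?M c" "square_integrable ?M d"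
      "(\<lambda>k. l2norm ?M (\<lambda>x. a k x - c x)) \<longlonglongrightarrow> 0" "(\<lambda>k. l2norm ?M (\<lambda>x. b k x - d x)) \<longlonglongrightarrow> 0"
    for a b :: "nat \<Rightarrow> real^'a \<Rightarrow> 'z::euclidean_space" and c d
  proof (rule tendsto_sandwich[OF _ _ tendsto_const])
    show "\<forall>\<^sub>F k in sequentially. l2norm ?M (\<lambda>x. (a k x + b k x) - (c x + d x))
       \<le> l2norm ?M (\<lambda>x. a k x - c x) + l2norm ?M (\<lambda>x. b k x - d x)"
    proof (intro always_eventually allI)
      fix k
      have "(\<lambda>x. (a k x + b k x) - (c x + d x)) = (\<lambda>x. (a k x - c x) + (b k x - d x))" by auto
      then show "l2norm ?M (\<lambda>x. (a k x + b k x) - (c x + d x)) \<le> l2norm ?M (\<lambda>x. a k x - c x) + l2norm ?M (\<lambda>x. b k x - d x)"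
        using l2norm_triangle[OF square_integrable_diff[OF that(1,3)] square_integrable_diff[OF that(2,4)]] by simp
    qed
    show "(\<lambda>k. l2norm ?M (\<lambda>x. a k x - c x) + l2norm ?M (\<lambda>x. b k x - d x)) \<longlonglongrightarrow> 0"
      using tendsto_add[OF that(5,6)] by simp
  qed auto
  have gr: "grad (\<lambda>x. \<phi> k x + \<psi> k x) x = grad (\<phi> k) x + grad (\<psi> k) x" for k x by (rule grad_add[OF \<phi>(1) \<psi>(1)])
  have t: "(\<lambda>x. \<phi> k x + \<psi> k x) \<in> test_functions \<Omega>" for k by (rule test_functions_add[OF \<phi>(1) \<psi>(1)])
  note sq = test_function_square_integrable[OF O \<phi>(1)] test_function_square_integrable[OF O \<psi>(1)]
  have 1: "(\<lambda>k. l2norm ?M (\<lambda>x. (\<phi> k x + \<psi> k x) - (u x + v x))) \<longlonglongrightarrow> 0"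
    by (rule gen[OF sq(1) sq(3) s(1,2) \<phi>(2) \<psi>(2)])
  have 2: "(\<lambda>k. l2norm ?M (\<lambda>x. grad (\<lambda>x. \<phi> k x + \<psi> k x) x - (f x + g x))) \<longlonglongrightarrow> 0"
    unfolding gr by (rule gen[OF sq(2) sq(4) s(3,4) \<phi>(3) \<psi>(3)])
  show ?thesis unfolding H10_pair_def
    using s t 1 2 by (intro conjI square_integrable_add exI[of _ "\<lambda>k x. \<phi> k x + \<psi> k x"]) auto
qed

lemma H10_pair_cmult:
  assumes O: "open \<Omega>" and p: "H10_pair \<Omega> u f"
  shows "H10_pair \<Omega> (\<lambda>x. c * u x) (\<lambda>x. c *\<^sub>R f x)"
proof -
  let ?M = "lebesgue_on \<Omega>"
  from p(1) obtain \<phi> where \<phi>: "\<And>k. \<phi> k \<in> test_functions \<Omega>" "(\<lambda>k. l2norm ?M (\<lambda>x. \<phi> k x - u x)) \<longlonglongrightarrow> 0"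
      "(\<lambda>k. l2norm ?M (\<lambda>x. grad (\<phi> k) x - f x)) \<longlonglongrightarrow> 0" by (auto simp: H10_pair_def)
  have gr: "grad (\<lambda>x. c * \<phi> k x) x = c *\<^sub>R grad (\<phi> k) x" for k x by (rule grad_cmult[OF \<phi>(1)])
  have 1: "l2norm ?M (\<lambda>x. c * \<phi> k x - c * u x) = \<bar>c\<bar> * l2norm ?M (\<lambda>x. \<phi> k x - u x)" for k
    using l2norm_scaleR[of ?M c "\<lambda>x. \<phi> k x - u x"] by (simp add: right_diff_distrib)
  have 2: "l2norm ?M (\<lambda>x. c *\<^sub>R grad (\<phi> k) x - c *\<^sub>R f x) = \<bar>c\<bar> * l2norm ?M (\<lambda>x. grad (\<phi> k) x - f x)" for k
    using l2norm_scaleR[of ?M c "\<lambda>x. grad (\<phi> k) x - f x"] by (simp add: scaleR_diff_right)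
  have t: "(\<lambda>x. c * \<phi> k x) \<in> test_functions \<Omega>" for k by (rule test_functions_cmult[OF \<phi>(1)])
  have 3: "(\<lambda>k. l2norm ?M (\<lambda>x. c * \<phi> k x - c * u x)) \<longlonglongrightarrow> 0"
    unfolding 1 using tendsto_mult[OF tendsto_const \<phi>(2), of "\<bar>c\<bar>"] by simp
  have 4: "(\<lambda>k. l2norm ?M (\<lambda>x. grad (\<lambda>x. c * \<phi> k x) x - c *\<^sub>R f x)) \<longlonglongrightarrow> 0"
    unfolding gr 2 using tendsto_mult[OF tendsto_const \<phi>(3), of "\<bar>c\<bar>"] by simp
  show ?thesis unfolding H10_pair_def
    using p t 3 4 by (intro conjI square_integrable_scaleR square_integrable_cmult exI[of _ "\<lambda>k x. c * \<phi> k x"])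
      (auto simp: H10_pair_def)
qed

lemma H10_pair_zero: "open \<Omega> \<Longrightarrow> H10_pair \<Omega> (\<lambda>x. 0) (\<lambda>x. 0)"
proof -
  assume O: "open \<Omega>"
  have t: "(\<lambda>x. 0) \<in> test_functions \<Omega>" by (auto simp: test_functions_def intro: Ck_const)
  have "grad (\<lambda>x::real^'a. 0) x = 0" for x by (rule has_derivative_inner_imp_grad) simp
  then show ?thesis using H10_pair_test_function[OF O t] by (simp add: grad_def[abs_def])
qed

section \<open>Regularization of Lipschitz functions\<close>

lemma Lipschitz_constant_nonneg:
  fixes f :: "real^'n \<Rightarrow> real"
  assumes "\<And>x y. \<bar>f x - f y\<bar> \<le> L * norm (x - y)" shows "0 \<le> L"
  using assms[of "axis undefined 1" 0]
  by (metis abs_ge_zero norm_axis_1 diff_zero mult.right_neutral order_trans)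

text \<open>Differentiating under the integral moves the derivative to the kernel, which is smooth, so the
  induction runs over all kernels at once.\<close>
lemma Ck_convolution:
  fixes f \<eta> :: "real^'n \<Rightarrow> real"
  assumes f: "continuous_on UNIV f" and \<eta>: "\<And>k. Ck k \<eta>"
  shows "Ck k (\<lambda>x. integral (cbox a b) (\<lambda>y. f y * \<eta> (y - x)))"
  using \<eta>
proof (induction k arbitrary: \<eta>)
  case 0
  have "continuous_on (UNIV \<times> cbox a b) (\<lambda>z. f (snd z) * \<eta> (snd z - fst z))"
    by (intro continuous_intros continuous_on_compose2[OF f] continuous_on_compose2[OF Ck_imp_continuous[OF 0]]) auto
  then show ?case
    using integral_continuous_on_param[of UNIV a b "\<lambda>x y. f y * \<eta> (y - x)"] by (simp add: split_beta')
next
  case (Suc k)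
  define F where "F x y = blinfun_inner_right (- f y *\<^sub>R grad \<eta> (y - x))" for x y
  have cF: "continuous_on (UNIV \<times> cbox a b) (\<lambda>(x, y). F x y)"
    unfolding F_def split_beta'
    by (intro bounded_linear.continuous_on[OF bounded_linear_blinfun_inner_right] continuous_intros
        continuous_on_compose2[OF f] continuous_on_compose2[OF Ck_continuous_grad[OF Suc.prems]]) auto
  have cFx: "continuous_on (cbox a b) (F x)" for x
  proof -
    have "continuous_on (cbox a b) (\<lambda>y. (x, y))" by (intro continuous_intros)
    from continuous_on_compose2[OF cF this] show ?thesis by auto
  qed
  have der: "((\<lambda>x. integral (cbox a b) (\<lambda>y. f y * \<eta> (y - x))) has_derivative integral (cbox a b) (F x)) (at x)" for x
  proof (rule leibniz_rule[where U = UNIV, OF _ _ cF])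
    fix x y :: "real^'n"
    have "((\<lambda>x. y - x) has_derivative (\<lambda>h. - h)) (at x)" by (auto intro!: derivative_eq_intros)
    from has_derivative_compose[OF this Ck_has_derivative_grad[OF Suc.prems]]
    have "((\<lambda>x. \<eta> (y - x)) has_derivative (\<lambda>h. grad \<eta> (y - x) \<bullet> (- h))) (at x)" .
    then have "((\<lambda>x. f y * \<eta> (y - x)) has_derivative (\<lambda>h. f y * (grad \<eta> (y - x) \<bullet> (- h)))) (at x)"
      by (rule has_derivative_mult_right)
    moreover have "(\<lambda>h. f y * (grad \<eta> (y - x) \<bullet> (- h))) = blinfun_apply (F x y)"
      by (auto simp: F_def)
    ultimately show "((\<lambda>x. f y * \<eta> (y - x)) has_derivative blinfun_apply (F x y)) (at x within UNIV)"
      by simp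
  next
    fix x
    show "(\<lambda>y. f y * \<eta> (y - x)) integrable_on cbox a b"
      by (intro integrable_continuous continuous_intros continuous_on_subset[OF f]
          continuous_on_compose2[OF Ck_imp_continuous[OF Suc.prems]]) auto
  qed auto
  show ?case
  proof (rule Ck_SucI[OF der])
    fix i
    have comp: "blinfun_apply (integral (cbox a b) (F x)) (axis i 1) = integral (cbox a b) (\<lambda>y. f y * (- 1 * partial_deriv i \<eta> (y - x)))" for x
    proof -
      have "integral (cbox a b) ((\<lambda>B. blinfun_apply B (axis i 1)) \<circ> F x) = blinfun_apply (integral (cbox a b) (F x)) (axis i 1)"
        by (rule integral_linear[OF integrable_continuous[OF cFx] blinfun.bounded_linear_left])
      moreover have "(\<lambda>B. blinfun_apply B (axis i 1)) \<circ> F x = (\<lambda>y. f y * (- 1 * partial_deriv i \<eta> (y - x)))"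
        by (auto simp: F_def o_def inner_axis grad_nth)
      ultimately show ?thesis by simp
    qed
    have C: "Ck j (\<lambda>z. - 1 * partial_deriv i \<eta> z)" for j
      using Suc.prems[of "Suc j"] by (intro Ck_mult Ck_const) auto
    show "Ck k (\<lambda>x. blinfun_apply (integral (cbox a b) (F x)) (axis i 1))"
      unfolding comp by (rule Suc.IH[OF C])
  qed
qed

lemma open_AE_not_in_empty:
  fixes S :: "(real^'n) set"
  assumes "open S" "AE x in lebesgue. x \<notin> S" shows "S = {}"
proof -
  have "S \<in> null_sets lebesgue"
    using assms by (subst AE_iff_null_sets) auto
  then have "negligible S" by (simp add: negligible_iff_null_sets)
  then show ?thesis using open_not_negligible[OF assms(1)] by blast
qed

text \<open>Averages of translates with a nonnegative smooth weight of mass one supported in the ball of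
  radius \<open>\<delta>\<close>: they inherit the Lipschitz constant, and an affine function is reproduced up to an
  additive constant, so that its slope is preserved.\<close>
lemma mollification:
  fixes f :: "real^'n \<Rightarrow> real"
  assumes lip: "\<And>x y. \<bar>f x - f y\<bar> \<le> L * norm (x - y)" and bnd: "bounded {x. f x \<noteq> 0}" and \<delta>: "\<delta> > 0"
  shows "\<exists>\<psi>. (\<forall>k. Ck k \<psi>) \<and> (\<forall>x. \<psi> x \<noteq> 0 \<longrightarrow> (\<exists>y. f y \<noteq> 0 \<and> norm (y - x) \<le> \<delta>)) \<and>
    (\<forall>x y. \<bar>\<psi> x - \<psi> y\<bar> \<le> L * norm (x - y)) \<and> (\<forall>x. \<bar>\<psi> x - f x\<bar> \<le> L * \<delta>) \<and>
    (\<forall>x p c. (\<forall>y\<in>cball x (2 * \<delta>). f y = p \<bullet> y + c) \<longrightarrow> grad \<psi> x = p)"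
proof -
  have L0: "0 \<le> L" using lip by (rule Lipschitz_constant_nonneg)
  have cf: "continuous_on UNIV f"
  proof (rule lipschitz_on_continuous_on)
    show "lipschitz_on L UNIV f" using lip L0 by (auto simp: lipschitz_on_def dist_norm)
  qed
  define d where "d = ((\<chi> i. \<delta> / real CARD('n)) :: real^'n)"
  define \<rho> where "\<rho> = bump 1 (- d) d"
  have \<rho>c: "continuous_on UNIV \<rho>" unfolding \<rho>_def by (rule Ck_imp_continuous[OF Ck_bump])
  have \<rho>0: "0 \<le> \<rho> x" for x unfolding \<rho>_def by (rule bump_bounds)
  have \<rho>supp: "norm x \<le> \<delta>" if "\<rho> x \<noteq> 0" for x
  proof -
    have "x \<in> box (- d) d" using that \<rho>0[of x] bump_pos_iff[of 1 "-d" d x] by (auto simp: \<rho>_def)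
    then have "- (\<delta> / real CARD('n)) < x $ i \<and> x $ i < \<delta> / real CARD('n)" for i by (simp add: mem_box_cart d_def)
    then have "\<bar>x $ i\<bar> \<le> \<delta> / real CARD('n)" for i by (smt (verit))
    then have "(\<Sum>i\<in>UNIV. \<bar>x $ i\<bar>) \<le> (\<Sum>i\<in>(UNIV::'n set). \<delta> / real CARD('n))" by (intro sum_mono)
    then show ?thesis using norm_le_l1_cart[of x] by simp
  qed
  have int: "integrable lborel (\<lambda>y. h y * \<rho> y)" if "continuous_on UNIV h" for h
    by (rule integrable_continuous_compact_support[of _ \<delta>]) (use \<rho>supp that in \<open>auto intro!: continuous_intros \<rho>c\<close>)
  define Z where "Z = (LINT y|lborel. \<rho> y)"
  have Z: "Z > 0"
  proof -
    have "Z \<noteq> 0"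
    proof
      assume "Z = 0"
      then have "AE x in lborel. \<rho> x = 0"
        using integral_nonneg_eq_0_iff_AE[of lborel \<rho>] int[of "\<lambda>_. 1"] \<rho>0 by (simp add: Z_def)
      then have "AE x in lebesgue. \<rho> x = 0" by (rule AE_completion)
      then have "AE x in lebesgue. x \<notin> box (- d) d"
        by eventually_elim (use bump_pos_iff[of 1 "-d" d] in \<open>simp add: \<rho>_def, metis less_irrefl\<close>)
      then have "box (- d) d = {}" by (rule open_AE_not_in_empty[OF open_box])
      moreover have "0 \<in> box (- d) d" using \<delta> by (auto simp: mem_box_cart d_def)
      ultimately show False by auto
    qed
    moreover have "0 \<le> Z" unfolding Z_def using \<rho>0 by (intro Bochner_Integration.integral_nonneg)
    ultimately show ?thesis by simp
  qed
  define Av where "Av h = (1 / Z) * (LINT y|lborel. h y * \<rho> y)" for h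
  have Av_diff: "Av (\<lambda>y. g y - h y) = Av g - Av h" if "continuous_on UNIV g" "continuous_on UNIV h" for g h
    using int that by (simp add: Av_def left_diff_distrib right_diff_distrib)
  have Av_add_const: "Av (\<lambda>y. c + h y) = c + Av h" if "continuous_on UNIV h" for c h
  proof -
    have "(LINT y|lborel. (c + h y) * \<rho> y) = c * Z + (LINT y|lborel. h y * \<rho> y)"
      using int[OF that] int[of "\<lambda>_. 1"] by (simp add: distrib_right Z_def)
    then show ?thesis using Z by (simp add: Av_def distrib_left)
  qed
  have Av_bound: "\<bar>Av h\<bar> \<le> B" if h: "continuous_on UNIV h" "\<And>y. norm y \<le> \<delta> \<Longrightarrow> \<bar>h y\<bar> \<le> B" for h B
  proof -
    have "\<bar>LINT y|lborel. h y * \<rho> y\<bar> \<le> (LINT y|lborel. \<bar>h y * \<rho> y\<bar>)" by (rule integral_abs_bound)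
    also have "\<dots> \<le> (LINT y|lborel. B * \<rho> y)"
    proof (rule integral_mono)
      show "integrable lborel (\<lambda>y. \<bar>h y * \<rho> y\<bar>)" using int[OF h(1)] by simp
      show "integrable lborel (\<lambda>y. B * \<rho> y)" using int[of "\<lambda>_. B"] by simp
      show "\<bar>h y * \<rho> y\<bar> \<le> B * \<rho> y" for y
        using h(2)[of y] \<rho>supp[of y] \<rho>0[of y] by (cases "\<rho> y = 0") (auto simp: abs_mult mult_right_mono)
    qed
    also have "\<dots> = B * Z" by (simp add: Z_def)
    finally show ?thesis using Z by (simp add: Av_def abs_mult field_simps)
  qed
  define \<psi> where "\<psi> x = (1 / Z) * (LINT y|lborel. f y * \<rho> (y - x))" for x
  have c\<rho>: "continuous_on UNIV (\<lambda>y. \<rho> (y - x))" for x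
    by (rule continuous_on_compose2[OF \<rho>c]) (auto intro!: continuous_intros)
  have cfs: "continuous_on UNIV (\<lambda>y. f (x + y))" for x
    by (rule continuous_on_compose2[OF cf]) (auto intro!: continuous_intros)
  have \<psi>Av: "\<psi> x = Av (\<lambda>y. f (x + y))" for x
  proof -
    have "(LINT y|lborel. f (x + y) * \<rho> ((x + y) - x)) = (LINT y|lborel. f y * \<rho> (y - x))"
      by (rule lborel_integral_translation[of "\<lambda>y. f y * \<rho> (y - x)"])
         (intro borel_measurable_continuous_onI continuous_intros cf c\<rho>)
    then show ?thesis by (simp add: \<psi>_def Av_def)
  qed
  obtain a where a: "{x. f x \<noteq> 0} \<subseteq> cbox (- a) a" using bounded_subset_cbox_symmetric[OF bnd] by blast
  have "Ck k \<psi>" for k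
  proof -
    have eq: "\<psi> x = (1 / Z) * integral (cbox (- a) a) (\<lambda>y. f y * \<rho> (y - x))" for x
    proof -
      have c: "continuous_on UNIV (\<lambda>y. f y * \<rho> (y - x))" by (intro continuous_intros cf c\<rho>)
      have si: "set_integrable lborel (cbox (- a) a) (\<lambda>y. f y * \<rho> (y - x))"
        unfolding set_integrable_def
        by (rule borel_integrable_compact) (use c in \<open>auto intro: continuous_on_subset\<close>)
      have "(LINT y|lborel. f y * \<rho> (y - x)) = (LINT y:cbox (- a) a|lborel. f y * \<rho> (y - x))"
        unfolding set_lebesgue_integral_def
        by (intro Bochner_Integration.integral_cong) (use a in \<open>auto simp: indicator_def\<close>)
      also have "\<dots> = integral (cbox (- a) a) (\<lambda>y. f y * \<rho> (y - x))"
        by (rule set_borel_integral_eq_integral(2)[OF si])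
      finally show ?thesis by (simp add: \<psi>_def)
    qed
    have "Ck k (\<lambda>x. (1 / Z) * integral (cbox (- a) a) (\<lambda>y. f y * \<rho> (y - x)))"
      by (intro Ck_mult Ck_const Ck_convolution[OF cf]) (simp add: \<rho>_def Ck_bump)
    moreover have "\<psi> = (\<lambda>x. (1 / Z) * integral (cbox (- a) a) (\<lambda>y. f y * \<rho> (y - x)))" using eq by (rule ext)
    ultimately show ?thesis by simp 
  qed
  moreover have "\<exists>y. f y \<noteq> 0 \<and> norm (y - x) \<le> \<delta>" if "\<psi> x \<noteq> 0" for x
  proof (rule ccontr)
    assume "\<not> ?thesis"
    then have "f y * \<rho> (y - x) = 0" for y using \<rho>supp[of "y - x"] by auto
    then have "(\<lambda>y. f y * \<rho> (y - x)) = (\<lambda>y. 0)" by (rule ext)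
    then have "\<psi> x = 0" by (simp add: \<psi>_def)
    then show False using that by simp
  qed
  moreover have "\<bar>\<psi> x - \<psi> y\<bar> \<le> L * norm (x - y)" for x y
  proof -
    have "\<psi> x - \<psi> y = Av (\<lambda>z. f (x + z) - f (y + z))" unfolding \<psi>Av by (rule Av_diff[OF cfs cfs, symmetric])
    also have "\<bar>\<dots>\<bar> \<le> L * norm (x - y)"
    proof (rule Av_bound)
      show "continuous_on UNIV (\<lambda>z. f (x + z) - f (y + z))" by (intro continuous_intros cfs)
      show "\<bar>f (x + z) - f (y + z)\<bar> \<le> L * norm (x - y)" for z using lip[of "x + z" "y + z"] by simp
    qed
    finally show ?thesis .
  qed
  moreover have "\<bar>\<psi> x - f x\<bar> \<le> L * \<delta>" for x
  proof -
    have "\<psi> x = f x + Av (\<lambda>z. f (x + z) - f x)"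
      using Av_add_const[of "\<lambda>z. f (x + z) - f x" "f x"] unfolding \<psi>Av by (simp add: continuous_intros cfs)
    moreover have "\<bar>Av (\<lambda>z. f (x + z) - f x)\<bar> \<le> L * \<delta>"
    proof (rule Av_bound)
      show "continuous_on UNIV (\<lambda>z. f (x + z) - f x)" by (intro continuous_intros cfs)
      show "\<bar>f (x + z) - f x\<bar> \<le> L * \<delta>" if "norm z \<le> \<delta>" for z
        using lip[of "x + z" x] mult_left_mono[OF that L0] by simp
    qed
    ultimately show ?thesis by simp
  qed
  moreover have "grad \<psi> x = p" if aff: "\<forall>y\<in>cball x (2 * \<delta>). f y = p \<bullet> y + c" for x p c
  proof (rule has_derivative_inner_imp_grad)
    define c' where "c' = Av (\<lambda>y. p \<bullet> y + c)"
    have "((\<lambda>x. p \<bullet> x + c') has_derivative (\<lambda>h. p \<bullet> h)) (at x)"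
      by (auto intro!: derivative_eq_intros)
    then show "(\<psi> has_derivative (\<lambda>h. p \<bullet> h)) (at x)"
    proof (rule has_derivative_transform_within_open[of _ _ _ _ "ball x \<delta>"])
      fix x' assume x': "x' \<in> ball x \<delta>"
      have "f (x' + y) * \<rho> y = (p \<bullet> x' + (p \<bullet> y + c)) * \<rho> y" for y
      proof (cases "\<rho> y = 0")
        case False
        then have "norm y \<le> \<delta>" by (rule \<rho>supp)
        moreover have "dist x (x' + y) \<le> dist x x' + norm y" using norm_triangle_ineq4[of "x - x'" y] by (simp add: dist_norm algebra_simps)
        ultimately have "x' + y \<in> cball x (2 * \<delta>)" using x' by simp
        then show ?thesis using aff by (simp add: inner_add_right)
      qed simp
      then have "(\<lambda>y. f (x' + y) * \<rho> y) = (\<lambda>y. (p \<bullet> x' + (p \<bullet> y + c)) * \<rho> y)" by (rule ext)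
      then have "\<psi> x' = Av (\<lambda>y. p \<bullet> x' + (p \<bullet> y + c))" unfolding \<psi>Av Av_def by (simp only:)
      also have "\<dots> = p \<bullet> x' + c'" unfolding c'_def by (rule Av_add_const) (intro continuous_intros)
      finally show "p \<bullet> x' + c' = \<psi> x'" by simp
    qed (use \<delta> in auto)
  qed
  ultimately show ?thesis by (intro exI[of _ \<psi>]) blast
qed

lemma Lipschitz_imp_norm_grad_le:
  assumes C: "Ck (Suc 0) \<psi>" and lip: "\<And>x y. \<bar>\<psi> x - \<psi> y\<bar> \<le> L * norm (x - y)"
  shows "norm (grad \<psi> x) \<le> L"
proof -
  define g where "g = grad \<psi> x"
  have d1: "((\<lambda>t. x + t *\<^sub>R g) has_derivative (\<lambda>t. t *\<^sub>R g)) (at 0)"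
    by (auto intro!: derivative_eq_intros)
  have d2: "(\<lambda>t. g \<bullet> (t *\<^sub>R g)) = (*) (g \<bullet> g)" by (auto simp: mult.commute)
  have "((\<lambda>t. \<psi> (x + t *\<^sub>R g)) has_derivative (\<lambda>t. g \<bullet> (t *\<^sub>R g))) (at 0)"
    using has_derivative_compose[OF d1, of \<psi> "\<lambda>h. grad \<psi> x \<bullet> h"] Ck_has_derivative_grad[OF C, of x]
    by (simp add: g_def)
  then have "((\<lambda>t. \<psi> (x + t *\<^sub>R g)) has_real_derivative (g \<bullet> g)) (at 0)"
    unfolding has_field_derivative_def d2 .
  then have lim: "((\<lambda>h. (\<psi> (x + h *\<^sub>R g) - \<psi> x) / h) \<longlongrightarrow> g \<bullet> g) (at 0)"
    by (simp add: DERIV_def)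
  have "g \<bullet> g \<le> L * norm g"
  proof (rule tendsto_upperbound[OF lim])
    show "\<forall>\<^sub>F h in at 0. (\<psi> (x + h *\<^sub>R g) - \<psi> x) / h \<le> L * norm g"
      unfolding eventually_at_filter
    proof (intro always_eventually allI impI)
      fix h :: real assume "h \<noteq> 0"
      have "\<bar>(\<psi> (x + h *\<^sub>R g) - \<psi> x) / h\<bar> \<le> L * norm g"
        using lip[of "x + h *\<^sub>R g" x] \<open>h \<noteq> 0\<close> by (simp add: field_simps)
      then show "(\<psi> (x + h *\<^sub>R g) - \<psi> x) / h \<le> L * norm g" by linarith
    qed
  qed simp
  then have "norm g * norm g \<le> L * norm g" by (simp add: power2_norm_eq_inner[symmetric] power2_eq_square)
  moreover have "0 \<le> L" using lip by (rule Lipschitz_constant_nonneg)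
  ultimately show ?thesis by (cases "g = 0") (auto simp: g_def)
qed

text \<open>Cutting off at height \<open>\<epsilon>\<close> moves the support into the interior; the gradients of the
  mollified cut-offs are bounded by the Lipschitz constant and are eventually equal to the slope at
  almost every point, so they converge by dominated convergence.\<close>
lemma lipschitz_locally_affine_H10_pair:
  fixes f :: "real^'n \<Rightarrow> real" and G :: "real^'n \<Rightarrow> real^'n"
  assumes O: "open \<Omega>" "bounded \<Omega>" and lip: "\<And>x y. \<bar>f x - f y\<bar> \<le> L * norm (x - y)"
    and f0: "\<And>x. 0 \<le> f x" and supp: "\<And>x. f x \<noteq> 0 \<Longrightarrow> x \<in> \<Omega>"
    and Gm: "G \<in> borel_measurable (lebesgue_on \<Omega>)"
    and aff: "AE x in lebesgue_on \<Omega>. \<exists>r>0. \<forall>y\<in>ball x r. f y = f x + G x \<bullet> (y - x)"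
  shows "H10_pair \<Omega> f G"
proof -
  let ?M = "lebesgue_on \<Omega>"
  interpret finite_measure ?M by (rule finite_measure_domain[OF O])
  have L0: "0 \<le> L" using lip by (rule Lipschitz_constant_nonneg)
  have cf: "continuous_on UNIV f"
    by (rule lipschitz_on_continuous_on[of L]) (use lip L0 in \<open>auto simp: lipschitz_on_def dist_norm\<close>)
  define \<epsilon> where "\<epsilon> k = inverse (real (Suc k))" for k
  have \<epsilon>0: "\<epsilon> k > 0" for k by (simp add: \<epsilon>_def)
  have \<epsilon>lim: "\<epsilon> \<longlonglongrightarrow> 0" unfolding \<epsilon>_def[abs_def] by (rule LIMSEQ_inverse_real_of_nat)
  define F where "F k x = max (f x - \<epsilon> k) 0" for k x
  have Flip: "\<bar>F k x - F k y\<bar> \<le> L * norm (x - y)" for k x y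
    using lip[of x y] by (auto simp: F_def max_def)
  have bnd: "bounded {x. f x \<noteq> 0}" using supp by (intro bounded_subset[OF O(2)]) auto
  have "\<exists>\<psi> \<delta>. 0 < \<delta> \<and> \<delta> \<le> \<epsilon> k \<and> \<psi> \<in> test_functions \<Omega> \<and> (\<forall>x y. \<bar>\<psi> x - \<psi> y\<bar> \<le> L * norm (x - y)) \<and> (\<forall>x. \<bar>\<psi> x - F k x\<bar> \<le> L * \<delta>) \<and>
    (\<forall>x p c. (\<forall>y\<in>cball x (2 * \<delta>). F k y = p \<bullet> y + c) \<longrightarrow> grad \<psi> x = p)" for k
  proof -
    define K where "K = {x. \<epsilon> k \<le> f x}"
    have KO: "K \<subseteq> {x. f x \<noteq> 0}" using \<epsilon>0[of k] by (auto simp: K_def)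
    have "closed K" unfolding K_def by (intro closed_Collect_le continuous_intros cf)
    then have Kc: "compact K" using bounded_subset[OF bnd KO] by (simp add: compact_eq_bounded_closed)
    have KOm: "K \<subseteq> \<Omega>" using KO supp by auto
    obtain e where e: "e > 0" "\<And>x. x \<in> K \<Longrightarrow> ball x e \<subseteq> \<Omega>"
      using compact_subset_open_imp_ball_epsilon_subset[OF Kc O(1) KOm] by (metis UN_subset_iff)
    define \<delta> where "\<delta> = min (e/2) (\<epsilon> k)"
    have \<delta>: "\<delta> > 0" "\<delta> \<le> \<epsilon> k" "\<delta> < e" using e \<epsilon>0[of k] by (auto simp: \<delta>_def min_def)
    have Fs: "{x. F k x \<noteq> 0} \<subseteq> K" by (auto simp: F_def K_def max_def split: if_splits)
    have Fb: "bounded {x. F k x \<noteq> 0}" using Fs Kc by (meson bounded_subset compact_imp_bounded)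
    obtain \<psi> where \<psi>: "\<And>k. Ck k \<psi>" "\<And>x. \<psi> x \<noteq> 0 \<Longrightarrow> \<exists>y. F k y \<noteq> 0 \<and> norm (y - x) \<le> \<delta>"
      and rest: "\<forall>x y. \<bar>\<psi> x - \<psi> y\<bar> \<le> L * norm (x - y)" "\<forall>x. \<bar>\<psi> x - F k x\<bar> \<le> L * \<delta>"
       "\<forall>x p c. (\<forall>y\<in>cball x (2 * \<delta>). F k y = p \<bullet> y + c) \<longrightarrow> grad \<psi> x = p"
      using mollification[OF Flip Fb \<delta>(1)] by blast
    define S where "S = {x + y |x y. x \<in> K \<and> y \<in> cball 0 \<delta>}"
    have Sc: "compact S" unfolding S_def by (rule compact_sums[OF Kc compact_cball])
    have SO: "S \<subseteq> \<Omega>"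
    proof
      fix z assume "z \<in> S"
      then obtain x y where "z = x + y" "x \<in> K" "norm y \<le> \<delta>" by (auto simp: S_def)
      then have "z \<in> ball x e" using \<delta> by (simp add: dist_norm)
      then show "z \<in> \<Omega>" using e(2) \<open>x \<in> K\<close> by blast
    qed
    have "{x. \<psi> x \<noteq> 0} \<subseteq> S"
    proof
      fix x assume "x \<in> {x. \<psi> x \<noteq> 0}"
      then obtain y where y: "F k y \<noteq> 0" "norm (y - x) \<le> \<delta>" using \<psi>(2) by blast
      then have "x = y + (x - y)" "y \<in> K" "x - y \<in> cball 0 \<delta>" using Fs by (auto simp: norm_minus_commute)
      then show "x \<in> S" unfolding S_def by blast
    qed
    then have cl: "closure {x. \<psi> x \<noteq> 0} \<subseteq> S" by (simp add: closure_minimal compact_imp_closed Sc)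
    then have "compact (closure {x. \<psi> x \<noteq> 0})"
      using bounded_subset[OF compact_imp_bounded[OF Sc] cl] by (simp add: compact_eq_bounded_closed)
    then have "\<psi> \<in> test_functions \<Omega>" using \<psi>(1) cl SO by (auto simp: test_functions_def)
    then show ?thesis using rest \<delta> by blast
  qed
  then obtain \<psi> \<delta> where \<delta>: "\<And>k. 0 < \<delta> k" "\<And>k. \<delta> k \<le> \<epsilon> k" and \<psi>: "\<And>k. \<psi> k \<in> test_functions \<Omega>"
    and \<psi>lip: "\<And>k x y. \<bar>\<psi> k x - \<psi> k y\<bar> \<le> L * norm (x - y)" and \<psi>close: "\<And>k x. \<bar>\<psi> k x - F k x\<bar> \<le> L * \<delta> k"
    and \<psi>aff: "\<And>k x p c. (\<forall>y\<in>cball x (2 * \<delta> k). F k y = p \<bullet> y + c) \<Longrightarrow> grad (\<psi> k) x = p"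
    by metis
  have gb: "norm (grad (\<psi> k) x) \<le> L" for k x
    by (rule Lipschitz_imp_norm_grad_le[OF test_function_Ck[OF \<psi>] \<psi>lip])
  have gm: "grad (\<psi> k) \<in> borel_measurable ?M" for k
    using test_function_square_integrable(2)[OF O(1) \<psi>] by (simp add: square_integrable_def)
  \<comment> \<open>Where \<open>f\<close> vanishes and is locally affine its slope is zero because \<open>f\<close> has a minimum there;
    where \<open>f\<close> is positive the cut-off only subtracts a constant once \<open>\<epsilon> k\<close> is small.\<close>
  have conv: "AE x in ?M. \<forall>\<^sub>F k in sequentially. grad (\<psi> k) x = G x"
    using aff
  proof eventually_elim
    case (elim x)
    then obtain r where r: "r > 0" "\<And>y. y \<in> ball x r \<Longrightarrow> f y = f x + G x \<bullet> (y - x)" by blast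
    have d2: "(\<lambda>k. 2 * \<epsilon> k) \<longlonglongrightarrow> 0" using tendsto_mult[OF tendsto_const \<epsilon>lim, of 2] by simp
    show ?case
    proof (cases "f x = 0")
      case True
      have G0: "G x = 0"
      proof (rule ccontr)
        assume nz: "G x \<noteq> 0"
        define t where "t = r / (2 * norm (G x))"
        have t: "t > 0" "norm (t *\<^sub>R G x) < r" using r nz by (auto simp: t_def)
        then have "f (x - t *\<^sub>R G x) = f x + G x \<bullet> ((x - t *\<^sub>R G x) - x)" by (intro r) (simp add: dist_norm)
        then have "f (x - t *\<^sub>R G x) = - t * (G x \<bullet> G x)" using True by simp
        moreover have "t * (G x \<bullet> G x) > 0" using t nz by simp
        ultimately show False using f0[of "x - t *\<^sub>R G x"] by linarith
      qed
      have "\<forall>\<^sub>F k in sequentially. 2 * \<epsilon> k < r" using order_tendstoD(2)[OF d2 r(1)] .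
      then show ?thesis
      proof eventually_elim
        case (elim k)
        show ?case
        proof (rule \<psi>aff[where c = 0])
          show "\<forall>y\<in>cball x (2 * \<delta> k). F k y = G x \<bullet> y + 0"
          proof
            fix y assume "y \<in> cball x (2 * \<delta> k)"
            then have "y \<in> ball x r" using elim \<delta>(2)[of k] by simp
            then show "F k y = G x \<bullet> y + 0" using r(2) True G0 \<epsilon>0[of k] by (simp add: F_def)
          qed
        qed
      qed
    next
      case False
      then have fx: "f x > 0" using f0[of x] by simp
      define r' where "r' = min r (f x / (2 * (L + 1)))"
      have r': "r' > 0" "r' \<le> r" "L * r' \<le> f x / 2"
      proof -
        have "f x / (2 * (L + 1)) > 0" using fx L0 by simp
        then show "r' > 0" "r' \<le> r" using r(1) by (simp_all add: r'_def)
        have "r' \<le> f x / (2 * (L + 1))" by (simp add: r'_def)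
        then have "L * r' \<le> (L + 1) * (f x / (2 * (L + 1)))"
          using L0 \<open>r' > 0\<close> by (intro mult_mono) simp_all
        moreover have "(L + 1) * (f x / (2 * (L + 1))) = f x / 2" using L0 by (simp add: field_simps)
        ultimately show "L * r' \<le> f x / 2" by linarith
      qed
      have fy: "f y \<ge> f x / 2" if "y \<in> ball x r'" for y
      proof -
        have "\<bar>f y - f x\<bar> \<le> L * norm (y - x)" by (rule lip)
        also have "\<dots> \<le> L * r'" using that L0 by (intro mult_left_mono) (auto simp: dist_norm norm_minus_commute)
        finally show ?thesis using r'(3) by linarith
      qed
      have "\<forall>\<^sub>F k in sequentially. 2 * \<epsilon> k < r'" using order_tendstoD(2)[OF d2 r'(1)] .
      moreover have "\<forall>\<^sub>F k in sequentially. \<epsilon> k < f x / 2" using order_tendstoD(2)[OF \<epsilon>lim, of "f x / 2"] fx by simp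
      ultimately show ?thesis
      proof eventually_elim
        case (elim k)
        show ?case
        proof (rule \<psi>aff[where c = "f x - G x \<bullet> x - \<epsilon> k"])
          show "\<forall>y\<in>cball x (2 * \<delta> k). F k y = G x \<bullet> y + (f x - G x \<bullet> x - \<epsilon> k)"
          proof
            fix y assume "y \<in> cball x (2 * \<delta> k)"
            then have y: "y \<in> ball x r'" using elim \<delta>(2)[of k] by simp
            then have "f y = f x + G x \<bullet> (y - x)" using r'(2) by (intro r(2)) simp
            moreover have "f y - \<epsilon> k \<ge> 0" using fy[OF y] elim by linarith
            ultimately show "F k y = G x \<bullet> y + (f x - G x \<bullet> x - \<epsilon> k)" by (simp add: F_def inner_diff_right)
          qed
        qed
      qed
    qed
  qed
  have Gb: "AE x in ?M. norm (G x) \<le> L"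
    using conv
  proof eventually_elim
    case (elim x)
    then obtain k where "grad (\<psi> k) x = G x" using eventually_happens'[OF sequentially_bot] by blast
    then show ?case using gb[of k x] by simp
  qed
  have Gs: "square_integrable ?M G"
    unfolding square_integrable_def
  proof
    show "integrable ?M (\<lambda>x. (norm (G x))\<^sup>2)"
      by (rule integrable_const_bound[of _ "L\<^sup>2"])
        (use Gb Gm in \<open>auto elim!: eventually_mono intro!: power_mono\<close>)
  qed (rule Gm)
  have fm: "f \<in> borel_measurable ?M" by (intro borel_imp_lebesgue_on borel_measurable_continuous_onI cf)
  have uni: "\<bar>\<psi> k x - f x\<bar> \<le> (L + 1) * \<epsilon> k" for k x
  proof -
    have "\<bar>F k x - f x\<bar> \<le> \<epsilon> k" using f0[of x] \<epsilon>0[of k] by (auto simp: F_def max_def)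
    moreover have "L * \<delta> k \<le> L * \<epsilon> k" by (rule mult_left_mono[OF \<delta>(2) L0])
    ultimately have "\<bar>\<psi> k x - f x\<bar> \<le> L * \<epsilon> k + \<epsilon> k" using \<psi>close[of k x] by linarith
    then show ?thesis by (simp add: distrib_right)
  qed
  have usq: "(norm (\<psi> k x - f x))\<^sup>2 \<le> ((L + 1) * \<epsilon> k)\<^sup>2" for k x
    by (rule power_mono) (use uni[of k x] in \<open>simp_all only: real_norm_def abs_ge_zero\<close>)
  have dfs: "square_integrable ?M (\<lambda>x. \<psi> k x - f x)" for k
    unfolding square_integrable_def
  proof
    have m: "\<psi> k \<in> borel_measurable ?M" using test_function_square_integrable(1)[OF O(1) \<psi>] by (simp add: square_integrable_def)
    then show m': "(\<lambda>x. \<psi> k x - f x) \<in> borel_measurable ?M" using fm by simp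
    show "integrable ?M (\<lambda>x. (norm (\<psi> k x - f x))\<^sup>2)"
    proof (rule integrable_const_bound[of _ "((L + 1) * \<epsilon> k)\<^sup>2"])
      have "norm ((norm (\<psi> k x - f x))\<^sup>2) \<le> ((L + 1) * \<epsilon> k)\<^sup>2" for x using usq[of k x] by simp
      then show "AE x in ?M. norm ((norm (\<psi> k x - f x))\<^sup>2) \<le> ((L + 1) * \<epsilon> k)\<^sup>2" by blast
      show "(\<lambda>x. (norm (\<psi> k x - f x))\<^sup>2) \<in> borel_measurable ?M" using m' by measurable
    qed
  qed
  have fs: "square_integrable ?M f"
    using square_integrable_diff[OF test_function_square_integrable(1)[OF O(1) \<psi>[of 0]] dfs[of 0]] by simp
  have "(\<lambda>k. l2norm ?M (\<lambda>x. \<psi> k x - f x)) \<longlonglongrightarrow> 0"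
  proof (rule tendsto_sandwich[OF _ _ tendsto_const])
    show "\<forall>\<^sub>F k in sequentially. l2norm ?M (\<lambda>x. \<psi> k x - f x) \<le> sqrt (measure ?M (space ?M)) * ((L + 1) * \<epsilon> k)"
    proof (intro always_eventually allI)
      fix k
      have B0: "0 \<le> (L + 1) * \<epsilon> k" using L0 \<epsilon>0[of k] by simp
      have "(LINT x|?M. (norm (\<psi> k x - f x))\<^sup>2) \<le> (LINT x|?M. ((L + 1) * \<epsilon> k)\<^sup>2)"
        using dfs[of k] by (intro integral_mono usq) (simp_all add: square_integrable_def)
      also have "\<dots> = measure ?M (space ?M) * ((L + 1) * \<epsilon> k)\<^sup>2" by simp
      finally have "l2norm ?M (\<lambda>x. \<psi> k x - f x) \<le> sqrt (measure ?M (space ?M) * ((L + 1) * \<epsilon> k)\<^sup>2)"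
        unfolding l2norm_def by (rule real_sqrt_le_mono)
      then show "l2norm ?M (\<lambda>x. \<psi> k x - f x) \<le> sqrt (measure ?M (space ?M)) * ((L + 1) * \<epsilon> k)"
        using B0 by (simp add: real_sqrt_mult)
    qed
    show "(\<lambda>k. sqrt (measure ?M (space ?M)) * ((L + 1) * \<epsilon> k)) \<longlonglongrightarrow> 0"
      using tendsto_mult[OF tendsto_const tendsto_mult[OF tendsto_const \<epsilon>lim], of "sqrt (measure ?M (space ?M))" "L + 1"] by simp
  qed auto
  moreover have "(\<lambda>k. l2norm ?M (\<lambda>x. grad (\<psi> k) x - G x)) \<longlonglongrightarrow> 0"
  proof -
    have "(\<lambda>k. LINT x|?M. (norm (grad (\<psi> k) x - G x))\<^sup>2) \<longlonglongrightarrow> (LINT x|?M. 0)"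
    proof (rule integral_dominated_convergence[where w = "\<lambda>x. (L + L)\<^sup>2"])
      show "AE x in ?M. (\<lambda>k. (norm (grad (\<psi> k) x - G x))\<^sup>2) \<longlonglongrightarrow> 0"
        using conv by eventually_elim (rule tendsto_eventually, auto elim: eventually_mono)
      show "AE x in ?M. norm ((norm (grad (\<psi> k) x - G x))\<^sup>2) \<le> (L + L)\<^sup>2" for k
        using Gb
      proof eventually_elim
        case (elim x)
        have "norm (grad (\<psi> k) x - G x) \<le> L + L" using norm_triangle_ineq4[of "grad (\<psi> k) x" "G x"] gb[of k x] elim by linarith
        from power_mono[OF this norm_ge_zero, of 2] show ?case by simp
      qed
    qed (use gm Gm in auto)
    then have "(\<lambda>k. sqrt (LINT x|?M. (norm (grad (\<psi> k) x - G x))\<^sup>2)) \<longlonglongrightarrow> sqrt 0" by (intro tendsto_real_sqrt) simp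
    then show ?thesis by (simp add: l2norm_def)
  qed
  ultimately show ?thesis unfolding H10_pair_def using \<psi> fs Gs by blast
qed

section \<open>Exterior balls of Lipschitz domains\<close>

text \<open>Moving from \<open>z\<close> by \<open>r / 2\<close> against the direction \<open>e\<close> leads below the graph of \<open>g\<close> by at least
  \<open>r / 2\<close>. A displacement \<open>w\<close> changes the height above the graph by at most \<open>(1 + L) * norm w\<close>, which
  determines the radius of a ball that stays below the graph.\<close>
lemma lipschitz_epigraph_exterior_ball:
  fixes e :: "real^'n"
  assumes e: "norm e = 1" and g: "L-lipschitz_on {w. e \<bullet> w = 0} (g :: real^'n \<Rightarrow> real)"
    and U: "\<Omega> \<inter> U = {y\<in>U. g (y - (e \<bullet> y) *\<^sub>R e) < e \<bullet> y}"
    and z: "z \<in> U" "z \<notin> \<Omega>" and r: "0 < r" "cball z r \<subseteq> U"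
  shows "cball (z - (r/2) *\<^sub>R e) (r / (2 * (1 + L))) \<subseteq> cball z r - \<Omega>"
proof
  have L0: "0 \<le> L" using g by (rule lipschitz_on_nonneg)
  fix y assume y: "y \<in> cball (z - (r/2) *\<^sub>R e) (r / (2 * (1 + L)))"
  define w where "w = y - (z - (r/2) *\<^sub>R e)"
  have w: "norm w \<le> r / (2 * (1 + L))" using y by (simp add: w_def dist_norm norm_minus_commute)
  then have w': "(1 + L) * norm w \<le> r / 2" using L0 by (simp add: field_simps)
  have ee: "e \<bullet> e = 1" using e by (simp add: power2_norm_eq_inner[symmetric])
  define P where "P y = y - (e \<bullet> y) *\<^sub>R e" for y
  have Pk: "P y \<in> {w. e \<bullet> w = 0}" for y by (simp add: P_def inner_diff_right ee)
  have y_eq: "y = z - (r/2) *\<^sub>R e + w" by (simp add: w_def)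
  have "norm w \<le> r / 2" using w' mult_nonneg_nonneg[OF L0 norm_ge_zero[of w]] by (simp add: distrib_right)
  moreover have "norm (z - y) \<le> norm ((r/2) *\<^sub>R e) + norm w"
    unfolding y_eq using norm_triangle_ineq4[of "(r/2) *\<^sub>R e" w] by simp
  ultimately have yz: "y \<in> cball z r" using r e by (simp add: dist_norm)
  have "e \<bullet> z \<le> g (P z)"
  proof (rule ccontr)
    assume "\<not> ?thesis"
    then have "z \<in> \<Omega> \<inter> U" using U z by (simp add: P_def)
    then show False using z by simp
  qed
  moreover have "\<bar>g (P z) - g (P y)\<bar> \<le> L * norm w"
  proof -
    have "\<bar>g (P z) - g (P y)\<bar> \<le> L * norm (P z - P y)"
      using lipschitz_onD[OF g Pk[of z] Pk[of y]] by (simp add: dist_norm)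
    also have "P z - P y = - P w" by (simp add: P_def y_eq inner_add_right inner_diff_right ee scaleR_add_left scaleR_diff_left)
    also have "norm (- P w) \<le> norm w"
    proof -
      have "(norm (P w))\<^sup>2 = (norm w)\<^sup>2 - (e \<bullet> w)\<^sup>2"
        unfolding P_def power2_norm_eq_inner by (simp add: inner_diff_left inner_diff_right ee inner_commute[of w e] power2_eq_square)
      then have "(norm (P w))\<^sup>2 \<le> (norm w)\<^sup>2" by simp
      from power2_le_imp_le[OF this] show ?thesis by simp
    qed
    finally show ?thesis using L0 by (simp add: mult_left_mono)
  qed
  moreover have "e \<bullet> y = e \<bullet> z - r / 2 + e \<bullet> w" by (simp add: y_eq inner_add_right inner_diff_right ee)
  moreover have "e \<bullet> w \<le> norm w" using Cauchy_Schwarz_ineq2[of e w] e by simp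
  ultimately have "e \<bullet> y \<le> g (P y)" using w' by (simp add: distrib_right)
  then have "y \<notin> \<Omega> \<inter> U" using U by (simp add: P_def)
  moreover have "y \<in> U" using yz r(2) by blast
  ultimately have "y \<notin> \<Omega>" by simp
  with yz show "y \<in> cball z r - \<Omega>" by (rule DiffI)
qed

text \<open>The boundary is compact, so finitely many of the local graph representations suffice.\<close>
lemma uniform_exterior_ball_small:
  fixes \<Omega> :: "(real^'n) set"
  assumes O: "open \<Omega>" "bounded \<Omega>" and lip: "lipschitz_boundary \<Omega>"
  shows "\<exists>\<theta>>0. \<exists>r0>0. \<theta> \<le> 1 \<and> (\<forall>z\<in>frontier \<Omega>. \<forall>r. 0 < r \<and> r \<le> r0 \<longrightarrow> (\<exists>p. cball p (\<theta> * r) \<subseteq> cball z r - \<Omega>))"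
proof -
  define Q where "Q x \<rho> \<theta> \<longleftrightarrow> 0 < \<rho> \<and> 0 < \<theta> \<and> (\<forall>z\<in>frontier \<Omega> \<inter> ball x \<rho>. \<forall>r. 0 < r \<and> r < \<rho> \<longrightarrow>
      (\<exists>p. cball p (\<theta> * r) \<subseteq> cball z r - \<Omega>))" for x \<rho> \<theta>
  have "\<exists>\<rho> \<theta>. 0 < \<rho> \<and> 0 < \<theta> \<and> (\<forall>z\<in>frontier \<Omega> \<inter> ball x \<rho>. \<forall>r. 0 < r \<and> r < \<rho> \<longrightarrow> (\<exists>p. cball p (\<theta> * r) \<subseteq> cball z r - \<Omega>))"
    if x: "x \<in> frontier \<Omega>" for x
  proof -
    obtain U e g L where U: "open U" "x \<in> U" and e: "norm e = 1"
      and g: "L-lipschitz_on {w. e \<bullet> w = 0} (g :: real^'n \<Rightarrow> real)"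
      and eq: "\<Omega> \<inter> U = {y\<in>U. g (y - (e \<bullet> y) *\<^sub>R e) < e \<bullet> y}"
      by (rule exE[OF lip[unfolded lipschitz_boundary_def, rule_format, OF x]]) (elim exE conjE, rule that)
    obtain \<rho> where \<rho>: "\<rho> > 0" "ball x \<rho> \<subseteq> U" using U open_contains_ball by blast
    have L0: "0 \<le> L" using g by (rule lipschitz_on_nonneg)
    have "\<exists>p. cball p ((1 / (2 * (1 + L))) * r) \<subseteq> cball z r - \<Omega>"
      if z: "z \<in> frontier \<Omega> \<inter> ball x (\<rho>/2)" and r: "0 < r" "r < \<rho>/2" for z r
    proof -
      have "cball z r \<subseteq> ball x \<rho>"
      proof
        fix y assume "y \<in> cball z r"
        then have "dist x y < \<rho>" using z r dist_triangle[of x y z] by simp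
        then show "y \<in> ball x \<rho>" by simp
      qed
      then have sub: "cball z r \<subseteq> U" using \<rho> by blast
      have "z \<notin> \<Omega>" using z O(1) by (auto simp: frontier_def interior_open)
      moreover have "z \<in> U" using sub r by auto
      ultimately show ?thesis
        using lipschitz_epigraph_exterior_ball[OF e g eq _ _ r(1) sub] by (intro exI[of _ "z - (r/2) *\<^sub>R e"]) simp
    qed
    then show ?thesis using \<rho> L0 by (intro exI[of _ "\<rho>/2"] exI[of _ "1 / (2 * (1 + L))"]) auto
  qed
  then have "\<forall>x\<in>frontier \<Omega>. \<exists>\<rho> \<theta>. Q x \<rho> \<theta>" unfolding Q_def by blast
  then obtain \<rho> \<theta> where Q: "\<And>x. x \<in> frontier \<Omega> \<Longrightarrow> Q x (\<rho> x) (\<theta> x)" by metis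
  then have \<rho>: "\<And>x. x \<in> frontier \<Omega> \<Longrightarrow> 0 < \<rho> x" and \<theta>: "\<And>x. x \<in> frontier \<Omega> \<Longrightarrow> 0 < \<theta> x"
    and ball: "\<And>x z r. x \<in> frontier \<Omega> \<Longrightarrow> z \<in> frontier \<Omega> \<inter> ball x (\<rho> x) \<Longrightarrow> 0 < r \<Longrightarrow> r < \<rho> x
        \<Longrightarrow> \<exists>p. cball p (\<theta> x * r) \<subseteq> cball z r - \<Omega>" unfolding Q_def by blast+
  have comp: "compact (frontier \<Omega>)" using O(2) by (rule compact_frontier_bounded)
  have cov: "frontier \<Omega> \<subseteq> (\<Union>x\<in>frontier \<Omega>. ball x (\<rho> x))" using \<rho> by auto
  obtain C where C: "C \<subseteq> frontier \<Omega>" "finite C" "frontier \<Omega> \<subseteq> (\<Union>x\<in>C. ball x (\<rho> x))"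
    by (rule compactE_image[OF comp _ cov]) auto
  define r0 where "r0 = Min (insert 1 (\<rho> ` C)) / 2"
  define th where "th = Min (insert 1 (\<theta> ` C))"
  have r0: "r0 > 0" unfolding r0_def using C \<rho> by (auto simp: Min_gr_iff)
  have th: "th > 0" "th \<le> 1" unfolding th_def using C \<theta> by (auto simp: Min_gr_iff)
  have "\<exists>p. cball p (th * r) \<subseteq> cball z r - \<Omega>" if z: "z \<in> frontier \<Omega>" and r: "0 < r" "r \<le> r0" for z r
  proof -
    obtain x where x: "x \<in> C" "z \<in> ball x (\<rho> x)" using C(3) z by blast
    have "Min (insert 1 (\<rho> ` C)) \<le> \<rho> x" using C(2) x by (intro Min_le) auto
    then have "r < \<rho> x" using r r0 by (simp add: r0_def)
    then obtain p where p: "cball p (\<theta> x * r) \<subseteq> cball z r - \<Omega>" using ball[of x z r] x C(1) z r by blast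
    have "th \<le> \<theta> x" unfolding th_def using C(2) x by (intro Min_le) auto
    then have "cball p (th * r) \<subseteq> cball p (\<theta> x * r)" using r by (intro subset_cball mult_right_mono) auto
    then show ?thesis using p by blast
  qed
  then show ?thesis using th r0 by blast
qed

text \<open>For radii beyond those that the local graphs allow, the ball found for a proportionally reduced
  radius serves.\<close>
lemma uniform_exterior_ball:
  fixes \<Omega> :: "(real^'n) set"
  assumes O: "open \<Omega>" "bounded \<Omega>" and lip: "lipschitz_boundary \<Omega>" and D: "0 < D"
  shows "\<exists>\<theta>>0. \<theta> \<le> 1 \<and> (\<forall>z\<in>frontier \<Omega>. \<forall>r. 0 < r \<and> r \<le> D \<longrightarrow> (\<exists>p. cball p (\<theta> * r) \<subseteq> cball z r - \<Omega>))"
proof -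
  obtain th r0 where th: "th > 0" "th \<le> 1" "r0 > 0"
    and b: "\<And>z r. z \<in> frontier \<Omega> \<Longrightarrow> 0 < r \<Longrightarrow> r \<le> r0 \<Longrightarrow> \<exists>p. cball p (th * r) \<subseteq> cball z r - \<Omega>"
    using uniform_exterior_ball_small[OF O lip] by blast
  define m where "m = min 1 (r0 / D)"
  have m: "0 < m" "m \<le> 1" "m * D \<le> r0" using th D by (auto simp: m_def min_def field_simps)
  have "\<exists>p. cball p ((th * m) * r) \<subseteq> cball z r - \<Omega>" if zr: "z \<in> frontier \<Omega>" "0 < r" "r \<le> D" for z r
  proof -
    have "m * r \<le> m * D" using m zr by simp
    then have "m * r \<le> r0" "0 < m * r" using m(3) mult_pos_pos[OF m(1) zr(2)] by linarith+
    then obtain p where p: "cball p (th * (m * r)) \<subseteq> cball z (m * r) - \<Omega>" using b[of z "m * r"] zr(1) by blast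
    have "cball z (m * r) \<subseteq> cball z r" using m zr by (intro subset_cball) (simp add: mult_left_le_one_le)
    then show ?thesis using p by (auto simp: mult.assoc)
  qed
  moreover have "th * m \<le> 1" using th m by (simp add: mult_le_one)
  ultimately show ?thesis using th m by (intro exI[of _ "th * m"]) auto
qed

text \<open>A boundary point in the interior of the closure would have an exterior ball that is contained in
  the closure.\<close>
lemma interior_closure_subset_domain:
  fixes \<Omega> :: "(real^'n) set"
  assumes O: "open \<Omega>" "bounded \<Omega>" and lip: "lipschitz_boundary \<Omega>"
  shows "interior (closure \<Omega>) \<subseteq> \<Omega>"
proof (rule ccontr)
  assume "\<not> ?thesis"
  then obtain x where x: "x \<in> interior (closure \<Omega>)" "x \<notin> \<Omega>" by blast
  then have xf: "x \<in> frontier \<Omega>" using O(1) interior_subset[of "closure \<Omega>"] by (auto simp: frontier_def interior_open)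
  obtain \<theta> where \<theta>: "\<theta> > 0" "\<And>r. 0 < r \<Longrightarrow> r \<le> 1 \<Longrightarrow> \<exists>p. cball p (\<theta> * r) \<subseteq> cball x r - \<Omega>"
    using uniform_exterior_ball[OF O lip, of 1] xf by auto
  obtain e where e: "e > 0" "cball x e \<subseteq> closure \<Omega>" using x(1) unfolding mem_interior_cball by blast
  define r where "r = min e 1"
  have r: "r > 0" "r \<le> 1" "r \<le> e" using e by (auto simp: r_def)
  obtain p where p: "cball p (\<theta> * r) \<subseteq> cball x r - \<Omega>" using \<theta>(2) r by blast
  have pos: "\<theta> * r > 0" using \<theta> r by simp
  have "p \<in> cball x r" using p pos by force
  then have "p \<in> closure \<Omega>" using e(2) r(3) subset_cball[of r e x] by blast
  moreover have "ball p (\<theta> * r) \<inter> \<Omega> = {}" using p by force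
  then have "ball p (\<theta> * r) \<inter> closure \<Omega> = {}" by (simp add: open_Int_closure_eq_empty)
  moreover have "p \<in> ball p (\<theta> * r)" using pos by simp
  ultimately show False by blast
qed

section \<open>Hat functions\<close>

lemma affine_interpolation:
  fixes C :: "(real^'n) set" and val :: "real^'n \<Rightarrow> real"
  assumes "\<not> affine_dependent C"
  shows "\<exists>p q. \<forall>v\<in>C. p \<bullet> v + q = val v"
proof (cases "C = {}")
  case False
  then obtain z where z: "z \<in> C" by blast
  define S where "S = C - {z}"
  have C: "C = insert z S" "z \<notin> S" using z by (auto simp: S_def)
  have ind: "independent ((\<lambda>x. - z + x) ` S)"
    using assms affine_dependent_iff_dependent[OF C(2)] C(1) by simp
  obtain g where g: "linear g" "\<And>x. x \<in> (\<lambda>x. - z + x) ` S \<Longrightarrow> g x = val (x + z) - val z"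
    using linear_independent_extend[OF ind, of "\<lambda>x. val (x + z) - val z"] by blast
  define p where "p = adjoint g 1"
  have gp: "g x = p \<bullet> x" for x using adjoint_works[OF g(1), of x 1] by (simp add: p_def inner_commute)
  have "p \<bullet> v + (val z - p \<bullet> z) = val v" if "v \<in> C" for v
  proof (cases "v = z")
    case False
    then have "- z + v \<in> (\<lambda>x. - z + x) ` S" using that C by auto
    from g(2)[OF this] show ?thesis by (simp add: gp inner_diff_right)
  qed simp
  then show ?thesis by blast
qed auto

lemma affine_nonneg_on_hull:
  fixes C :: "(real^'n) set"
  assumes "\<And>v. v \<in> C \<Longrightarrow> 0 \<le> p \<bullet> v + q" "x \<in> convex hull C" shows "0 \<le> p \<bullet> x + q"
proof -
  have "- q \<le> p \<bullet> v" if "v \<in> C" for v using assms(1)[OF that] by linarith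
  then have "C \<subseteq> {x. p \<bullet> x \<ge> - q}" by blast
  then have "convex hull C \<subseteq> {x. p \<bullet> x \<ge> - q}" using convex_halfspace_ge by (rule hull_minimal)
  then show ?thesis using assms(2) by force
qed

lemma affine_eq_on_hull:
  fixes C :: "(real^'n) set"
  assumes "\<And>v. v \<in> C \<Longrightarrow> p \<bullet> v + q = p' \<bullet> v + q'" "x \<in> convex hull C" shows "p \<bullet> x + q = p' \<bullet> x + q'"
proof -
  have "0 \<le> (p - p') \<bullet> x + (q - q')"
    by (rule affine_nonneg_on_hull[OF _ assms(2)]) (use assms(1) in \<open>simp add: inner_diff_left algebra_simps\<close>)
  moreover have "0 \<le> (p' - p) \<bullet> x + (q' - q)"
    by (rule affine_nonneg_on_hull[OF _ assms(2)]) (use assms(1) in \<open>simp add: inner_diff_left algebra_simps\<close>)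
  ultimately show ?thesis by (simp add: inner_diff_left)
qed

locale triangulated =
  fixes \<T> :: "(real^'n) set set"
  assumes tri: "triangulation \<T>" and full: "\<And>T. T \<in> \<T> \<Longrightarrow> int CARD('n) simplex T"
begin

definition corners :: "(real^'n) set \<Rightarrow> (real^'n) set" where "corners T = {z. z extreme_point_of T}"

lemma finite_mesh: "finite \<T>" using tri by (simp add: triangulation_def)

lemma corners:
  assumes "T \<in> \<T>"
  shows "\<not> affine_dependent (corners T)" "finite (corners T)" "T = convex hull (corners T)"
proof -
  obtain C where C: "\<not> affine_dependent C" "T = convex hull C" using full[OF assms] by (auto simp: simplex_def)
  then have "corners T = C" unfolding corners_def using extreme_point_of_convex_hull_affine_independent[OF C(1)] by auto
  then show "\<not> affine_dependent (corners T)" "finite (corners T)" "T = convex hull (corners T)"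
    using C aff_independent_finite by auto
qed

lemma corners_subset: "T \<in> \<T> \<Longrightarrow> corners T \<subseteq> T" by (auto simp: corners_def extreme_point_of_def)

lemma mesh_vertices_eq: "mesh_vertices \<T> = \<Union>(corners ` \<T>)"
  by (auto simp: mesh_vertices_def corners_def)

lemma finite_mesh_vertices: "finite (mesh_vertices \<T>)"
  unfolding mesh_vertices_eq using finite_mesh corners(2) by auto

lemma cell_compact_convex: assumes "T \<in> \<T>" shows "compact T" "convex T" "closed T"
  using full[OF assms] compact_simplex convex_simplex closed_simplex by blast+

text \<open>Two cells meet in a common face, which is the hull of its extreme points, and those are
  corners of both cells; so affine interpolants on the two cells agree there.\<close>
lemma nodal_interpolant_exists:
  fixes val :: "real^'n \<Rightarrow> real"
  shows "\<exists>\<phi>. (\<forall>T\<in>\<T>. \<exists>p q. \<forall>x\<in>T. \<phi> x = p \<bullet> x + q) \<and> (\<forall>y\<in>mesh_vertices \<T>. \<phi> y = val y) \<and> (\<forall>x. x \<notin> \<Union>\<T> \<longrightarrow> \<phi> x = 0)"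
proof -
  have "\<forall>T\<in>\<T>. \<exists>pq. \<forall>v\<in>corners T. fst pq \<bullet> v + snd pq = val v"
    using affine_interpolation[OF corners(1)] by auto
  then obtain pq where pq: "\<And>T v. T \<in> \<T> \<Longrightarrow> v \<in> corners T \<Longrightarrow> fst (pq T) \<bullet> v + snd (pq T) = val v" by metis
  define a where "a T x = fst (pq T) \<bullet> x + snd (pq T)" for T x
  have agree: "a T x = a T' x" if T: "T \<in> \<T>" "T' \<in> \<T>" and x: "x \<in> T" "x \<in> T'" for T T' x
  proof -
    let ?F = "T \<inter> T'"
    have face: "A \<inter> B face_of A" if "A \<in> \<T>" "B \<in> \<T>" for A B using tri that by (simp add: triangulation_def)
    have F: "?F face_of T" "?F face_of T'" using face[OF T] face[OF T(2,1)] by (simp_all add: Int_commute)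
    have "?F = convex hull {v. v extreme_point_of ?F}"
      by (rule Krein_Milman_Minkowski) (use cell_compact_convex T in \<open>auto intro: compact_Int convex_Int\<close>)
    then have xF: "x \<in> convex hull {v. v extreme_point_of ?F}" using x by auto
    show ?thesis unfolding a_def
    proof (rule affine_eq_on_hull[OF _ xF])
      fix v assume "v \<in> {v. v extreme_point_of ?F}"
      then have "v \<in> corners T" "v \<in> corners T'"
        using extreme_point_of_face[OF F(1), of v] extreme_point_of_face[OF F(2), of v] by (auto simp: corners_def)
      then show "fst (pq T) \<bullet> v + snd (pq T) = fst (pq T') \<bullet> v + snd (pq T')" using pq T by simp
    qed
  qed
  define \<phi> where "\<phi> x = (if x \<in> \<Union>\<T> then a (SOME T. T \<in> \<T> \<and> x \<in> T) x else 0)" for x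
  have \<phi>: "\<phi> x = a T x" if "T \<in> \<T>" "x \<in> T" for T x
  proof -
    have "\<exists>T. T \<in> \<T> \<and> x \<in> T" using that by blast
    from someI_ex[OF this] have "(SOME T. T \<in> \<T> \<and> x \<in> T) \<in> \<T>" "x \<in> (SOME T. T \<in> \<T> \<and> x \<in> T)" by auto
    from agree[OF this(1) that(1) this(2) that(2)] show ?thesis using that by (auto simp: \<phi>_def)
  qed
  show ?thesis
  proof (intro exI[of _ \<phi>] conjI ballI allI impI)
    show "\<exists>p q. \<forall>x\<in>T. \<phi> x = p \<bullet> x + q" if "T \<in> \<T>" for T using \<phi>[OF that] by (auto simp: a_def)
    show "\<phi> y = val y" if y: "y \<in> mesh_vertices \<T>" for y
    proof -
      obtain T where T: "T \<in> \<T>" "y \<in> corners T" using y by (auto simp: mesh_vertices_eq)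
      then show ?thesis using \<phi>[OF T(1)] corners_subset[OF T(1)] pq[OF T] by (auto simp: a_def)
    qed
    show "\<phi> x = 0" if "x \<notin> \<Union>\<T>" for x using that by (simp add: \<phi>_def)
  qed
qed

lemma hat_function_props:
  shows "\<And>T. T \<in> \<T> \<Longrightarrow> \<exists>p q. \<forall>x\<in>T. hat_function \<T> z x = p \<bullet> x + q"
    and "\<And>y. y \<in> mesh_vertices \<T> \<Longrightarrow> hat_function \<T> z y = (if y = z then 1 else 0)"
    and "\<And>x. x \<notin> \<Union>\<T> \<Longrightarrow> hat_function \<T> z x = 0"
proof -
  define P where "P \<phi> \<longleftrightarrow> (\<forall>T\<in>\<T>. \<exists>p q. \<forall>x\<in>T. \<phi> x = p \<bullet> x + q) \<and>
      (\<forall>y\<in>mesh_vertices \<T>. \<phi> y = (if y = z then 1 else 0)) \<and> (\<forall>x. x \<notin> \<Union>\<T> \<longrightarrow> \<phi> x = 0)" for \<phi> :: "real^'n \<Rightarrow> real"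
  obtain \<phi> where \<phi>: "P \<phi>" using nodal_interpolant_exists[of "\<lambda>y. if y = z then 1 else 0"] unfolding P_def by blast
  have PD: "\<exists>p q. \<forall>x\<in>T. \<psi> x = p \<bullet> x + q" if "P \<psi>" "T \<in> \<T>" for \<psi> T using that by (simp add: P_def)
  have uniq: "\<psi> = \<phi>" if \<psi>: "P \<psi>" for \<psi>
  proof
    fix x show "\<psi> x = \<phi> x"
    proof (cases "x \<in> \<Union>\<T>")
      case False then show ?thesis using \<phi> \<psi> by (simp add: P_def)
    next
      case True
      then obtain T where T: "T \<in> \<T>" "x \<in> T" by blast
      obtain p q where pq: "\<And>x. x \<in> T \<Longrightarrow> \<phi> x = p \<bullet> x + q" using PD[OF \<phi> T(1)] by blast
      obtain p' q' where pq': "\<And>x. x \<in> T \<Longrightarrow> \<psi> x = p' \<bullet> x + q'" using PD[OF \<psi> T(1)] by blast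
      have "p' \<bullet> x + q' = p \<bullet> x + q"
      proof (rule affine_eq_on_hull)
        show "x \<in> convex hull (corners T)" using corners(3)[OF T(1)] T(2) by simp
        fix v assume v: "v \<in> corners T"
        then have "v \<in> mesh_vertices \<T>" "v \<in> T" using T corners_subset[OF T(1)] by (auto simp: mesh_vertices_eq)
        then show "p' \<bullet> v + q' = p \<bullet> v + q" using pq[of v] pq'[of v] \<phi> \<psi> by (simp add: P_def)
      qed
      then show ?thesis using pq[OF T(2)] pq'[OF T(2)] by simp
    qed
  qed
  have "hat_function \<T> z = (THE \<phi>. P \<phi>)" unfolding hat_function_def P_def by (rule refl)
  also have "\<dots> = \<phi>" by (rule the_equality[of P, OF \<phi> uniq])
  finally have hat: "P (hat_function \<T> z)" using \<phi> by (simp only:)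
  show "\<And>T. T \<in> \<T> \<Longrightarrow> \<exists>p q. \<forall>x\<in>T. hat_function \<T> z x = p \<bullet> x + q"
    "\<And>y. y \<in> mesh_vertices \<T> \<Longrightarrow> hat_function \<T> z y = (if y = z then 1 else 0)"
    "\<And>x. x \<notin> \<Union>\<T> \<Longrightarrow> hat_function \<T> z x = 0"
    using hat unfolding P_def by blast+
qed

lemma hat_nonneg: "0 \<le> hat_function \<T> z x"
proof (cases "x \<in> \<Union>\<T>")
  case True
  then obtain T where T: "T \<in> \<T>" "x \<in> T" by blast
  obtain p q where pq: "\<And>x. x \<in> T \<Longrightarrow> hat_function \<T> z x = p \<bullet> x + q" using hat_function_props(1)[OF T(1)] by blast
  have "0 \<le> p \<bullet> x + q"
  proof (rule affine_nonneg_on_hull)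
    show "x \<in> convex hull (corners T)" using corners(3)[OF T(1)] T(2) by simp
    fix v assume v: "v \<in> corners T"
    then have "v \<in> mesh_vertices \<T>" "v \<in> T" using T corners_subset[OF T(1)] by (auto simp: mesh_vertices_eq)
    then show "0 \<le> p \<bullet> v + q" using pq[of v, symmetric] hat_function_props(2)[of v z] by simp
  qed
  then show ?thesis using pq T by simp
qed (simp add: hat_function_props(3))

lemma hat_partition_of_unity:
  assumes "x \<in> \<Union>\<T>" shows "(\<Sum>z\<in>mesh_vertices \<T>. hat_function \<T> z x) = 1"
proof -
  obtain T where T: "T \<in> \<T>" "x \<in> T" using assms by blast
  have "\<forall>z. \<exists>pq. \<forall>x\<in>T. hat_function \<T> z x = fst pq \<bullet> x + snd pq" using hat_function_props(1)[OF T(1)] by auto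
  then obtain pq where pq: "\<And>z x. x \<in> T \<Longrightarrow> hat_function \<T> z x = fst (pq z) \<bullet> x + snd (pq z)" by metis
  let ?p = "\<Sum>z\<in>mesh_vertices \<T>. fst (pq z)" and ?q = "\<Sum>z\<in>mesh_vertices \<T>. snd (pq z)"
  have sum: "(\<Sum>z\<in>mesh_vertices \<T>. hat_function \<T> z y) = ?p \<bullet> y + ?q" if "y \<in> T" for y
    using pq[OF that] by (simp add: inner_sum_left sum.distrib)
  have "?p \<bullet> x + ?q = 0 \<bullet> x + 1"
  proof (rule affine_eq_on_hull)
    show "x \<in> convex hull (corners T)" using corners(3)[OF T(1)] T(2) by simp
    fix v assume v: "v \<in> corners T"
    then have v': "v \<in> mesh_vertices \<T>" "v \<in> T" using T corners_subset[OF T(1)] by (auto simp: mesh_vertices_eq)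
    have "(\<Sum>z\<in>mesh_vertices \<T>. hat_function \<T> z v) = (\<Sum>z\<in>mesh_vertices \<T>. if v = z then 1 else 0)"
      using hat_function_props(2)[OF v'(1)] by simp
    also have "\<dots> = 1" using v'(1) finite_mesh_vertices by simp
    finally show "?p \<bullet> v + ?q = 0 \<bullet> v + 1" using sum[OF v'(2)] by simp
  qed
  then show ?thesis using sum[OF T(2)] by simp
qed

lemma hat_support:
  assumes T: "T \<in> \<T>" "x \<in> T" and nz: "hat_function \<T> z x \<noteq> 0"
  shows "z \<in> corners T"
proof (rule ccontr)
  assume z: "z \<notin> corners T"
  obtain p q where pq: "\<And>x. x \<in> T \<Longrightarrow> hat_function \<T> z x = p \<bullet> x + q" using hat_function_props(1)[OF T(1)] by blast
  have "p \<bullet> x + q = 0 \<bullet> x + 0"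
  proof (rule affine_eq_on_hull)
    show "x \<in> convex hull (corners T)" using corners(3)[OF T(1)] T(2) by simp
    fix v assume v: "v \<in> corners T"
    then have "v \<in> mesh_vertices \<T>" "v \<in> T" "v \<noteq> z" using T z corners_subset[OF T(1)] by (auto simp: mesh_vertices_eq)
    then show "p \<bullet> v + q = 0 \<bullet> v + 0" using pq[of v, symmetric] hat_function_props(2)[of v z] by simp
  qed
  then show False using nz pq[OF T(2)] by simp
qed

lemma hat_support_diameter:
  assumes nz: "hat_function \<T> z x \<noteq> 0" shows "norm (x - z) \<le> mesh_size \<T>"
proof -
  have "x \<in> \<Union>\<T>" using nz hat_function_props(3) by blast
  then obtain T where T: "T \<in> \<T>" "x \<in> T" by blast
  have "z \<in> T" using hat_support[OF T nz] corners_subset[OF T(1)] by blast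
  then have "dist x z \<le> diameter T"
    using T cell_compact_convex(1)[OF T(1)] by (intro diameter_bounded_bound) (auto simp: compact_imp_bounded)
  also have "\<dots> \<le> mesh_size \<T>" unfolding mesh_size_def using finite_mesh T(1) by (intro Max_ge) auto
  finally show ?thesis by (simp add: dist_norm)
qed

text \<open>The barycentric coordinate of \<open>z\<close> measures how far a point of a cell can be moved away from
  the corner \<open>z\<close> without leaving the cell.\<close>
lemma dilation_stays_in_cell:
  assumes T: "T \<in> \<T>" "x \<in> T" and z: "z \<in> corners T" and t: "0 < t" and h: "hat_function \<T> z x \<ge> 1 - t"
  shows "z + (1/t) *\<^sub>R (x - z) \<in> T"
proof -
  let ?C = "corners T"
  obtain p q where pq: "\<And>x. x \<in> T \<Longrightarrow> hat_function \<T> z x = p \<bullet> x + q" using hat_function_props(1)[OF T(1)] by blast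
  have fin: "finite ?C" using corners(2)[OF T(1)] .
  have Tc: "T = convex hull ?C" by (rule corners(3)[OF T(1)])
  obtain u where u: "\<And>v. v \<in> ?C \<Longrightarrow> 0 \<le> u v" "sum u ?C = 1" "(\<Sum>v\<in>?C. u v *\<^sub>R v) = x"
  proof -
    have "x \<in> {y. \<exists>u. (\<forall>v\<in>?C. 0 \<le> u v) \<and> sum u ?C = 1 \<and> (\<Sum>v\<in>?C. u v *\<^sub>R v) = y}"
      using T(2) Tc convex_hull_finite[OF fin] by metis
    then show ?thesis using that by blast
  qed
  have "hat_function \<T> z x = u z"
  proof -
    have "p \<bullet> x + q = (\<Sum>v\<in>?C. u v * (p \<bullet> v + q))"
      using u(2,3) by (simp add: distrib_left sum.distrib inner_sum_right sum_distrib_right[symmetric] flip: u(3))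
    also have "\<dots> = (\<Sum>v\<in>?C. if v = z then u v else 0)"
    proof (rule sum.cong[OF refl])
      fix v assume v: "v \<in> ?C"
      then have "v \<in> mesh_vertices \<T>" "v \<in> T" using T corners_subset[OF T(1)] by (auto simp: mesh_vertices_eq)
      then show "u v * (p \<bullet> v + q) = (if v = z then u v else 0)" using pq[of v, symmetric] hat_function_props(2)[of v z] by simp
    qed
    also have "\<dots> = u z" using z fin by simp
    finally show ?thesis using pq[OF T(2)] by simp
  qed
  then have uz: "u z \<ge> 1 - t" using h by simp
  define u' where "u' v = u v / t + (if v = z then 1 - 1/t else 0)" for v
  have "0 \<le> u' v" if "v \<in> ?C" for v
  proof (cases "v = z")
    case True
    have "u' v = (u z - (1 - t)) / t" using True t by (simp add: u'_def field_simps)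
    then show ?thesis using uz t by simp
  qed (use u(1)[OF that] t in \<open>simp add: u'_def\<close>)
  moreover have "sum u' ?C = 1"
    using u(2) z fin by (simp add: u'_def[abs_def] sum.distrib sum_divide_distrib[symmetric])
  moreover have "(\<Sum>v\<in>?C. u' v *\<^sub>R v) = z + (1/t) *\<^sub>R (x - z)"
  proof -
    have "(\<Sum>v\<in>?C. u' v *\<^sub>R v) = (\<Sum>v\<in>?C. (1/t) *\<^sub>R (u v *\<^sub>R v)) + (\<Sum>v\<in>?C. if v = z then (1 - 1/t) *\<^sub>R v else 0)"
      unfolding sum.distrib[symmetric] by (rule sum.cong) (auto simp: u'_def scaleR_add_left)
    also have "\<dots> = (1/t) *\<^sub>R x + (1 - 1/t) *\<^sub>R z"
      unfolding scaleR_sum_right[symmetric] u(3) using z fin by simp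
    also have "\<dots> = z + (1/t) *\<^sub>R (x - z)" by (simp add: algebra_simps)
    finally show ?thesis .
  qed
  ultimately have "z + (1/t) *\<^sub>R (x - z) \<in> convex hull ?C" unfolding convex_hull_finite[OF fin] by blast
  then show ?thesis by (rule ssubst[OF Tc, of "\<lambda>S. z + (1/t) *\<^sub>R (x - z) \<in> S"])
qed

text \<open>The set where the hat function is positive is star-shaped: the homothety about \<open>z\<close> with a
  small ratio \<open>t\<close> maps it onto \<open>{hat > 1 - t}\<close>, which lies near \<open>z\<close> and hence inside the
  triangulated region, where it is open by continuity.\<close>
lemma open_hat_positive:
  assumes z: "z \<in> mesh_vertices \<T>" and r: "0 < r" "ball z r \<subseteq> \<Union>\<T>"
  shows "open {x. 0 < hat_function \<T> z x}"
proof -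
  let ?h = "hat_function \<T> z" and ?H = "mesh_size \<T>"
  have hz: "?h z = 1" using hat_function_props(2)[OF z] by simp
  have H0: "0 \<le> ?H" using hat_support_diameter[of z z] hz by simp
  define t where "t = min (1/2) (r / (2 * (?H + 1)))"
  have "r / (2 * (?H + 1)) > 0" using r H0 by simp
  then have t: "0 < t" "t < 1" by (auto simp: t_def)
  have "t * ?H \<le> (r / (2 * (?H + 1))) * (?H + 1)" using t H0 by (intro mult_mono) (auto simp: t_def)
  also have "\<dots> = r / 2" using H0 by (simp add: field_simps)
  finally have tH: "t * ?H < r" using r by simp
  have aff: "?h (z + s *\<^sub>R (y - z)) = (1 - s) + s * ?h y" if yT: "T \<in> \<T>" "y \<in> T" "z \<in> T" "z + s *\<^sub>R (y - z) \<in> T" for T y s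
  proof -
    obtain p q where pq: "\<And>x. x \<in> T \<Longrightarrow> ?h x = p \<bullet> x + q" using hat_function_props(1)[OF yT(1)] by blast
    have pz: "p \<bullet> z = 1 - q" using pq[OF yT(3)] hz by simp
    show ?thesis unfolding pq[OF yT(2)] pq[OF yT(4)] inner_add_right inner_diff_right inner_scaleR_right pz
      by (simp add: algebra_simps)
  qed
  have zT: "z \<in> T" if "T \<in> \<T>" "x \<in> T" "?h x \<noteq> 0" for T x using hat_support[OF that] corners_subset[OF that(1)] by blast
  define W where "W = {x. 1 - t < ?h x}"
  have dil: "\<exists>T\<in>\<T>. z \<in> T \<and> x \<in> T \<and> z + (1/t) *\<^sub>R (x - z) \<in> T" if "x \<in> W" for x
  proof -
    have nz: "?h x \<noteq> 0" "?h x \<ge> 1 - t" using that t by (auto simp: W_def)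
    then obtain T where T: "T \<in> \<T>" "x \<in> T" using hat_function_props(3) by blast
    then show ?thesis using dilation_stays_in_cell[OF T hat_support[OF T nz(1)] t(1) nz(2)] zT[OF T nz(1)] by blast
  qed
  have "W \<subseteq> ball z r"
  proof
    fix x assume x: "x \<in> W"
    obtain T where T: "T \<in> \<T>" "z \<in> T" "z + (1/t) *\<^sub>R (x - z) \<in> T" using dil[OF x] by blast
    have "dist (z + (1/t) *\<^sub>R (x - z)) z \<le> diameter T"
      using T cell_compact_convex(1)[OF T(1)] by (intro diameter_bounded_bound) (auto simp: compact_imp_bounded)
    also have "\<dots> \<le> ?H" unfolding mesh_size_def using finite_mesh T(1) by (intro Max_ge) auto
    finally have "norm (x - z) / t \<le> ?H" using t by (simp add: dist_norm)
    then have "norm (x - z) \<le> t * ?H" using t by (simp add: field_simps)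
    then show "x \<in> ball z r" using tH by (simp add: dist_norm norm_minus_commute)
  qed
  define K where "K = (\<Union>T\<in>\<T>. {x\<in>T. ?h x \<le> 1 - t})"
  have "closed K" unfolding K_def
  proof (intro closed_UN finite_mesh ballI)
    fix T assume T: "T \<in> \<T>"
    obtain p q where pq: "\<And>x. x \<in> T \<Longrightarrow> ?h x = p \<bullet> x + q" using hat_function_props(1)[OF T] by blast
    have "{x\<in>T. ?h x \<le> 1 - t} = T \<inter> {x. p \<bullet> x \<le> 1 - t - q}" using pq by (auto simp: algebra_simps)
    then show "closed {x\<in>T. ?h x \<le> 1 - t}" using cell_compact_convex(3)[OF T] by (auto intro: closed_Int closed_halfspace_le)
  qed
  moreover have "W = ball z r - K"
    using \<open>W \<subseteq> ball z r\<close> r(2) by (fastforce simp: W_def K_def)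
  ultimately have oW: "open W" by (simp add: open_Diff)
  have "{x. 0 < ?h x} = (\<lambda>y. z + t *\<^sub>R (y - z)) -` W"
  proof (intro set_eqI iffI)
    fix y assume "y \<in> {x. 0 < ?h x}"
    then have y: "0 < ?h y" by simp
    then obtain T where T: "T \<in> \<T>" "y \<in> T" using hat_function_props(3)[of y z] by force
    have z': "z \<in> T" using zT[OF T] y by simp
    have "(1 - t) *\<^sub>R z + t *\<^sub>R y \<in> T" using cell_compact_convex(2)[OF T(1)] T(2) z' t by (intro convexD) auto
    moreover have "(1 - t) *\<^sub>R z + t *\<^sub>R y = z + t *\<^sub>R (y - z)" by (simp add: algebra_simps)
    ultimately have "z + t *\<^sub>R (y - z) \<in> T" by simp
    from aff[OF T z' this] show "y \<in> (\<lambda>y. z + t *\<^sub>R (y - z)) -` W" using y t by (simp add: W_def)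
  next
    fix y assume y: "y \<in> (\<lambda>y. z + t *\<^sub>R (y - z)) -` W"
    let ?x = "z + t *\<^sub>R (y - z)"
    have x: "?x \<in> W" using y by simp
    obtain T where T: "T \<in> \<T>" "z \<in> T" "?x \<in> T" "z + (1/t) *\<^sub>R (?x - z) \<in> T" using dil[OF x] by blast
    have "z + (1/t) *\<^sub>R (?x - z) = y" using t by simp
    then have yT: "y \<in> T" using T by simp
    from aff[OF T(1) yT T(2,3)] have "?h ?x = (1 - t) + t * ?h y" .
    then have "t * ?h y > 0" using x by (simp add: W_def)
    then show "y \<in> {x. 0 < ?h x}" using t by (simp add: zero_less_mult_iff)
  qed
  moreover have "open ((\<lambda>y. z + t *\<^sub>R (y - z)) -` W)" by (rule open_vimage[OF oW]) (intro continuous_intros)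
  ultimately show ?thesis by simp
qed

lemma hat_slopes:
  "\<exists>p q. \<forall>T\<in>\<T>. \<forall>x\<in>T. hat_function \<T> z x = p T \<bullet> x + q T"
proof -
  have "\<forall>T. \<exists>pq. T \<in> \<T> \<longrightarrow> (\<forall>x\<in>T. hat_function \<T> z x = fst pq \<bullet> x + snd pq)" using hat_function_props(1) by auto
  then obtain pq where "\<And>T x. T \<in> \<T> \<Longrightarrow> x \<in> T \<Longrightarrow> hat_function \<T> z x = fst (pq T) \<bullet> x + snd (pq T)" by metis
  then show ?thesis by (intro exI[of _ "\<lambda>T. fst (pq T)"] exI[of _ "\<lambda>T. snd (pq T)"]) blast
qed

text \<open>On a segment the function is Lipschitz on each of finitely many closed pieces: those cut out by
  the cells and the one where the function vanishes, which is closed by hypothesis.\<close>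
lemma hat_Lipschitz:
  assumes op: "open {x. 0 < hat_function \<T> z x}"
  shows "\<exists>L. \<forall>x y. \<bar>hat_function \<T> z x - hat_function \<T> z y\<bar> \<le> L * norm (x - y)"
proof -
  let ?h = "hat_function \<T> z"
  obtain p q where "\<forall>T\<in>\<T>. \<forall>x\<in>T. ?h x = p T \<bullet> x + q T" using hat_slopes[of z] by (elim exE)
  then have pq: "\<And>T x. T \<in> \<T> \<Longrightarrow> x \<in> T \<Longrightarrow> ?h x = p T \<bullet> x + q T" by blast
  define L where "L = (\<Sum>T\<in>\<T>. norm (p T))"
  have pL: "norm (p T) \<le> L" if "T \<in> \<T>" for T unfolding L_def using finite_mesh that by (intro member_le_sum) auto
  have L0: "0 \<le> L" unfolding L_def by (intro sum_nonneg) auto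
  have "\<bar>?h x - ?h y\<bar> \<le> L * norm (x - y)" for x y
  proof -
    define \<gamma> where "\<gamma> t = x + t *\<^sub>R (y - x)" for t :: real
    have cg: "continuous_on UNIV \<gamma>" unfolding \<gamma>_def by (intro continuous_intros)
    define U where "U i = (case i of None \<Rightarrow> \<gamma> -` (- {x. 0 < ?h x}) | Some T \<Rightarrow> \<gamma> -` T)" for i
    define I where "I = insert None (Some ` \<T>)"
    have "lipschitz_on (L * norm (x - y)) {0..1} (\<lambda>t. ?h (\<gamma> t))"
    proof (rule lipschitz_on_closed_Union[where I = I and U = U])
      show "finite I" using finite_mesh by (simp add: I_def)
      show "0 \<le> L * norm (x - y)" using L0 by simp
      show "closed (U i)" if "i \<in> I" for i
        using that op cell_compact_convex(3) cg unfolding U_def I_def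
        by (auto intro!: closed_vimage)
      show "{0..1} \<subseteq> (\<Union>i\<in>I. U i)"
      proof
        fix t
        show "t \<in> (\<Union>i\<in>I. U i)"
        proof (cases "0 < ?h (\<gamma> t)")
          case True
          then obtain T where "T \<in> \<T>" "\<gamma> t \<in> T" using hat_function_props(3)[of "\<gamma> t" z] by force
          then show ?thesis by (auto simp: I_def U_def)
        qed (auto simp: I_def U_def)
      qed
      fix i assume i: "i \<in> I"
      show "lipschitz_on (L * norm (x - y)) (U i) (\<lambda>t. ?h (\<gamma> t))"
      proof (rule lipschitz_onI)
        show "0 \<le> L * norm (x - y)" using L0 by simp
        fix s t assume st: "s \<in> U i" "t \<in> U i"
        show "dist (?h (\<gamma> s)) (?h (\<gamma> t)) \<le> L * norm (x - y) * dist s t"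
        proof (cases i)
          case None
          then have "?h (\<gamma> s) = 0" "?h (\<gamma> t) = 0" using st hat_nonneg[of z] by (auto simp: U_def intro: antisym)
          then show ?thesis using L0 by simp
        next
          case (Some T)
          then have T: "T \<in> \<T>" "\<gamma> s \<in> T" "\<gamma> t \<in> T" using i st by (auto simp: I_def U_def)
          have "?h (\<gamma> s) - ?h (\<gamma> t) = p T \<bullet> ((s - t) *\<^sub>R (y - x))"
            using pq[OF T(1,2)] pq[OF T(1,3)] by (simp add: \<gamma>_def inner_add_right algebra_simps)
          also have "\<bar>\<dots>\<bar> \<le> norm (p T) * norm ((s - t) *\<^sub>R (y - x))" by (rule Cauchy_Schwarz_ineq2)
          also have "\<dots> \<le> L * norm ((s - t) *\<^sub>R (y - x))" by (intro mult_right_mono pL T) simp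
          finally show ?thesis by (simp add: dist_real_def norm_minus_commute mult_ac)
        qed
      qed
    qed
    from lipschitz_onD[OF this, of 0 1] show ?thesis by (simp add: \<gamma>_def dist_real_def)
  qed
  then show ?thesis by blast
qed

text \<open>A common face that meets the interior of a cell is the whole cell.\<close>
lemma interior_cells_disjoint:
  assumes T: "T \<in> \<T>" "T' \<in> \<T>" and x: "x \<in> interior T" "x \<in> interior T'" shows "T = T'"
proof -
  have sub: "A \<subseteq> B" if AB: "A \<in> \<T>" "B \<in> \<T>" and xx: "x \<in> interior A" "x \<in> interior B" for A B
  proof -
    have F: "(A \<inter> B) face_of A" using tri AB by (auto simp: triangulation_def)
    have "x \<in> (A \<inter> B) \<inter> rel_interior A" using xx interior_subset interior_subset_rel_interior by blast
    then have "A \<subseteq> A \<inter> B" using subset_of_face_of[OF F, of A] by blast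
    then show ?thesis by blast
  qed
  show ?thesis using sub[OF T x] sub[OF T(2,1) x(2,1)] by blast
qed

end

text \<open>The set where the hat function is positive is open and contained in the closure of the domain,
  hence in the domain, because the boundary has exterior balls. So the function vanishes outside the
  domain, and it is affine near every point in the interior of a cell.\<close>
lemma hat_H10_pair:
  fixes \<Omega> :: "(real^'n) set"
  assumes O: "open \<Omega>" "bounded \<Omega>" and lip: "lipschitz_boundary \<Omega>" and mesh: "simplicial_mesh \<Omega> \<T>"
    and z: "z \<in> interior_vertices \<Omega> \<T>"
  shows "\<exists>G. H10_pair \<Omega> (hat_function \<T> z) G" "continuous_on UNIV (hat_function \<T> z)"
proof -
  interpret triangulated \<T> using mesh by unfold_locales (auto simp: simplicial_mesh_def)
  have U: "\<Union>\<T> = closure \<Omega>" using mesh by (simp add: simplicial_mesh_def)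
  let ?h = "hat_function \<T> z"
  have z': "z \<in> mesh_vertices \<T>" "z \<in> \<Omega>" using z by (auto simp: interior_vertices_def)
  obtain r where r: "r > 0" "ball z r \<subseteq> \<Omega>" using O(1) z' open_contains_ball by blast
  have "ball z r \<subseteq> \<Union>\<T>" using r(2) closure_subset U by blast
  then have op: "open {x. 0 < ?h x}" by (rule open_hat_positive[OF z'(1) r(1)])
  have "{x. 0 < ?h x} \<subseteq> closure \<Omega>" using hat_function_props(3)[of _ z] U by force
  then have "{x. 0 < ?h x} \<subseteq> interior (closure \<Omega>)" using op by (rule interior_maximal)
  then have supp: "{x. 0 < ?h x} \<subseteq> \<Omega>" using interior_closure_subset_domain[OF O lip] by blast
  obtain L where L: "\<And>x y. \<bar>?h x - ?h y\<bar> \<le> L * norm (x - y)" using hat_Lipschitz[OF op] by blast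
  have "0 \<le> L" using L by (rule Lipschitz_constant_nonneg)
  then show "continuous_on UNIV ?h"
    by (intro lipschitz_on_continuous_on[of L]) (use L in \<open>auto simp: lipschitz_on_def dist_norm\<close>)
  obtain p q where "\<forall>T\<in>\<T>. \<forall>x\<in>T. ?h x = p T \<bullet> x + q T" using hat_slopes[of z] by (elim exE)
  then have pq: "\<And>T x. T \<in> \<T> \<Longrightarrow> x \<in> T \<Longrightarrow> ?h x = p T \<bullet> x + q T" by blast
  define G where "G x = (\<Sum>T\<in>\<T>. indicator (interior T) x *\<^sub>R p T)" for x
  have Gx: "G x = p T" if T: "T \<in> \<T>" "x \<in> interior T" for T x
  proof -
    have "G x = (\<Sum>T'\<in>\<T>. if T' = T then p T' else 0)" unfolding G_def
    proof (rule sum.cong[OF refl])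
      fix T' assume T': "T' \<in> \<T>"
      show "indicator (interior T') x *\<^sub>R p T' = (if T' = T then p T' else 0)"
      proof (cases "x \<in> interior T'")
        case True
        then show ?thesis using interior_cells_disjoint[OF T(1) T' T(2)] by simp
      next
        case False
        then show ?thesis using T(2) by (metis indicator_simps(2) scaleR_zero_left)
      qed
    qed
    also have "\<dots> = p T" using T(1) finite_mesh by simp
    finally show ?thesis .
  qed
  have "H10_pair \<Omega> ?h G"
  proof (rule lipschitz_locally_affine_H10_pair[OF O L hat_nonneg])
    show "x \<in> \<Omega>" if "?h x \<noteq> 0" for x using that supp hat_nonneg[of z x] by auto
    show "G \<in> borel_measurable (lebesgue_on \<Omega>)"
      unfolding G_def by (intro borel_imp_lebesgue_on borel_measurable_sum borel_measurable_scaleR borel_measurable_indicator) auto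
    have "negligible (\<Union>T\<in>\<T>. frontier T)"
      using finite_mesh cell_compact_convex(2) by (intro negligible_Union) (auto intro: negligible_convex_frontier)
    then have "AE x in lebesgue. x \<notin> (\<Union>T\<in>\<T>. frontier T)" by (simp only: negligible_iff_null_sets AE_not_in)
    then have "AE x in lebesgue. x \<in> \<Omega> \<longrightarrow> (\<exists>r>0. \<forall>y\<in>ball x r. ?h y = ?h x + G x \<bullet> (y - x))"
    proof eventually_elim
      case (elim x)
      show ?case
      proof
        assume "x \<in> \<Omega>"
        then obtain T where T: "T \<in> \<T>" "x \<in> T" using U closure_subset by blast
        have xi: "x \<in> interior T" using elim T closure_subset[of T] by (auto simp: frontier_def)
        then obtain r where r: "r > 0" "ball x r \<subseteq> T" by (auto simp: mem_interior)
        have "?h y = ?h x + G x \<bullet> (y - x)" if "y \<in> ball x r" for y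
          using pq[OF T] pq[OF T(1), of y] that r(2) Gx[OF T(1) xi] by (auto simp: inner_diff_right)
        then show "\<exists>r>0. \<forall>y\<in>ball x r. ?h y = ?h x + G x \<bullet> (y - x)" using r(1) by blast
      qed
    qed
    then show "AE x in lebesgue_on \<Omega>. \<exists>r>0. \<forall>y\<in>ball x r. ?h y = ?h x + G x \<bullet> (y - x)"
      by (subst AE_restrict_space_iff) (use O in auto)
  qed
  then show "\<exists>G. H10_pair \<Omega> ?h G" by blast
qed

section \<open>Quasi-interpolation\<close>

lemma convex_combination_square_le:
  fixes w t :: "'a \<Rightarrow> real"
  assumes "finite I" "\<And>i. i \<in> I \<Longrightarrow> 0 \<le> w i" "sum w I = 1" "\<And>i. i \<in> I \<Longrightarrow> w i \<noteq> 0 \<Longrightarrow> (t i)\<^sup>2 \<le> E"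
  shows "(\<Sum>i\<in>I. w i * t i)\<^sup>2 \<le> E"
proof -
  define \<mu> where "\<mu> = (\<Sum>i\<in>I. w i * t i)"
  have "0 \<le> (\<Sum>i\<in>I. w i * (t i - \<mu>)\<^sup>2)" using assms(2) by (intro sum_nonneg) auto
  also have "\<dots> = (\<Sum>i\<in>I. w i * (t i)\<^sup>2 - 2 * \<mu> * (w i * t i) + \<mu>\<^sup>2 * w i)"
    by (rule sum.cong) (auto simp: power2_eq_square algebra_simps)
  also have "\<dots> = (\<Sum>i\<in>I. w i * (t i)\<^sup>2) - 2 * \<mu> * \<mu> + \<mu>\<^sup>2"
    using assms(3) by (simp add: sum.distrib sum_subtractf sum_distrib_left[symmetric] \<mu>_def)
  finally have "\<mu>\<^sup>2 \<le> (\<Sum>i\<in>I. w i * (t i)\<^sup>2)" by (simp add: power2_eq_square)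
  also have "\<dots> \<le> (\<Sum>i\<in>I. w i * E)"
  proof (rule sum_mono)
    fix i assume i: "i \<in> I"
    show "w i * (t i)\<^sup>2 \<le> w i * E"
      by (cases "w i = 0") (use assms(2,4) i in \<open>auto intro: mult_left_mono\<close>)
  qed
  also have "\<dots> = E" using assms(3) by (simp add: sum_distrib_right[symmetric])
  finally show ?thesis by (simp add: \<mu>_def)
qed

lemma square_of_average_le:
  fixes f :: "real^'n \<Rightarrow> real"
  assumes f: "continuous_on UNIV f" and m: "measure lborel (cball p r) > 0"
  shows "((1 / measure lborel (cball p r)) * (LINT y|lborel. f y * indicator (cball p r) y))\<^sup>2
    \<le> (1 / measure lborel (cball p r)) * (LINT y|lborel. (f y)\<^sup>2 * indicator (cball p r) y)"
proof -
  let ?B = "cball p r" let ?m = "measure lborel ?B"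
  have fm: "f \<in> borel_measurable borel" by (rule borel_measurable_continuous_onI[OF f])
  have int: "integrable lborel (\<lambda>y. g y * indicator ?B y)" if "continuous_on UNIV g" for g :: "real^'n \<Rightarrow> real"
  proof -
    have "integrable lborel (\<lambda>y. indicator ?B y *\<^sub>R g y)"
      by (rule borel_integrable_compact) (use that in \<open>auto intro: continuous_on_subset\<close>)
    then show ?thesis by (simp add: mult.commute)
  qed
  have sq: "(\<lambda>y. (norm (g y * indicator ?B y))\<^sup>2) = (\<lambda>y. (g y)\<^sup>2 * indicator ?B y)" for g :: "real^'n \<Rightarrow> real"
    by (auto simp: indicator_def)
  have s: "square_integrable lborel (\<lambda>y. g y * indicator ?B y)" if g: "continuous_on UNIV g" for g :: "real^'n \<Rightarrow> real"
    unfolding square_integrable_def sq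
  proof
    show "(\<lambda>y. g y * indicator ?B y) \<in> borel_measurable lborel"
      using borel_measurable_continuous_onI[OF g] by (auto intro!: borel_measurable_times borel_measurable_indicator)
    show "integrable lborel (\<lambda>y. (g y)\<^sup>2 * indicator ?B y)" by (rule int) (intro continuous_intros g)
  qed
  have one: "(\<lambda>y. 1 * indicator ?B y) = (indicator ?B :: real^'n \<Rightarrow> real)" by auto
  have "\<bar>LINT y|lborel. (f y * indicator ?B y) \<bullet> (1 * indicator ?B y)\<bar>
      \<le> l2norm lborel (\<lambda>y. f y * indicator ?B y) * l2norm lborel (\<lambda>y. 1 * indicator ?B y :: real)"
    by (rule l2_cauchy_schwarz[OF s[OF f] s]) (rule continuous_on_const)
  also have "(LINT y|lborel. (f y * indicator ?B y) \<bullet> (1 * indicator ?B y)) = (LINT y|lborel. f y * indicator ?B y)"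
    by (intro Bochner_Integration.integral_cong) (auto simp: indicator_def)
  finally have "\<bar>LINT y|lborel. f y * indicator ?B y\<bar> \<le> l2norm lborel (\<lambda>y. f y * indicator ?B y) * l2norm lborel (\<lambda>y. 1 * indicator ?B y :: real)" .
  from power_mono[OF this abs_ge_zero, of 2]
  have "(LINT y|lborel. f y * indicator ?B y)\<^sup>2 \<le> (l2norm lborel (\<lambda>y. f y * indicator ?B y) * l2norm lborel (\<lambda>y. 1 * indicator ?B y :: real))\<^sup>2"
    by (simp only: power2_abs)
  also have "\<dots> = (LINT y|lborel. (f y)\<^sup>2 * indicator ?B y) * ?m"
    unfolding power_mult_distrib l2norm_square sq by simp
  finally have "(LINT y|lborel. f y * indicator ?B y)\<^sup>2 \<le> (LINT y|lborel. (f y)\<^sup>2 * indicator ?B y) * ?m" .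
  then show ?thesis using m by (simp add: power_mult_distrib power2_eq_square field_simps)
qed

text \<open>The quasi-interpolant has as nodal value at \<open>z\<close> the mean over a ball of radius \<open>\<theta> * H\<close>
  that is contained in the ball of radius \<open>H\<close> about \<open>z\<close>. For a vertex on the boundary the ball lies outside the
  domain, where the function vanishes, so that only the interior vertices contribute. All
  balls that are relevant at a point \<open>x\<close> lie in the ball of radius \<open>2 * H\<close> about \<open>x\<close>, so by
  Jensen's inequality the squared error at \<open>x\<close> is at most a mean of \<open>(\<phi> (x + s) - \<phi> x)\<^sup>2\<close> over
  \<open>norm s \<le> 2 * H\<close>, up to the ratio \<open>(2 / \<theta>) ^ CARD('n)\<close> of the volumes; integrating over \<open>x\<close>
  first leaves differences of translates.\<close>
lemma test_function_interpolation_error: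
  fixes \<Omega> :: "(real^'n) set"
  assumes O: "open \<Omega>" "bounded \<Omega>" and mesh: "simplicial_mesh \<Omega> \<T>"
    and H: "H > 0" "mesh_size \<T> \<le> H" and \<theta>: "0 < \<theta>"
    and B: "\<And>z. z \<in> mesh_vertices \<T> \<Longrightarrow> cball (P z) (\<theta> * H) \<subseteq> cball z H"
      "\<And>z. z \<in> mesh_vertices \<T> - \<Omega> \<Longrightarrow> cball (P z) (\<theta> * H) \<inter> \<Omega> = {}"
    and hat: "\<And>z. z \<in> interior_vertices \<Omega> \<T> \<Longrightarrow> square_integrable (lebesgue_on \<Omega>) (hat_function \<T> z)"
    and \<phi>: "\<phi> \<in> test_functions \<Omega>"
  shows "l2norm (lebesgue_on \<Omega>) (\<lambda>x. \<phi> x - lincomb (interior_vertices \<Omega> \<T>)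
      (\<lambda>z. (1 / measure lborel (cball (0::real^'n) (\<theta> * H))) * (LINT x|lebesgue_on \<Omega>. \<phi> x * indicator (cball (P z) (\<theta> * H)) x))
      (hat_function \<T>) x) \<le> 2 * sqrt ((2 / \<theta>) ^ CARD('n)) * H * l2norm (lebesgue_on \<Omega>) (grad \<phi>)"
proof -
  interpret triangulated \<T> using mesh by unfold_locales (auto simp: simplicial_mesh_def)
  have U: "\<Union>\<T> = closure \<Omega>" using mesh by (simp add: simplicial_mesh_def)
  let ?Z = "interior_vertices \<Omega> \<T>" and ?N = "mesh_vertices \<T>" and ?M = "lebesgue_on \<Omega>"
  let ?h = "hat_function \<T>"
  define vol where "vol = unit_ball_vol (real CARD('n))"
  have vol: "vol > 0" by (simp add: vol_def unit_ball_vol_pos)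
  define m where "m = measure lborel (cball (0::real^'n) (\<theta> * H))"
  have m_eq: "measure lborel (cball p (\<theta> * H)) = m" for p :: "real^'n"
    unfolding m_def using H \<theta> by (simp add: content_cball)
  have m_vol: "m = vol * (\<theta> * H) ^ CARD('n)" unfolding m_def vol_def using H \<theta> by (simp add: content_cball)
  have m: "m > 0" unfolding m_vol using vol H \<theta> by simp
  define a where "a z = (1 / m) * (LINT x|?M. \<phi> x * indicator (cball (P z) (\<theta> * H)) x)" for z
  note c\<phi> = test_function_continuous[OF \<phi>]
  have \<phi>m: "\<phi> \<in> borel_measurable borel" by (rule borel_measurable_continuous_onI[OF c\<phi>(1)])
  have a_eq: "a z = (1 / m) * (LINT x|lborel. \<phi> x * indicator (cball (P z) (\<theta> * H)) x)" for z
    unfolding a_def using \<phi>m test_function_zero_outside(1)[OF \<phi>]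
    by (subst integral_lebesgue_on_eq_lborel[OF O(1)]) (auto intro!: borel_measurable_times borel_measurable_indicator)
  have a0: "a z = 0" if "z \<in> ?N - ?Z" for z
  proof -
    have "z \<in> ?N - \<Omega>" using that by (auto simp: interior_vertices_def)
    then have "(\<lambda>x. \<phi> x * indicator (cball (P z) (\<theta> * H)) x) = (\<lambda>x. 0)"
      using B(2)[of z] test_function_zero_outside(1)[OF \<phi>] by (fastforce simp: indicator_def)
    then show ?thesis unfolding a_eq by simp
  qed
  define k where "k x s = (\<phi> (x + s) - \<phi> x)\<^sup>2 * indicator (cball 0 (2 * H)) s" for x s
  have csh: "continuous_on UNIV (\<lambda>s. \<phi> (x + s))" for x
    by (rule continuous_on_compose2[OF c\<phi>(1)]) (auto intro!: continuous_intros)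
  have intc: "integrable lborel (\<lambda>y. g y * indicator (cball p r) y)" if "continuous_on UNIV g" for g :: "real^'n \<Rightarrow> real" and p r
  proof -
    have "integrable lborel (\<lambda>y. indicator (cball p r) y *\<^sub>R g y)"
      by (rule borel_integrable_compact) (use that in \<open>auto intro: continuous_on_subset\<close>)
    then show ?thesis by (simp add: mult.commute)
  qed
  have kint: "integrable lborel (k x)" for x
    unfolding k_def[abs_def] by (rule intc) (intro continuous_intros csh)
  define E where "E x = (1 / m) * (LINT s|lborel. k x s)" for x
  have local: "(\<phi> x - a z)\<^sup>2 \<le> E x" if z: "z \<in> ?N" and nz: "?h z x \<noteq> 0" for x z
  proof -
    let ?B = "cball (P z) (\<theta> * H)"
    have xz: "norm (x - z) \<le> H" using hat_support_diameter[OF nz] H(2) by simp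
    have cf: "continuous_on UNIV (\<lambda>y. \<phi> x - \<phi> y)" by (intro continuous_intros c\<phi>)
    have "(LINT y|lborel. (\<phi> x - \<phi> y) * indicator ?B y) = \<phi> x * m - (LINT y|lborel. \<phi> y * indicator ?B y)"
      using intc[OF c\<phi>(1), of "P z" "\<theta> * H"] intc[of "\<lambda>_. \<phi> x" "P z" "\<theta> * H"] m_eq[of "P z"] by (simp add: left_diff_distrib)
    then have "\<phi> x - a z = (1 / m) * (LINT y|lborel. (\<phi> x - \<phi> y) * indicator ?B y)"
      unfolding a_eq using m by (simp add: right_diff_distrib)
    then have "(\<phi> x - a z)\<^sup>2 \<le> (1 / m) * (LINT y|lborel. (\<phi> x - \<phi> y)\<^sup>2 * indicator ?B y)"
      using square_of_average_le[OF cf, of "P z" "\<theta> * H"] m m_eq by simp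
    also have "(LINT y|lborel. (\<phi> x - \<phi> y)\<^sup>2 * indicator ?B y) = (LINT s|lborel. (\<phi> x - \<phi> (x + s))\<^sup>2 * indicator ?B (x + s))"
      by (rule lborel_integral_translation[of "\<lambda>y. (\<phi> x - \<phi> y)\<^sup>2 * indicator ?B y" x, symmetric])
        (intro borel_measurable_times borel_measurable_power borel_measurable_diff borel_measurable_const
          borel_measurable_indicator \<phi>m, simp)
    also have "(1 / m) * \<dots> \<le> E x"
      unfolding E_def
    proof (rule mult_left_mono[OF integral_mono])
      have "(\<lambda>s. (\<phi> x - \<phi> (x + s))\<^sup>2 * indicator ?B (x + s)) = (\<lambda>s. (\<phi> x - \<phi> (x + s))\<^sup>2 * indicator (cball (P z - x) (\<theta> * H)) s)"
        by (rule ext) (auto simp: indicator_def dist_norm algebra_simps)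
      moreover have "integrable lborel (\<lambda>s. (\<phi> x - \<phi> (x + s))\<^sup>2 * indicator (cball (P z - x) (\<theta> * H)) s)"
        by (rule intc) (intro continuous_intros csh)
      ultimately show "integrable lborel (\<lambda>s. (\<phi> x - \<phi> (x + s))\<^sup>2 * indicator ?B (x + s))" by simp
      show "integrable lborel (k x)" by (rule kint)
      fix s
      show "(\<phi> x - \<phi> (x + s))\<^sup>2 * indicator ?B (x + s) \<le> k x s"
      proof (cases "x + s \<in> ?B")
        case True
        then have "x + s \<in> cball z H" using B(1)[OF z] by blast
        then have "norm (z - (x + s)) \<le> H" by (simp add: dist_norm)
        then have "norm s \<le> 2 * H" using xz norm_triangle_ineq4[of "z - x" "z - (x + s)"] by (simp add: norm_minus_commute)
        then show ?thesis using True by (simp add: k_def power2_commute)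
      qed (simp add: k_def)
    qed (use m in simp)
    finally show ?thesis .
  qed
  define err where "err x = \<phi> x - lincomb ?Z a ?h x" for x
  have pw: "(err x)\<^sup>2 \<le> E x" if x: "x \<in> \<Omega>" for x
  proof -
    have xU: "x \<in> \<Union>\<T>" using x U closure_subset by blast
    have "lincomb ?Z a ?h x = (\<Sum>z\<in>?N. a z * ?h z x)"
      unfolding lincomb_def
      by (rule sum.mono_neutral_left) (use a0 finite_mesh_vertices in \<open>auto simp: interior_vertices_def\<close>)
    moreover have "\<phi> x = (\<Sum>z\<in>?N. ?h z x * \<phi> x)"
      using hat_partition_of_unity[OF xU] by (simp add: sum_distrib_right[symmetric])
    ultimately have "err x = (\<Sum>z\<in>?N. ?h z x * (\<phi> x - a z))"
      unfolding err_def by (simp add: sum_subtractf right_diff_distrib mult.commute)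
    then show ?thesis
      using convex_combination_square_le[OF finite_mesh_vertices, of "\<lambda>z. ?h z x" "\<lambda>z. \<phi> x - a z" "E x"]
        hat_nonneg hat_partition_of_unity[OF xU] local by auto
  qed
  have err_sq: "square_integrable ?M err"
    unfolding err_def[abs_def] lincomb_def
  proof (intro square_integrable_diff test_function_square_integrable(1)[OF O(1) \<phi>])
    have "finite ?Z" using finite_mesh_vertices by (simp add: interior_vertices_def)
    then show "square_integrable ?M (\<lambda>x. \<Sum>z\<in>?Z. a z * ?h z x)" using hat
    proof (induction rule: finite_induct)
      case empty then show ?case by (simp add: square_integrable_def)
    next
      case (insert z F) then show ?case by (simp add: square_integrable_add square_integrable_cmult)
    qed
  qed
  define G where "G = (l2norm ?M (grad \<phi>))\<^sup>2"
  have G_eq: "G = (LINT x|lborel. (norm (grad \<phi> x))\<^sup>2)"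
    unfolding G_def l2norm_square
    by (rule integral_lebesgue_on_eq_lborel[OF O(1)])
      (use test_function_zero_outside(2)[OF \<phi>] in \<open>auto intro!: borel_measurable_continuous_onI continuous_intros c\<phi>\<close>)
  have kmeas: "(\<lambda>(x, s). ennreal (k x s)) \<in> borel_measurable (lborel \<Otimes>\<^sub>M lborel)"
  proof -
    have m1: "(\<lambda>z. \<phi> (fst z + snd z)) \<in> borel_measurable (lborel \<Otimes>\<^sub>M lborel)"
      using \<phi>m by measurable
    have m2: "(\<lambda>z. \<phi> (fst z)) \<in> borel_measurable (lborel \<Otimes>\<^sub>M lborel)"
      using \<phi>m by measurable
    have m3: "(\<lambda>z. indicator (cball 0 (2 * H)) (snd z) :: real) \<in> borel_measurable (lborel \<Otimes>\<^sub>M (lborel :: (real^'n) measure))"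
      by (rule measurable_compose[OF measurable_snd]) (rule borel_measurable_indicator, simp)
    show ?thesis unfolding k_def split_beta'
      by (rule measurable_compose[OF _ measurable_ennreal]) (intro borel_measurable_times borel_measurable_power borel_measurable_diff m1 m2 m3)
  qed
  obtain R where R: "\<And>x. x \<notin> cball 0 R \<Longrightarrow> \<phi> x = 0" using test_function_support_radius[OF \<phi>] by meson
  have inner: "(\<integral>\<^sup>+x. ennreal (k x s) \<partial>lborel) \<le> ennreal ((2 * H)\<^sup>2 * G) * indicator (cball 0 (2 * H)) s" for s
  proof (cases "s \<in> cball 0 (2 * H)")
    case True
    have cs: "continuous_on UNIV (\<lambda>x. \<phi> (x + s))"
      by (rule continuous_on_compose2[OF c\<phi>(1)]) (auto intro!: continuous_intros)
    have int: "integrable lborel (\<lambda>x. (\<phi> (x + s) - \<phi> x)\<^sup>2)"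
    proof (rule integrable_continuous_compact_support[of _ "R + norm s"])
      show "continuous_on UNIV (\<lambda>x. (\<phi> (x + s) - \<phi> x)\<^sup>2)" by (intro continuous_intros cs c\<phi>)
      fix x :: "real^'n" assume "x \<notin> cball 0 (R + norm s)"
      then have n: "norm x > R + norm s" by simp
      then have "norm (x + s) > R" using norm_diff_ineq[of x s] by linarith
      moreover have "norm x > R" using n norm_ge_zero[of s] by linarith
      ultimately show "(\<phi> (x + s) - \<phi> x)\<^sup>2 = 0" using R[of x] R[of "x + s"] by simp
    qed
    have "(\<integral>\<^sup>+x. ennreal (k x s) \<partial>lborel) = ennreal (LINT x|lborel. (\<phi> (x + s) - \<phi> x)\<^sup>2)"
      using True by (simp add: k_def nn_integral_eq_integral[OF int])
    also have "(LINT x|lborel. (\<phi> (x + s) - \<phi> x)\<^sup>2) \<le> (norm s)\<^sup>2 * G"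
      unfolding G_eq by (rule translation_estimate[OF test_function_Ck[OF \<phi>] R])
    also have "\<dots> \<le> (2 * H)\<^sup>2 * G" using True by (intro mult_right_mono power_mono) (auto simp: G_def)
    finally show ?thesis using True by (simp add: ennreal_leI)
  qed (simp add: k_def)
  have "ennreal ((l2norm ?M err)\<^sup>2) = (\<integral>\<^sup>+x. ennreal ((norm (err x))\<^sup>2) \<partial>?M)"
    by (rule nn_integral_square_l2norm[OF err_sq, symmetric])
  also have "\<dots> \<le> (\<integral>\<^sup>+x. ennreal (E x) \<partial>?M)"
    by (rule nn_integral_mono) (use pw in \<open>auto intro!: ennreal_leI simp: space_restrict_space\<close>)
  also have "\<dots> = (\<integral>\<^sup>+x. ennreal (E x) * indicator \<Omega> x \<partial>lebesgue)"
    by (rule nn_integral_restrict_space) (use O in simp)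
  also have "\<dots> \<le> (\<integral>\<^sup>+x. ennreal (E x) \<partial>lebesgue)"
    by (rule nn_integral_mono) (auto simp: indicator_def)
  also have "\<dots> = (\<integral>\<^sup>+x. ennreal (E x) \<partial>lborel)" by (rule nn_integral_completion)
  also have "\<dots> = (\<integral>\<^sup>+x. ennreal (1 / m) * (\<integral>\<^sup>+s. ennreal (k x s) \<partial>lborel) \<partial>lborel)"
  proof (rule nn_integral_cong)
    fix x
    have "(\<integral>\<^sup>+s. ennreal (k x s) \<partial>lborel) = ennreal (LINT s|lborel. k x s)"
      by (rule nn_integral_eq_integral[OF kint]) (simp add: k_def)
    then show "ennreal (E x) = ennreal (1 / m) * (\<integral>\<^sup>+s. ennreal (k x s) \<partial>lborel)"
      using m by (simp add: E_def ennreal_mult'[symmetric])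
  qed
  also have "\<dots> = ennreal (1 / m) * (\<integral>\<^sup>+x. (\<integral>\<^sup>+s. ennreal (k x s) \<partial>lborel) \<partial>lborel)"
    by (rule nn_integral_cmult) (use kmeas in measurable)
  also have "(\<integral>\<^sup>+x. (\<integral>\<^sup>+s. ennreal (k x s) \<partial>lborel) \<partial>lborel) = (\<integral>\<^sup>+s. (\<integral>\<^sup>+x. ennreal (k x s) \<partial>lborel) \<partial>lborel)"
    by (rule lborel_pair.Fubini'[OF kmeas, symmetric])
  also have "\<dots> \<le> (\<integral>\<^sup>+s. ennreal ((2 * H)\<^sup>2 * G) * indicator (cball 0 (2 * H)) s \<partial>(lborel :: (real^'n) measure))"
    by (rule nn_integral_mono) (rule inner)
  also have "\<dots> = ennreal ((2 * H)\<^sup>2 * G) * emeasure lborel (cball (0::real^'n) (2 * H))"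
    by (rule nn_integral_cmult_indicator) simp
  also have "emeasure lborel (cball (0::real^'n) (2 * H)) = ennreal (vol * (2 * H) ^ CARD('n))"
    using H by (simp add: emeasure_cball vol_def)
  also have "ennreal (1 / m) * (ennreal ((2 * H)\<^sup>2 * G) * ennreal (vol * (2 * H) ^ CARD('n)))
      = ennreal ((1 / m) * (((2 * H)\<^sup>2 * G) * (vol * (2 * H) ^ CARD('n))))"
  proof -
    have nn: "0 \<le> 1 / m" "0 \<le> (2 * H)\<^sup>2 * G" "0 \<le> vol * (2 * H) ^ CARD('n)"
      using m vol H by (simp_all add: G_def)
    show ?thesis by (simp only: ennreal_mult[OF nn(2,3), symmetric] ennreal_mult[OF nn(1) mult_nonneg_nonneg[OF nn(2,3)], symmetric])
  qed
  finally have "ennreal ((l2norm ?M err)\<^sup>2) \<le> ennreal ((1 / m) * (((2 * H)\<^sup>2 * G) * (vol * (2 * H) ^ CARD('n))))"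
    by (simp add: mult_left_mono)
  then have "(l2norm ?M err)\<^sup>2 \<le> (1 / m) * (((2 * H)\<^sup>2 * G) * (vol * (2 * H) ^ CARD('n)))"
    by (subst (asm) ennreal_le_iff) (use m vol H in \<open>auto simp: G_def\<close>)
  also have "\<dots> = (2 * H)\<^sup>2 * G * (2 / \<theta>) ^ CARD('n)"
    unfolding m_vol using vol H \<theta> by (simp add: power_mult_distrib power_divide)
  also have "\<dots> = (2 * sqrt ((2 / \<theta>) ^ CARD('n)) * H * l2norm ?M (grad \<phi>))\<^sup>2"
    using \<theta> by (simp add: power_mult_distrib G_def)
  finally have "l2norm ?M err \<le> 2 * sqrt ((2 / \<theta>) ^ CARD('n)) * H * l2norm ?M (grad \<phi>)"
    by (rule power2_le_imp_le) (use H \<theta> in simp)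
  then show ?thesis unfolding err_def a_def m_def .
qed

text \<open>The nodal means are continuous linear functionals on square integrable functions, so the estimate
  for test functions passes to limits with convergent coefficients.\<close>
lemma H10_interpolation_error:
  fixes \<Omega> :: "(real^'n) set"
  assumes O: "open \<Omega>" "bounded \<Omega>" and mesh: "simplicial_mesh \<Omega> \<T>"
    and H: "H > 0" "mesh_size \<T> \<le> H" and \<theta>: "0 < \<theta>"
    and B: "\<And>z. z \<in> mesh_vertices \<T> \<Longrightarrow> cball (P z) (\<theta> * H) \<subseteq> cball z H"
      "\<And>z. z \<in> mesh_vertices \<T> - \<Omega> \<Longrightarrow> cball (P z) (\<theta> * H) \<inter> \<Omega> = {}"
    and hat: "\<And>z. z \<in> interior_vertices \<Omega> \<T> \<Longrightarrow> square_integrable (lebesgue_on \<Omega>) (hat_function \<T> z)"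
    and v: "H10_pair \<Omega> v g"
  shows "\<exists>c. l2norm (lebesgue_on \<Omega>) (\<lambda>x. v x - lincomb (interior_vertices \<Omega> \<T>) c (hat_function \<T>) x)
     \<le> 2 * sqrt ((2 / \<theta>) ^ CARD('n)) * H * l2norm (lebesgue_on \<Omega>) g"
proof -
  interpret triangulated \<T> using mesh by unfold_locales (auto simp: simplicial_mesh_def)
  let ?Z = "interior_vertices \<Omega> \<T>" and ?M = "lebesgue_on \<Omega>" and ?h = "hat_function \<T>"
  let ?K = "2 * sqrt ((2 / \<theta>) ^ CARD('n)) * H"
  have fin: "finite ?Z" using finite_mesh_vertices by (simp add: interior_vertices_def)
  define a where "a u z = (1 / measure lborel (cball (0::real^'n) (\<theta> * H))) * (LINT x|?M. u x * indicator (cball (P z) (\<theta> * H)) x)" for u z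
  have lc: "square_integrable ?M (lincomb F c ?h)" if "finite F" "F \<subseteq> ?Z" for c F
    using that unfolding lincomb_def
  proof (induction rule: finite_induct)
    case empty then show ?case by (simp add: square_integrable_def)
  next
    case (insert z F) then show ?case using hat by (simp add: square_integrable_add square_integrable_cmult)
  qed
  have lcn: "l2norm ?M (lincomb F c ?h) \<le> (\<Sum>z\<in>F. \<bar>c z\<bar> * l2norm ?M (?h z))" if "finite F" "F \<subseteq> ?Z" for c F
    using that
  proof (induction rule: finite_induct)
    case empty then show ?case by (simp add: lincomb_def l2norm_def)
  next
    case (insert z F)
    have "l2norm ?M (lincomb (insert z F) c ?h) \<le> l2norm ?M (\<lambda>x. c z * ?h z x) + l2norm ?M (lincomb F c ?h)"
      using l2norm_triangle[OF square_integrable_cmult[OF hat[of z], of "c z"] lc[of F c]] insert by (simp add: lincomb_def)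
    also have "l2norm ?M (\<lambda>x. c z * ?h z x) = \<bar>c z\<bar> * l2norm ?M (?h z)" using l2norm_scaleR[of ?M "c z" "?h z"] by simp
    finally show ?case using insert by simp
  qed
  from v obtain \<phi> where \<phi>: "\<And>k. \<phi> k \<in> test_functions \<Omega>"
    and l: "(\<lambda>k. l2norm ?M (\<lambda>x. \<phi> k x - v x)) \<longlonglongrightarrow> 0" "(\<lambda>k. l2norm ?M (\<lambda>x. grad (\<phi> k) x - g x)) \<longlonglongrightarrow> 0"
    by (auto simp: H10_pair_def)
  have sv: "square_integrable ?M v" "square_integrable ?M g" using v by (auto simp: H10_pair_def)
  note t = test_function_square_integrable[OF O(1) \<phi>]
  have ind: "square_integrable ?M (indicator (cball p r) :: real^'n \<Rightarrow> real)" for p r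
  proof -
    interpret finite_measure ?M by (rule finite_measure_domain[OF O])
    have im: "(indicator (cball p r) :: real^'n \<Rightarrow> real) \<in> borel_measurable ?M"
      by (intro borel_imp_lebesgue_on borel_measurable_indicator) simp
    have sq: "(\<lambda>x. (norm (indicator (cball p r) x :: real))\<^sup>2) = indicator (cball p r)"
      by (rule ext) (simp add: indicator_def)
    have "integrable ?M (indicator (cball p r) :: real^'n \<Rightarrow> real)"
      by (rule integrable_const_bound[of _ 1, OF _ im]) (simp add: indicator_def)
    then show ?thesis unfolding square_integrable_def sq using im by blast
  qed
  have alim: "(\<lambda>k. a (\<phi> k) z) \<longlonglongrightarrow> a v z" for z
    unfolding a_def using l2_inner_tendsto[OF t(1) sv(1) ind l(1)] by (intro tendsto_mult tendsto_const) simp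
  define e where "e k = l2norm ?M (\<lambda>x. v x - \<phi> k x) + ?K * l2norm ?M (grad (\<phi> k)) + (\<Sum>z\<in>?Z. \<bar>a (\<phi> k) z - a v z\<bar> * l2norm ?M (?h z))" for k
  have le: "l2norm ?M (\<lambda>x. v x - lincomb ?Z (a v) ?h x) \<le> e k" for k
  proof -
    have 1: "l2norm ?M (\<lambda>x. v x - lincomb ?Z (a v) ?h x) \<le> l2norm ?M (\<lambda>x. v x - \<phi> k x) + l2norm ?M (\<lambda>x. \<phi> k x - lincomb ?Z (a v) ?h x)"
      by (rule l2norm_triangle_diff[OF sv(1) t(1) lc]) (use fin in auto)
    have 2: "l2norm ?M (\<lambda>x. \<phi> k x - lincomb ?Z (a v) ?h x) \<le> l2norm ?M (\<lambda>x. \<phi> k x - lincomb ?Z (a (\<phi> k)) ?h x)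
       + l2norm ?M (\<lambda>x. lincomb ?Z (a (\<phi> k)) ?h x - lincomb ?Z (a v) ?h x)"
      by (rule l2norm_triangle_diff[OF t(1) lc lc]) (use fin in auto)
    have 3: "l2norm ?M (\<lambda>x. \<phi> k x - lincomb ?Z (a (\<phi> k)) ?h x) \<le> ?K * l2norm ?M (grad (\<phi> k))"
      unfolding a_def by (rule test_function_interpolation_error[OF O mesh H \<theta> B hat \<phi>])
    have "(\<lambda>x. lincomb ?Z (a (\<phi> k)) ?h x - lincomb ?Z (a v) ?h x) = lincomb ?Z (\<lambda>z. a (\<phi> k) z - a v z) ?h"
      by (auto simp: lincomb_def sum_subtractf left_diff_distrib)
    then have 4: "l2norm ?M (\<lambda>x. lincomb ?Z (a (\<phi> k)) ?h x - lincomb ?Z (a v) ?h x) \<le> (\<Sum>z\<in>?Z. \<bar>a (\<phi> k) z - a v z\<bar> * l2norm ?M (?h z))"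
      using lcn[OF fin, of "\<lambda>z. a (\<phi> k) z - a v z"] by simp
    show ?thesis unfolding e_def using 1 2 3 4 by linarith
  qed
  have "e \<longlonglongrightarrow> 0 + ?K * l2norm ?M g + (\<Sum>z\<in>?Z. \<bar>a v z - a v z\<bar> * l2norm ?M (?h z))"
    unfolding e_def
  proof (intro tendsto_add tendsto_sum tendsto_mult tendsto_rabs tendsto_diff tendsto_const alim)
    show "(\<lambda>k. l2norm ?M (\<lambda>x. v x - \<phi> k x)) \<longlonglongrightarrow> 0" using l(1) by (simp add: l2norm_uminus_diff[of ?M v])
    show "(\<lambda>k. l2norm ?M (grad (\<phi> k))) \<longlonglongrightarrow> l2norm ?M g" by (rule l2norm_tendsto[OF t(2) sv(2) l(2)])
  qed
  then have "e \<longlonglongrightarrow> ?K * l2norm ?M g" by simp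
  then have "l2norm ?M (\<lambda>x. v x - lincomb ?Z (a v) ?h x) \<le> ?K * l2norm ?M g"
    by (rule LIMSEQ_le_const) (use le in auto)
  then show ?thesis by blast
qed

lemma cell_diameter_pos:
  fixes T :: "(real^'n) set"
  assumes "int CARD('n) simplex T" shows "0 < diameter T"
proof -
  obtain C where C: "int (card C) = int CARD('n) + 1" "T = convex hull C" using assms by (auto simp: simplex_def)
  have "1 \<le> CARD('n)" by (simp add: Suc_leI)
  then have "2 \<le> card C" using C(1) by linarith
  then obtain x y where xy: "x \<in> C" "y \<in> C" "x \<noteq> y"
    by (metis card_le_Suc0_iff_eq card.infinite not_less_eq_eq numeral_2_eq_2 zero_le)
  then have "x \<in> T" "y \<in> T" using C(2) hull_subset[of C convex] by auto
  moreover have "bounded T" using compact_simplex[OF assms] by (rule compact_imp_bounded)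
  ultimately have "dist x y \<le> diameter T" by (intro diameter_bounded_bound)
  then show ?thesis using xy by (smt (verit) zero_less_dist_iff)
qed

lemma mesh_size_bounds:
  fixes \<Omega> :: "(real^'n) set"
  assumes "\<Omega> \<noteq> {}" "bounded \<Omega>" "simplicial_mesh \<Omega> \<T>"
  shows "0 < mesh_size \<T>" "mesh_size \<T> \<le> diameter (closure \<Omega>) + 1"
proof -
  have fin: "finite \<T>" and sim: "\<And>T. T \<in> \<T> \<Longrightarrow> int CARD('n) simplex T" and U: "\<Union>\<T> = closure \<Omega>"
    using assms(3) by (auto simp: simplicial_mesh_def triangulation_def)
  have "\<T> \<noteq> {}" using U assms(1) closure_subset[of \<Omega>] by auto
  then obtain T where T: "T \<in> \<T>" by blast
  have "0 < diameter T" by (rule cell_diameter_pos[OF sim[OF T]])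
  also have "\<dots> \<le> mesh_size \<T>" unfolding mesh_size_def using fin T by (intro Max_ge) auto
  finally show "0 < mesh_size \<T>" .
  have le: "diameter T \<le> diameter (closure \<Omega>) + 1" if "T \<in> \<T>" for T
  proof -
    have "diameter T \<le> diameter (closure \<Omega>)" using that U assms(2) by (intro diameter_subset) auto
    then show ?thesis by linarith
  qed
  show "mesh_size \<T> \<le> diameter (closure \<Omega>) + 1"
    unfolding mesh_size_def using fin \<open>\<T> \<noteq> {}\<close> le by (intro Max.boundedI) auto
qed

text \<open>The mesh size is at most the diameter of the domain (plus one), so the ratio \<open>\<theta>\<close> of the
  exterior balls, and with it the constant, can be chosen for all meshes at once.\<close>
theorem uniform_interpolation_error:
  fixes \<Omega> :: "(real^'n) set"
  assumes dom: "polyhedral_lipschitz_domain \<Omega>"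
  shows "\<exists>C>0. \<forall>\<T> v g. simplicial_mesh \<Omega> \<T> \<and> H10_pair \<Omega> v g \<longrightarrow>
    (\<exists>c. l2norm (lebesgue_on \<Omega>) (\<lambda>x. v x - lincomb (interior_vertices \<Omega> \<T>) c (hat_function \<T>) x)
      \<le> C * mesh_size \<T> * l2norm (lebesgue_on \<Omega>) g)"
proof -
  have O: "open \<Omega>" "bounded \<Omega>" and ne: "\<Omega> \<noteq> {}" and lip: "lipschitz_boundary \<Omega>"
    using dom by (auto simp: polyhedral_lipschitz_domain_def)
  have "0 \<le> diameter (closure \<Omega>)" using O(2) by (intro diameter_ge_0) auto
  then have D: "0 < diameter (closure \<Omega>) + 1" by simp
  obtain \<theta> where \<theta>: "\<theta> > 0" "\<theta> \<le> 1" and ext: "\<And>z r. z \<in> frontier \<Omega> \<Longrightarrow> 0 < r \<Longrightarrow> r \<le> diameter (closure \<Omega>) + 1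
      \<Longrightarrow> \<exists>p. cball p (\<theta> * r) \<subseteq> cball z r - \<Omega>"
    using uniform_exterior_ball[OF O lip D] by blast
  show ?thesis
  proof (intro exI[of _ "2 * sqrt ((2 / \<theta>) ^ CARD('n))"] conjI allI impI)
    show "0 < 2 * sqrt ((2 / \<theta>) ^ CARD('n))" using \<theta> by simp
    fix \<T> and v :: "real^'n \<Rightarrow> real" and g assume *: "simplicial_mesh \<Omega> \<T> \<and> H10_pair \<Omega> v g"
    then have mesh: "simplicial_mesh \<Omega> \<T>" and v: "H10_pair \<Omega> v g" by auto
    let ?H = "mesh_size \<T>"
    note H = mesh_size_bounds[OF ne O(2) mesh]
    have U: "\<Union>\<T> = closure \<Omega>" using mesh by (simp add: simplicial_mesh_def)
    have "\<exists>p. cball p (\<theta> * ?H) \<subseteq> cball z ?H \<and> (z \<notin> \<Omega> \<longrightarrow> cball p (\<theta> * ?H) \<inter> \<Omega> = {})" if z: "z \<in> mesh_vertices \<T>" for z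
    proof (cases "z \<in> \<Omega>")
      case True
      have "cball z (\<theta> * ?H) \<subseteq> cball z ?H" using \<theta> H(1) by (intro subset_cball) (simp add: mult_left_le_one_le)
      then show ?thesis using True by blast
    next
      case False
      have "z \<in> closure \<Omega>" using z U by (auto simp: mesh_vertices_def extreme_point_of_def)
      then have "z \<in> frontier \<Omega>" using False O(1) by (simp add: frontier_def interior_open)
      then show ?thesis using ext[OF _ H] by blast
    qed
    then obtain P where P: "\<And>z. z \<in> mesh_vertices \<T> \<Longrightarrow> cball (P z) (\<theta> * ?H) \<subseteq> cball z ?H"
      "\<And>z. z \<in> mesh_vertices \<T> - \<Omega> \<Longrightarrow> cball (P z) (\<theta> * ?H) \<inter> \<Omega> = {}" by (metis DiffD1 DiffD2)
    have hat: "square_integrable (lebesgue_on \<Omega>) (hat_function \<T> z)" if "z \<in> interior_vertices \<Omega> \<T>" for z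
      using hat_H10_pair(1)[OF O lip mesh that] by (auto simp: H10_pair_def)
    show "\<exists>c. l2norm (lebesgue_on \<Omega>) (\<lambda>x. v x - lincomb (interior_vertices \<Omega> \<T>) c (hat_function \<T>) x)
      \<le> 2 * sqrt ((2 / \<theta>) ^ CARD('n)) * ?H * l2norm (lebesgue_on \<Omega>) g"
      by (rule H10_interpolation_error[OF O mesh H(1) order_refl \<theta>(1) P hat v])
  qed
qed

section \<open>The elliptic eigenvalue problem\<close>

text \<open>A minimizer of the Rayleigh quotient on the unit sphere is an eigenvector: otherwise the quadratic
  form would decrease in the direction of the residual \<open>r\<close>. So the minimum belongs to the spectrum.\<close>
lemma symmetric_matrix_coercive:
  fixes M :: "real^'n^'n"
  assumes sym: "transpose M = M" and spec: "mat_spectrum M \<subseteq> {\<alpha>..\<beta>}"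
  shows "\<alpha> * (v \<bullet> v) \<le> (M *v v) \<bullet> v"
proof -
  define q where "q v = (M *v v) \<bullet> v" for v :: "real^'n"
  have symq: "(M *v u) \<bullet> w = (M *v w) \<bullet> u" for u w
    by (metis sym dot_lmul_matrix inner_commute transpose_matrix_vector)
  have "continuous_on (sphere 0 1) q" unfolding q_def
    by (intro continuous_intros linear_continuous_on matrix_vector_mul_bounded_linear)
  moreover have "sphere (0::real^'n) 1 \<noteq> {}" by simp
  ultimately obtain v0 where v0: "v0 \<in> sphere 0 1" "\<And>v. v \<in> sphere 0 1 \<Longrightarrow> q v0 \<le> q v"
    using continuous_attains_inf[OF compact_sphere] by blast
  define \<mu> where "\<mu> = q v0"
  have low: "\<mu> * (v \<bullet> v) \<le> q v" for v
  proof (cases "v = 0")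
    case False
    have "q ((1 / norm v) *\<^sub>R v) = q v / (norm v)\<^sup>2"
      by (simp add: q_def matrix_vector_mult_scaleR power2_eq_square)
    moreover have "(1 / norm v) *\<^sub>R v \<in> sphere 0 1" using False by simp
    ultimately have "\<mu> \<le> q v / (norm v)\<^sup>2" using v0(2) by (metis \<mu>_def)
    then show ?thesis using False by (simp add: power2_norm_eq_inner[symmetric] field_simps)
  qed (simp add: q_def)
  define r where "r = M *v v0 - \<mu> *\<^sub>R v0"
  have n0: "v0 \<bullet> v0 = 1" using v0(1) by (simp add: power2_norm_eq_inner[symmetric])
  define c where "c = q r - \<mu> * (r \<bullet> r)"
  have c0: "0 \<le> c" using low[of r] by (simp add: c_def)
  have quad: "0 \<le> 2 * t * (r \<bullet> r) + t\<^sup>2 * c" for t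
  proof -
    have "q (v0 + t *\<^sub>R r) = \<mu> + 2 * t * ((M *v v0) \<bullet> r) + t\<^sup>2 * q r"
      by (simp add: q_def \<mu>_def matrix_vector_right_distrib matrix_vector_mult_scaleR inner_add_left inner_add_right
          symq[of r v0] power2_eq_square algebra_simps)
    moreover have "(v0 + t *\<^sub>R r) \<bullet> (v0 + t *\<^sub>R r) = 1 + 2 * t * (v0 \<bullet> r) + t\<^sup>2 * (r \<bullet> r)"
      by (simp add: inner_add_left inner_add_right n0 inner_commute[of r v0] power2_eq_square algebra_simps)
    ultimately have "0 \<le> 2 * t * ((M *v v0) \<bullet> r - \<mu> * (v0 \<bullet> r)) + t\<^sup>2 * c"
      using low[of "v0 + t *\<^sub>R r"] by (simp add: c_def algebra_simps)
    moreover have "(M *v v0) \<bullet> r - \<mu> * (v0 \<bullet> r) = r \<bullet> r" by (simp add: r_def inner_diff_left)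
    ultimately show ?thesis by simp
  qed
  have "r = 0"
  proof (rule ccontr)
    assume "r \<noteq> 0"
    then have rr: "r \<bullet> r > 0" by simp
    define t where "t = - (r \<bullet> r) / (c + 1)"
    have e: "r \<bullet> r = - t * (c + 1)" using c0 by (simp add: t_def)
    have "2 * t * (r \<bullet> r) + t\<^sup>2 * c = - (t\<^sup>2 * (c + 2))"
      unfolding e by (simp add: power2_eq_square algebra_simps)
    moreover have "t \<noteq> 0" using rr c0 by (simp add: t_def)
    then have "t\<^sup>2 * (c + 2) > 0" using c0 by simp
    ultimately show False using quad[of t] by linarith
  qed
  then have "M *v v0 = \<mu> *\<^sub>R v0" by (simp add: r_def)
  moreover have "v0 \<noteq> 0" using n0 by auto
  ultimately have "\<mu> \<in> mat_spectrum M" by (auto simp: mat_spectrum_def)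
  then have "\<alpha> \<le> \<mu>" using spec by auto
  then have "\<alpha> * (v \<bullet> v) \<le> \<mu> * (v \<bullet> v)" by (intro mult_right_mono) auto
  then show ?thesis using low[of v] by (simp add: q_def)
qed

lemma norm_matrix_vector_le:
  fixes M :: "real^'n^'n" shows "norm (M *v v) \<le> real CARD('n) * norm M * norm v"
proof -
  have "norm (M *v v) \<le> (\<Sum>i\<in>UNIV. \<bar>(M *v v) $ i\<bar>)" by (rule norm_le_l1_cart)
  also have "\<dots> \<le> (\<Sum>i\<in>(UNIV::'n set). norm M * norm v)"
  proof (rule sum_mono)
    fix i
    have "\<bar>(M *v v) $ i\<bar> = \<bar>M $ i \<bullet> v\<bar>" by (simp add: matrix_vector_mult_def inner_vec_def)
    also have "\<dots> \<le> norm (M $ i) * norm v" by (rule Cauchy_Schwarz_ineq2)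
    also have "\<dots> \<le> norm M * norm v" by (intro mult_right_mono Finite_Cartesian_Product.norm_nth_le) simp
    finally show "\<bar>(M *v v) $ i\<bar> \<le> norm M * norm v" .
  qed
  finally show ?thesis by simp
qed

locale elliptic_form =
  fixes \<Omega> :: "(real^'n) set" and A :: "real^'n \<Rightarrow> real^'n^'n" and \<alpha> \<beta> :: real
  assumes op: "open \<Omega>" and bd: "bounded \<Omega>" and coef: "admissible_coefficient \<Omega> \<alpha> \<beta> A"
begin

abbreviation "M \<equiv> lebesgue_on \<Omega>"
abbreviation "wg \<equiv> weak_gradient \<Omega>"

lemma H10_weak_gradient_pair: "v \<in> H10 \<Omega> \<Longrightarrow> H10_pair \<Omega> v (wg v)" by (rule H10_imp_pair[OF op bd])

lemma H10_square_integrable: "v \<in> H10 \<Omega> \<Longrightarrow> square_integrable M v" "v \<in> H10 \<Omega> \<Longrightarrow> square_integrable M (wg v)"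
  using H10_weak_gradient_pair by (auto simp: H10_pair_def)

lemma H10_lin_closed: "lin_closed (H10 \<Omega>)"
  unfolding lin_closed_def
  using H10_pair_imp_H10(1)[OF op bd] H10_pair_zero[OF op] H10_pair_add[OF op H10_weak_gradient_pair H10_weak_gradient_pair] H10_pair_cmult[OF op H10_weak_gradient_pair] by blast

lemma wg_add: "u \<in> H10 \<Omega> \<Longrightarrow> v \<in> H10 \<Omega> \<Longrightarrow> AE x in M. wg (\<lambda>x. u x + v x) x = wg u x + wg v x"
  by (rule H10_pair_imp_H10(2)[OF op bd H10_pair_add[OF op H10_weak_gradient_pair H10_weak_gradient_pair]])

lemma wg_scale: "u \<in> H10 \<Omega> \<Longrightarrow> AE x in M. wg (\<lambda>x. c * u x) x = c *\<^sub>R wg u x"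
  by (rule H10_pair_imp_H10(2)[OF op bd H10_pair_cmult[OF op H10_weak_gradient_pair]])

lemma wg_diff:
  assumes "u \<in> H10 \<Omega>" "v \<in> H10 \<Omega>" shows "AE x in M. wg (\<lambda>x. u x - v x) x = wg u x - wg v x"
  using H10_pair_imp_H10(2)[OF op bd H10_pair_add[OF op H10_weak_gradient_pair[OF assms(1)] H10_pair_cmult[OF op H10_weak_gradient_pair[OF assms(2)], of "-1"]]] by simp

lemma l2norm_wg_diff:
  assumes "u \<in> H10 \<Omega>" "v \<in> H10 \<Omega>" shows "l2norm M (wg (\<lambda>x. u x - v x)) = l2norm M (\<lambda>x. wg u x - wg v x)"
proof (rule l2norm_cong_AE)
  have "(\<lambda>x. u x - v x) \<in> H10 \<Omega>" by (rule lin_closed_diff[OF H10_lin_closed assms])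
  then show "wg (\<lambda>x. u x - v x) \<in> borel_measurable M" using H10_square_integrable by (auto simp: square_integrable_def)
  show "(\<lambda>x. wg u x - wg v x) \<in> borel_measurable M"
    using square_integrable_diff[OF H10_square_integrable(2)[OF assms(1)] H10_square_integrable(2)[OF assms(2)]] by (simp add: square_integrable_def)
  show "AE x in M. wg (\<lambda>x. u x - v x) x = wg u x - wg v x" by (rule wg_diff[OF assms])
qed

lemma alpha_pos: "0 < \<alpha>" using coef by (simp add: admissible_coefficient_def)

lemma bounded_form:
  obtains K where "0 \<le> K" "AE x in M. \<forall>f g. \<bar>(A x *v f) \<bullet> g\<bar> \<le> K * norm f * norm g"
proof -
  obtain B where B: "AE x in M. norm (A x) \<le> B" using coef by (auto simp: admissible_coefficient_def)
  define K where "K = real CARD('n) * max B 0"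
  have "AE x in M. \<forall>f g. \<bar>(A x *v f) \<bullet> g\<bar> \<le> K * norm f * norm g"
    using B
  proof eventually_elim
    case (elim x)
    show ?case
    proof (intro allI)
      fix f g
      have "\<bar>(A x *v f) \<bullet> g\<bar> \<le> norm (A x *v f) * norm g" by (rule Cauchy_Schwarz_ineq2)
      also have "norm (A x *v f) \<le> real CARD('n) * norm (A x) * norm f" by (rule norm_matrix_vector_le)
      also have "real CARD('n) * norm (A x) * norm f \<le> K * norm f"
        unfolding K_def using elim by (intro mult_right_mono mult_left_mono) auto
      finally show "\<bar>(A x *v f) \<bullet> g\<bar> \<le> K * norm f * norm g" by (simp add: mult_right_mono)
    qed
  qed
  moreover have "0 \<le> K" by (simp add: K_def)
  ultimately show ?thesis using that by blast
qed

lemma form_measurable: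
  assumes f: "f \<in> borel_measurable M" and g: "g \<in> borel_measurable M"
  shows "(\<lambda>x. (A x *v f x) \<bullet> g x) \<in> borel_measurable M"
proof -
  have A: "A \<in> borel_measurable M" using coef by (simp add: admissible_coefficient_def)
  have comp: "(\<lambda>x. h x $ i) \<in> borel_measurable M" if "h \<in> borel_measurable M" for h :: "real^'n \<Rightarrow> real^'n" and i
    using that by (rule measurable_compose) simp
  have row: "(\<lambda>x. A x $ i) \<in> borel_measurable M" for i
    by (rule measurable_compose[OF A], rule borel_measurable_continuous_onI) (intro continuous_intros)
  have "(\<lambda>x. (A x *v f x) \<bullet> g x) = (\<lambda>x. \<Sum>i\<in>UNIV. (A x $ i \<bullet> f x) * g x $ i)"
    by (simp add: inner_vec_def matrix_vector_mult_def fun_eq_iff)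
  then show ?thesis using row f comp[OF g] by simp
qed

lemma form_integrable:
  assumes f: "square_integrable M f" and g: "square_integrable M g"
  shows "integrable M (\<lambda>x. (A x *v f x) \<bullet> g x)"
proof -
  obtain K where K: "0 \<le> K" "AE x in M. \<forall>f g. \<bar>(A x *v f) \<bullet> g\<bar> \<le> K * norm f * norm g" by (rule bounded_form)
  have nf: "square_integrable M (\<lambda>x. norm (f x))" "square_integrable M (\<lambda>x. norm (g x))"
    using f g by (auto simp: square_integrable_def)
  have int: "integrable M (\<lambda>x. K * (norm (f x) * norm (g x)))"
    using square_integrable_inner[OF nf] by simp
  show ?thesis
  proof (rule Bochner_Integration.integrable_bound[OF int])
    show "(\<lambda>x. (A x *v f x) \<bullet> g x) \<in> borel_measurable M"
      using f g by (intro form_measurable) (auto simp: square_integrable_def)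
    show "AE x in M. norm ((A x *v f x) \<bullet> g x) \<le> norm (K * (norm (f x) * norm (g x)))"
      using K(2)
    proof eventually_elim
      case (elim x)
      then have "\<bar>(A x *v f x) \<bullet> g x\<bar> \<le> K * norm (f x) * norm (g x)" by blast
      then show ?case using K(1) by (simp add: mult.assoc)
    qed
  qed
qed

lemma energy_bound: "\<exists>K\<ge>0. \<forall>v\<in>H10 \<Omega>. energy \<Omega> A v v \<le> K * (l2norm M (wg v))\<^sup>2"
proof -
  obtain K where K: "0 \<le> K" "AE x in M. \<forall>f g. \<bar>(A x *v f) \<bullet> g\<bar> \<le> K * norm f * norm g" by (rule bounded_form)
  have "energy \<Omega> A v v \<le> K * (l2norm M (wg v))\<^sup>2" if v: "v \<in> H10 \<Omega>" for v
  proof -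
    have i: "integrable M (\<lambda>x. (norm (wg v x))\<^sup>2)" using H10_square_integrable(2)[OF v] by (simp add: square_integrable_def)
    have "energy \<Omega> A v v \<le> (LINT x|M. K * (norm (wg v x))\<^sup>2)"
      unfolding energy_def
    proof (rule integral_mono_AE)
      show "integrable M (\<lambda>x. (A x *v wg v x) \<bullet> wg v x)" by (rule form_integrable[OF H10_square_integrable(2)[OF v] H10_square_integrable(2)[OF v]])
      show "integrable M (\<lambda>x. K * (norm (wg v x))\<^sup>2)" using i by simp
      show "AE x in M. (A x *v wg v x) \<bullet> wg v x \<le> K * (norm (wg v x))\<^sup>2"
        using K(2)
      proof eventually_elim
        case (elim x)
        then have "\<bar>(A x *v wg v x) \<bullet> wg v x\<bar> \<le> K * norm (wg v x) * norm (wg v x)" by blast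
        then show ?case by (simp add: power2_eq_square mult.assoc)
      qed
    qed
    then show ?thesis by (simp add: l2norm_square)
  qed
  then show ?thesis using K(1) by blast
qed

lemma energy_coercive:
  assumes v: "v \<in> H10 \<Omega>" shows "\<alpha> * (l2norm M (wg v))\<^sup>2 \<le> energy \<Omega> A v v"
proof -
  have i: "integrable M (\<lambda>x. (norm (wg v x))\<^sup>2)" using H10_square_integrable(2)[OF v] by (simp add: square_integrable_def)
  have s: "AE x in M. transpose (A x) = A x" "AE x in M. mat_spectrum (A x) \<subseteq> {\<alpha>..\<beta>}"
    using coef by (auto simp: admissible_coefficient_def)
  have "(LINT x|M. \<alpha> * (norm (wg v x))\<^sup>2) \<le> energy \<Omega> A v v"
    unfolding energy_def
  proof (rule integral_mono_AE)
    show "integrable M (\<lambda>x. (A x *v wg v x) \<bullet> wg v x)" by (rule form_integrable[OF H10_square_integrable(2)[OF v] H10_square_integrable(2)[OF v]])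
    show "integrable M (\<lambda>x. \<alpha> * (norm (wg v x))\<^sup>2)" using i by simp
    show "AE x in M. \<alpha> * (norm (wg v x))\<^sup>2 \<le> (A x *v wg v x) \<bullet> wg v x"
      using s by eventually_elim (simp add: symmetric_matrix_coercive power2_norm_eq_inner)
  qed
  then show ?thesis by (simp add: l2norm_square)
qed

lemma energy_semi_inner: "semi_inner (H10 \<Omega>) (energy \<Omega> A)"
proof
  note V = H10_lin_closed
  show "lin_closed (H10 \<Omega>)" by (rule V)
  fix u v w c assume u: "u \<in> H10 \<Omega>" and w: "w \<in> H10 \<Omega>"
  have m: "wg z \<in> borel_measurable M" if "z \<in> H10 \<Omega>" for z using H10_square_integrable(2)[OF that] by (simp add: square_integrable_def)
  show "energy \<Omega> A (\<lambda>x. c * u x) w = c * energy \<Omega> A u w"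
  proof -
    have cu: "(\<lambda>x. c * u x) \<in> H10 \<Omega>" by (rule lin_closedD(3)[OF V u])
    have "energy \<Omega> A (\<lambda>x. c * u x) w = (LINT x|M. c * ((A x *v wg u x) \<bullet> wg w x))"
      unfolding energy_def
    proof (rule integral_cong_AE)
      show "AE x in M. (A x *v wg (\<lambda>x. c * u x) x) \<bullet> wg w x = c * ((A x *v wg u x) \<bullet> wg w x)"
        using wg_scale[OF u, of c] by eventually_elim (simp add: matrix_vector_mult_scaleR)
    qed (intro borel_measurable_times borel_measurable_const form_measurable m cu u w)+
    then show ?thesis by (simp add: energy_def)
  qed
  show "energy \<Omega> A u w = energy \<Omega> A w u"
    unfolding energy_def
  proof (rule integral_cong_AE)
    have s: "AE x in M. transpose (A x) = A x" using coef by (auto simp: admissible_coefficient_def)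
    show "AE x in M. (A x *v wg u x) \<bullet> wg w x = (A x *v wg w x) \<bullet> wg u x"
      using s by eventually_elim (metis dot_lmul_matrix inner_commute transpose_matrix_vector)
  qed (intro form_measurable m u w)+
  show "0 \<le> energy \<Omega> A u u"
    by (rule order_trans[OF _ energy_coercive[OF u]]) (use alpha_pos in simp)
  assume v: "v \<in> H10 \<Omega>"
  show "energy \<Omega> A (\<lambda>x. u x + v x) w = energy \<Omega> A u w + energy \<Omega> A v w"
  proof -
    have uv: "(\<lambda>x. u x + v x) \<in> H10 \<Omega>" by (rule lin_closedD(2)[OF V u v])
    have "energy \<Omega> A (\<lambda>x. u x + v x) w = (LINT x|M. (A x *v wg u x) \<bullet> wg w x + (A x *v wg v x) \<bullet> wg w x)"
      unfolding energy_def
    proof (rule integral_cong_AE)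
      show "AE x in M. (A x *v wg (\<lambda>x. u x + v x) x) \<bullet> wg w x = (A x *v wg u x) \<bullet> wg w x + (A x *v wg v x) \<bullet> wg w x"
        using wg_add[OF u v] by eventually_elim (simp add: matrix_vector_right_distrib inner_add_left)
    qed (intro borel_measurable_add form_measurable m uv u v w)+
    also have "\<dots> = energy \<Omega> A u w + energy \<Omega> A v w"
      unfolding energy_def by (intro Bochner_Integration.integral_add form_integrable H10_square_integrable u v w)
    finally show ?thesis .
  qed
qed

lemma L2_semi_inner: "semi_inner (H10 \<Omega>) (L2_inner \<Omega>)"
proof
  show "lin_closed (H10 \<Omega>)" by (rule H10_lin_closed)
  fix u v w c assume u: "u \<in> H10 \<Omega>" and w: "w \<in> H10 \<Omega>"
  show "L2_inner \<Omega> (\<lambda>x. c * u x) w = c * L2_inner \<Omega> u w" by (simp add: L2_inner_def mult.assoc)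
  show "L2_inner \<Omega> u w = L2_inner \<Omega> w u" by (simp add: L2_inner_def mult.commute)
  show "0 \<le> L2_inner \<Omega> u u" by (simp add: L2_inner_def)
  assume v: "v \<in> H10 \<Omega>"
  show "L2_inner \<Omega> (\<lambda>x. u x + v x) w = L2_inner \<Omega> u w + L2_inner \<Omega> v w"
    using square_integrable_inner[OF H10_square_integrable(1)[OF u] H10_square_integrable(1)[OF w]] square_integrable_inner[OF H10_square_integrable(1)[OF v] H10_square_integrable(1)[OF w]]
    by (simp add: L2_inner_def distrib_right)
qed

sublocale two_forms "H10 \<Omega>" "L2_inner \<Omega>" "energy \<Omega> A"
  by (intro two_forms.intro L2_semi_inner energy_semi_inner)

lemma L2_inner_square: "L2_inner \<Omega> u u = (l2norm M u)\<^sup>2"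
  unfolding L2_inner_def l2norm_square by (simp add: power2_eq_square[symmetric])

lemma L2_inner_null_iff: "u \<in> H10 \<Omega> \<Longrightarrow> L2_inner \<Omega> u u = 0 \<longleftrightarrow> (AE x in M. u x = 0)"
  using l2norm_eq_0_iff[OF H10_square_integrable(1)] by (simp add: L2_inner_square)

lemma has_ae_dimension_iff:
  assumes W: "W \<subseteq> H10 \<Omega>" shows "has_ae_dimension \<Omega> W n \<longleftrightarrow> L.has_dim W n"
proof -
  have "(\<forall>i<n. f i \<in> W) \<Longrightarrow>
      ((\<forall>c. (AE x in M. (\<Sum>i<n. c i * f i x) = 0) \<longrightarrow> (\<forall>i<n. c i = 0)) \<and> (\<forall>w\<in>W. \<exists>c. AE x in M. w x = (\<Sum>i<n. c i * f i x)))
      = ((\<forall>c. L2_inner \<Omega> (lincomb {..<n} c f) (lincomb {..<n} c f) = 0 \<longrightarrow> (\<forall>i<n. c i = 0)) \<and>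
      (\<forall>w\<in>W. \<exists>c. L2_inner \<Omega> (\<lambda>x. w x - lincomb {..<n} c f x) (\<lambda>x. w x - lincomb {..<n} c f x) = 0))" for f
  proof -
    assume f: "\<forall>i<n. f i \<in> W"
    have l: "lincomb {..<n} c f \<in> H10 \<Omega>" for c by (rule L.V_lincomb) (use f W in auto)
    have 1: "L2_inner \<Omega> (lincomb {..<n} c f) (lincomb {..<n} c f) = 0 \<longleftrightarrow> (AE x in M. (\<Sum>i<n. c i * f i x) = 0)" for c
      using L2_inner_null_iff[OF l] by (simp add: lincomb_def)
    have 2: "L2_inner \<Omega> (\<lambda>x. w x - lincomb {..<n} c f x) (\<lambda>x. w x - lincomb {..<n} c f x) = 0 \<longleftrightarrow> (AE x in M. w x = (\<Sum>i<n. c i * f i x))"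
      if "w \<in> W" for w c
    proof -
      have "(\<lambda>x. w x - lincomb {..<n} c f x) \<in> H10 \<Omega>" using L.V_diff[OF _ l] that W by blast
      from L2_inner_null_iff[OF this] show ?thesis by (simp add: lincomb_def)
    qed
    show ?thesis using 1 2 by simp
  qed
  then show ?thesis unfolding has_ae_dimension_def L.has_dim_def by blast
qed

lemma lists_eigenvalues_iff:
  assumes W: "W \<subseteq> H10 \<Omega>" shows "lists_eigenvalues \<Omega> A W ev \<longleftrightarrow> lists_eigs W ev"
proof -
  have "eigenvalue_indices \<Omega> W = indices W"
    unfolding eigenvalue_indices_def indices_def has_ae_dimension_iff[OF W] ..
  moreover have "eigenspace \<Omega> A W \<mu> = eig W \<mu>" for \<mu> by (simp add: eigenspace_def eig_def)
  moreover have "has_ae_dimension \<Omega> (eig W \<mu>) n \<longleftrightarrow> L.has_dim (eig W \<mu>) n" for \<mu> n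
    by (rule has_ae_dimension_iff) (use W in \<open>auto simp: eig_def\<close>)
  ultimately show ?thesis by (simp add: lists_eigenvalues_def lists_eigs_def)
qed

end

text \<open>Turns almost everywhere identities between finite element functions into pointwise ones.\<close>
lemma continuous_AE_zero_imp_zero:
  fixes f :: "real^'n \<Rightarrow> real"
  assumes O: "open \<Omega>" and f: "continuous_on UNIV f" and ae: "AE x in lebesgue_on \<Omega>. f x = 0" and x: "x \<in> \<Omega>"
  shows "f x = 0"
proof -
  have "open (\<Omega> \<inter> f -` (- {0}))" using O f by (intro open_Int open_vimage) auto
  moreover have "AE x in lebesgue. x \<in> \<Omega> \<longrightarrow> f x = 0" using ae O by (subst (asm) AE_restrict_space_iff) auto
  then have "AE x in lebesgue. x \<notin> \<Omega> \<inter> f -` (- {0})" by eventually_elim auto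
  ultimately have "\<Omega> \<inter> f -` (- {0}) = {}" by (rule open_AE_not_in_empty)
  then show ?thesis using x by auto
qed

lemma P1_space_lin_closed:
  assumes "lin_closed (H10 \<Omega>)" shows "lin_closed (P1_space \<Omega> \<T>)"
  unfolding lin_closed_def
proof (intro conjI ballI allI)
  show "(\<lambda>x. 0) \<in> P1_space \<Omega> \<T>"
    unfolding P1_space_def using lin_closedD(1)[OF assms] by (auto intro!: exI[of _ 0])
  fix u assume u: "u \<in> P1_space \<Omega> \<T>"
  show "(\<lambda>x. c * u x) \<in> P1_space \<Omega> \<T>" for c
    unfolding P1_space_def
  proof (intro CollectI conjI ballI)
    show "(\<lambda>x. c * u x) \<in> H10 \<Omega>" using u lin_closedD(3)[OF assms] by (auto simp: P1_space_def)
    fix T assume "T \<in> \<T>"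
    then obtain p q where "AE x in lebesgue_on T. u x = p \<bullet> x + q" using u by (auto simp: P1_space_def)
    then have "AE x in lebesgue_on T. c * u x = (c *\<^sub>R p) \<bullet> x + c * q" by eventually_elim (simp add: distrib_left)
    then show "\<exists>p q. AE x in lebesgue_on T. c * u x = p \<bullet> x + q" by blast
  qed
  fix v assume v: "v \<in> P1_space \<Omega> \<T>"
  show "(\<lambda>x. u x + v x) \<in> P1_space \<Omega> \<T>"
    unfolding P1_space_def
  proof (intro CollectI conjI ballI)
    show "(\<lambda>x. u x + v x) \<in> H10 \<Omega>" using u v lin_closedD(2)[OF assms] by (auto simp: P1_space_def)
    fix T assume T: "T \<in> \<T>"
    then obtain p q where 1: "AE x in lebesgue_on T. u x = p \<bullet> x + q" using u by (auto simp: P1_space_def)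
    obtain p' q' where 2: "AE x in lebesgue_on T. v x = p' \<bullet> x + q'" using v T by (auto simp: P1_space_def)
    from 1 2 have "AE x in lebesgue_on T. u x + v x = (p + p') \<bullet> x + (q + q')"
      by eventually_elim (simp add: inner_add_left)
    then show "\<exists>p q. AE x in lebesgue_on T. u x + v x = p \<bullet> x + q" by blast
  qed
qed

lemma AE_lebesgue_on_self: "T \<in> sets lebesgue \<Longrightarrow> (\<And>x. x \<in> T \<Longrightarrow> P x) \<Longrightarrow> AE x in lebesgue_on T. P x"
  by (subst AE_restrict_space_iff) auto

context elliptic_form
begin

text \<open>Instantiates the abstract estimate with the hat functions of the interior vertices as \<open>\<psi>\<close>. Two facts
  have to be supplied: the kernel of the quasi-interpolation is the orthogonal complement of the hat
  functions, as they are linearly independent and have nonzero mean; and this kernel is complete in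
  the energy, where the approximation property takes the place of a Friedrichs inequality.\<close>
theorem eigenvalue_error:
  assumes dom: "polyhedral_lipschitz_domain \<Omega>" and mesh: "simplicial_mesh \<Omega> \<T>"
    and approx: "\<And>v. v \<in> H10 \<Omega> \<Longrightarrow> \<exists>c. l2norm M (\<lambda>x. v x - lincomb (interior_vertices \<Omega> \<T>) c (hat_function \<T>) x) \<le> B * l2norm M (wg v)"
    and B: "0 \<le> B" and Vh: "closed_subspace_H10 \<Omega> Vh" "P1_space \<Omega> \<T> \<subseteq> Vh"
    and ev: "lists_eigenvalues \<Omega> A Vh ev" and EV: "lists_eigenvalues \<Omega> A (coarse_space \<Omega> A \<T> Vh) EV"
    and l: "l \<in> {1..card (interior_vertices \<Omega> \<T>)}" and small: "2 * (B\<^sup>2 / \<alpha>)\<^sup>2 * (ev l)\<^sup>2 \<le> 1 / 2"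
  shows "EV l - ev l \<le> 4 * (B\<^sup>2 / \<alpha>)\<^sup>2 * (ev l)\<^sup>2 * ev l"
proof -
  interpret triangulated \<T> using mesh by unfold_locales (auto simp: simplicial_mesh_def)
  have lip: "lipschitz_boundary \<Omega>" using dom by (simp add: polyhedral_lipschitz_domain_def)
  let ?Z = "interior_vertices \<Omega> \<T>" and ?h = "hat_function \<T>" and ?F = "fine_space \<Omega> \<T> Vh"
  have fin: "finite ?Z" using finite_mesh_vertices by (simp add: interior_vertices_def)
  have VhV: "Vh \<subseteq> H10 \<Omega>" and Vhl: "lin_closed Vh"
    using Vh(1) by (auto simp: closed_subspace_H10_def lin_closed_def)
  have P1l: "lin_closed (P1_space \<Omega> \<T>)" by (rule P1_space_lin_closed[OF H10_lin_closed])
  have hc: "continuous_on UNIV (?h z)" if "z \<in> ?Z" for z by (rule hat_H10_pair(2)[OF op bd lip mesh that])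
  have hP1: "?h z \<in> P1_space \<Omega> \<T>" if z: "z \<in> ?Z" for z
    unfolding P1_space_def
  proof (intro CollectI conjI ballI)
    show "?h z \<in> H10 \<Omega>" using hat_H10_pair(1)[OF op bd lip mesh z] H10_pair_imp_H10(1)[OF op bd] by blast
    fix T assume T: "T \<in> \<T>"
    obtain p q where "\<And>x. x \<in> T \<Longrightarrow> ?h z x = p \<bullet> x + q" using hat_function_props(1)[OF T] by blast
    then have "AE x in lebesgue_on T. ?h z x = p \<bullet> x + q"
      using cell_compact_convex(3)[OF T] by (intro AE_lebesgue_on_self) auto
    then show "\<exists>p q. AE x in lebesgue_on T. ?h z x = p \<bullet> x + q" by blast
  qed
  have hVh: "?h z \<in> Vh" if "z \<in> ?Z" for z using hP1[OF that] Vh(2) by blast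
  have hV: "?h z \<in> H10 \<Omega>" if "z \<in> ?Z" for z using hVh[OF that] VhV by blast
  have hval: "?h z y = (if y = z then 1 else 0)" if "y \<in> ?Z" for z y
    using that hat_function_props(2)[of y z] by (simp add: interior_vertices_def)
  have indep: "\<forall>z\<in>?Z. c z = 0" if ae: "AE x in M. lincomb ?Z c ?h x = 0" for c
  proof
    fix z assume z: "z \<in> ?Z"
    have "continuous_on UNIV (lincomb ?Z c ?h)" unfolding lincomb_def by (intro continuous_intros hc)
    then have "lincomb ?Z c ?h z = 0"
      by (rule continuous_AE_zero_imp_zero[OF op _ ae]) (use z in \<open>simp add: interior_vertices_def\<close>)
    moreover have "lincomb ?Z c ?h z = (\<Sum>y\<in>?Z. if y = z then c y else 0)"
      unfolding lincomb_def by (rule sum.cong) (use hval[OF z] in auto)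
    ultimately show "c z = 0" using z fin by simp
  qed
  have mass: "L2_inner \<Omega> (\<lambda>_. 1) (?h z) \<noteq> 0" if z: "z \<in> ?Z" for z
  proof
    assume "L2_inner \<Omega> (\<lambda>_. 1) (?h z) = 0"
    then have "(LINT x|M. ?h z x) = 0" by (simp add: L2_inner_def)
    moreover have "integrable M (?h z)"
      by (rule square_integrable_imp_integrable[OF finite_measure_domain[OF op bd] H10_square_integrable(1)[OF hV[OF z]]])
    ultimately have "AE x in M. ?h z x = 0"
      using integral_nonneg_eq_0_iff_AE[of M "?h z"] hat_nonneg[of z] by simp
    then have "?h z z = 0"
      by (rule continuous_AE_zero_imp_zero[OF op hc[OF z]]) (use z in \<open>simp add: interior_vertices_def\<close>)
    then show False using hval[OF z] by simp
  qed
  have F_eq: "?F = {v\<in>Vh. \<forall>z\<in>?Z. L2_inner \<Omega> v (?h z) = 0}"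
  proof -
    have "(AE x in M. quasi_interpolation \<Omega> \<T> v x = 0) \<longleftrightarrow> (\<forall>z\<in>?Z. L2_inner \<Omega> v (?h z) = 0)" for v
    proof
      have eq: "quasi_interpolation \<Omega> \<T> v = lincomb ?Z (\<lambda>z. L2_inner \<Omega> v (?h z) / L2_inner \<Omega> (\<lambda>_. 1) (?h z)) ?h"
        by (simp add: quasi_interpolation_def lincomb_def)
      show "\<forall>z\<in>?Z. L2_inner \<Omega> v (?h z) = 0" if "AE x in M. quasi_interpolation \<Omega> \<T> v x = 0"
        using indep[OF that[unfolded eq]] mass by simp
      show "AE x in M. quasi_interpolation \<Omega> \<T> v x = 0" if "\<forall>z\<in>?Z. L2_inner \<Omega> v (?h z) = 0"
        unfolding eq lincomb_def using that by simp
    qed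
    then show ?thesis by (simp add: fine_space_def)
  qed
  have lcV: "lincomb ?Z c ?h \<in> H10 \<Omega>" for c by (rule L.V_lincomb[OF fin]) (rule hV)
  define \<kappa> where "\<kappa> = B\<^sup>2 / \<alpha>"
  have \<kappa>: "0 \<le> \<kappa>" using alpha_pos by (simp add: \<kappa>_def)
  have app: "\<exists>c. L2_inner \<Omega> (\<lambda>x. v x - lincomb ?Z c ?h x) (\<lambda>x. v x - lincomb ?Z c ?h x) \<le> \<kappa> * energy \<Omega> A v v"
    if v: "v \<in> H10 \<Omega>" for v
  proof -
    obtain c where c: "l2norm M (\<lambda>x. v x - lincomb ?Z c ?h x) \<le> B * l2norm M (wg v)" using approx[OF v] by blast
    have "L2_inner \<Omega> (\<lambda>x. v x - lincomb ?Z c ?h x) (\<lambda>x. v x - lincomb ?Z c ?h x) \<le> (B * l2norm M (wg v))\<^sup>2"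
      unfolding L2_inner_square by (rule power_mono[OF c]) simp
    also have "\<dots> = \<kappa> * (\<alpha> * (l2norm M (wg v))\<^sup>2)" using alpha_pos by (simp add: \<kappa>_def power_mult_distrib)
    also have "\<dots> \<le> \<kappa> * energy \<Omega> A v v" by (rule mult_left_mono[OF energy_coercive[OF v] \<kappa>])
    finally show ?thesis by blast
  qed
  have Fl: "lin_closed ?F"
    unfolding lin_closed_def F_eq using lin_closedD[OF Vhl] VhV hV
    by (auto simp: subset_iff L.add_left L.scale_left) (simp add: L2_inner_def)
  have poinc: "L2_inner \<Omega> f f \<le> \<kappa> * energy \<Omega> A f f" if f: "f \<in> ?F" for f
  proof -
    have fV: "f \<in> H10 \<Omega>" using f VhV by (auto simp: F_eq)
    obtain c where c: "L2_inner \<Omega> (\<lambda>x. f x - lincomb ?Z c ?h x) (\<lambda>x. f x - lincomb ?Z c ?h x) \<le> \<kappa> * energy \<Omega> A f f"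
      using app[OF fV] by blast
    have "L2_inner \<Omega> f (lincomb ?Z c ?h) = 0"
      using f fV by (subst L.lincomb_right[OF fin hV]) (auto simp: F_eq)
    then show ?thesis using c L.diff_square[OF fV lcV, of c] L.nonneg[OF lcV, of c] by simp
  qed
  have complete: "\<exists>w\<in>?F. (\<lambda>k. energy \<Omega> A (\<lambda>x. s k x - w x) (\<lambda>x. s k x - w x)) \<longlonglongrightarrow> 0"
    if s: "\<And>k. s k \<in> ?F"
      and cau: "\<And>k. energy \<Omega> A (\<lambda>x. s (Suc k) x - s k x) (\<lambda>x. s (Suc k) x - s k x) \<le> ((1/2)^k)\<^sup>2" for s
  proof -
    have sVh: "s k \<in> Vh" for k using s[of k] by (simp add: F_eq)
    have sV: "s k \<in> H10 \<Omega>" for k using sVh VhV by blast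
    have dF: "(\<lambda>x. s (Suc k) x - s k x) \<in> ?F" for k by (rule lin_closed_diff[OF Fl s s])
    have dV: "(\<lambda>x. s (Suc k) x - s k x) \<in> H10 \<Omega>" for k by (rule L.V_diff[OF sV sV])
    note fm = finite_measure_domain[OF op bd]
    have "l2norm M (\<lambda>x. s (Suc k) x - s k x) \<le> sqrt \<kappa> * (1/2)^k" for k
    proof (rule power2_le_imp_le)
      have "(l2norm M (\<lambda>x. s (Suc k) x - s k x))\<^sup>2 \<le> \<kappa> * energy \<Omega> A (\<lambda>x. s (Suc k) x - s k x) (\<lambda>x. s (Suc k) x - s k x)"
        using poinc[OF dF[of k]] by (simp add: L2_inner_square)
      also have "\<dots> \<le> \<kappa> * ((1/2)^k)\<^sup>2" by (rule mult_left_mono[OF cau \<kappa>])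
      finally show "(l2norm M (\<lambda>x. s (Suc k) x - s k x))\<^sup>2 \<le> (sqrt \<kappa> * (1/2)^k)\<^sup>2" using \<kappa> by (simp add: power_mult_distrib)
    qed (use \<kappa> in simp)
    from l2_complete[OF fm H10_square_integrable(1)[OF sV] this] obtain w where w: "square_integrable M w"
      and wl: "(\<lambda>k. l2norm M (\<lambda>x. s k x - w x)) \<longlonglongrightarrow> 0" by blast
    have "l2norm M (\<lambda>x. wg (s (Suc k)) x - wg (s k) x) \<le> (1 / sqrt \<alpha>) * (1/2)^k" for k
    proof (rule power2_le_imp_le)
      have "\<alpha> * (l2norm M (\<lambda>x. wg (s (Suc k)) x - wg (s k) x))\<^sup>2 \<le> ((1/2)^k)\<^sup>2"
        using order_trans[OF energy_coercive[OF dV] cau, of k] by (simp add: l2norm_wg_diff[OF sV sV])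
      then show "(l2norm M (\<lambda>x. wg (s (Suc k)) x - wg (s k) x))\<^sup>2 \<le> ((1 / sqrt \<alpha>) * (1/2)^k)\<^sup>2"
        using alpha_pos by (simp add: power_mult_distrib power_divide field_simps)
    qed (use alpha_pos in simp)
    from l2_complete[OF fm H10_square_integrable(2)[OF sV] this] obtain g where g: "square_integrable M g"
      and gl: "(\<lambda>k. l2norm M (\<lambda>x. wg (s k) x - g x)) \<longlonglongrightarrow> 0" by blast
    have p: "H10_pair \<Omega> w g" by (rule H10_pair_limit[OF op H10_weak_gradient_pair[OF sV] w g wl gl])
    note wH = H10_pair_imp_H10[OF op bd p]
    have "H1_tendsto \<Omega> s w"
      using H1_norm_tendsto_iff[where u = s and f = "\<lambda>k. wg (s k)", OF op bd H10_weak_gradient_pair[OF sV] w g H10_pair_is_weak_gradient[OF op p]] wl gl by blast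
    then have wVh: "w \<in> Vh" using Vh(1) wH(1) sVh unfolding closed_subspace_H10_def by blast
    have "L2_inner \<Omega> w (?h z) = 0" if z: "z \<in> ?Z" for z
    proof -
      have "(\<lambda>k. LINT x|M. s k x \<bullet> ?h z x) \<longlonglongrightarrow> (LINT x|M. w x \<bullet> ?h z x)"
        by (rule l2_inner_tendsto[OF H10_square_integrable(1)[OF sV] w H10_square_integrable(1)[OF hV[OF z]] wl])
      moreover have "(LINT x|M. s k x \<bullet> ?h z x) = 0" for k using s[of k] z by (simp add: F_eq L2_inner_def)
      ultimately show ?thesis by (simp add: L2_inner_def LIMSEQ_const_iff)
    qed
    then have wF: "w \<in> ?F" using wVh by (simp add: F_eq)
    obtain K where K: "\<And>v. v \<in> H10 \<Omega> \<Longrightarrow> energy \<Omega> A v v \<le> K * (l2norm M (wg v))\<^sup>2" using energy_bound by blast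
    have "(\<lambda>k. energy \<Omega> A (\<lambda>x. s k x - w x) (\<lambda>x. s k x - w x)) \<longlonglongrightarrow> 0"
    proof (rule tendsto_sandwich[OF _ _ tendsto_const])
      show "\<forall>\<^sub>F k in sequentially. 0 \<le> energy \<Omega> A (\<lambda>x. s k x - w x) (\<lambda>x. s k x - w x)"
        by (intro always_eventually allI E.nonneg E.V_diff sV wH(1))
      show "\<forall>\<^sub>F k in sequentially. energy \<Omega> A (\<lambda>x. s k x - w x) (\<lambda>x. s k x - w x) \<le> K * (l2norm M (\<lambda>x. wg (s k) x - g x))\<^sup>2"
      proof (intro always_eventually allI)
        fix k
        have "l2norm M (wg (\<lambda>x. s k x - w x)) = l2norm M (\<lambda>x. wg (s k) x - wg w x)" by (rule l2norm_wg_diff[OF sV wH(1)])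
        also have "\<dots> = l2norm M (\<lambda>x. wg (s k) x - g x)"
        proof (rule l2norm_cong_AE)
          show "AE x in M. wg (s k) x - wg w x = wg (s k) x - g x" using wH(2) by eventually_elim simp
        qed (use H10_square_integrable(2)[OF sV[of k]] wH(3) g in \<open>auto simp: square_integrable_def\<close>)
        finally show "energy \<Omega> A (\<lambda>x. s k x - w x) (\<lambda>x. s k x - w x) \<le> K * (l2norm M (\<lambda>x. wg (s k) x - g x))\<^sup>2"
          using K[OF E.V_diff[OF sV wH(1)], of k] by simp
      qed
      show "(\<lambda>k. K * (l2norm M (\<lambda>x. wg (s k) x - g x))\<^sup>2) \<longlonglongrightarrow> 0"
        using tendsto_mult[OF tendsto_const tendsto_power[OF gl, of 2], of K] by simp
    qed
    then show ?thesis using wF by blast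
  qed
  let ?Vc = "coarse_space \<Omega> A \<T> Vh"
  have Vc: "?Vc = {(\<lambda>x. v x - w x) | v w. v \<in> P1_space \<Omega> \<T> \<and> w \<in> ?F \<and> (\<forall>w'\<in>?F. energy \<Omega> A w w' = energy \<Omega> A v w')}"
    unfolding coarse_space_def is_energy_projection_def ..
  have "?Vc \<subseteq> H10 \<Omega>"
  proof
    fix y assume "y \<in> ?Vc"
    then obtain v w where "y = (\<lambda>x. v x - w x)" "v \<in> P1_space \<Omega> \<T>" "w \<in> ?F" unfolding Vc by blast
    moreover have "?F \<subseteq> Vh" by (auto simp: F_eq)
    ultimately show "y \<in> H10 \<Omega>" using L.V_diff[of v w] Vh(2) VhV by blast
  qed
  then have EV': "lists_eigs ?Vc EV" using EV lists_eigenvalues_iff by blast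
  have ev': "lists_eigs Vh ev" using ev lists_eigenvalues_iff[OF VhV] by blast
  have lcP1: "lincomb ?Z c ?h \<in> P1_space \<Omega> \<T>" for c by (rule lin_closed_lincomb[OF P1l fin hP1])
  have ind': "\<forall>z\<in>?Z. c z = 0" if "L2_inner \<Omega> (lincomb ?Z c ?h) (lincomb ?Z c ?h) = 0" for c
    using that L2_inner_null_iff[OF lcV] indep by blast
  have app': "\<exists>c. L2_inner \<Omega> (\<lambda>x. v x - lincomb ?Z c ?h x) (\<lambda>x. v x - lincomb ?Z c ?h x) \<le> \<kappa> * energy \<Omega> A v v"
    if "v \<in> Vh" for v using app that VhV by blast
  show ?thesis
    using two_level_eigenvalue_bound[OF Vhl VhV P1l Vh(2) fin lcP1 hVh ind' F_eq app' \<kappa> complete Vc ev' EV' l small[folded \<kappa>_def]]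
    unfolding \<kappa>_def .
qed

end

text \<open>With \<open>K\<close> the constant of the quasi-interpolation estimate, the approximation property holds with
  \<open>\<kappa> = (K * H)\<^sup>2 / \<alpha>\<close>. The condition on \<open>H\<close> with \<open>c = 1 / (2 * K)\<close> gives \<open>\<kappa> * lam_h l \<le> 1 / 4\<close>, which makes
  the squared norms of the trial functions stay away from zero.\<close>
theorem theorem5p2:
  fixes \<Omega> :: "(real^'n) set" and \<gamma> :: real
  assumes "polyhedral_lipschitz_domain \<Omega>"
  shows "\<exists>c>0. \<exists>C>0.
    \<forall>(A :: real^'n \<Rightarrow> real^'n^'n) (\<alpha>::real) (\<beta>::real) (\<T> :: (real^'n) set set)
      (Vh :: (real^'n \<Rightarrow> real) set) (lam_h :: nat \<Rightarrow> real) (lam_H :: nat \<Rightarrow> real).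
      admissible_coefficient \<Omega> \<alpha> \<beta> A \<and>
      simplicial_mesh \<Omega> \<T> \<and> shape_parameter \<T> = \<gamma> \<and>
      closed_subspace_H10 \<Omega> Vh \<and> P1_space \<Omega> \<T> \<subset> Vh \<and>
      lists_eigenvalues \<Omega> A Vh lam_h \<and>
      lists_eigenvalues \<Omega> A (coarse_space \<Omega> A \<T> Vh) lam_H \<longrightarrow>
      (\<forall>l\<in>{1..card (interior_vertices \<Omega> \<T>)}.
         mesh_size \<T> \<le> c * real l powr (-1/4) * sqrt (\<alpha> / lam_h l) \<longrightarrow>
         (lam_H l - lam_h l) / lam_h l \<le> C * real l * (lam_h l / \<alpha>)\<^sup>2 * mesh_size \<T> ^ 4)"
proof -
  have O: "open \<Omega>" "bounded \<Omega>" "\<Omega> \<noteq> {}" using assms by (auto simp: polyhedral_lipschitz_domain_def)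
  obtain K where K: "K > 0" and approx: "\<And>\<T> v g. simplicial_mesh \<Omega> \<T> \<Longrightarrow> H10_pair \<Omega> v g \<Longrightarrow>
    (\<exists>c. l2norm (lebesgue_on \<Omega>) (\<lambda>x. v x - lincomb (interior_vertices \<Omega> \<T>) c (hat_function \<T>) x)
      \<le> K * mesh_size \<T> * l2norm (lebesgue_on \<Omega>) g)"
    using uniform_interpolation_error[OF assms] by blast
  have pos: "0 < 1 / (2 * K)" "0 < 4 * K ^ 4" using K by simp_all
  show ?thesis
  proof (rule exI[of _ "1 / (2 * K)"], rule conjI[OF pos(1)], rule exI[of _ "4 * K ^ 4"],
      rule conjI[OF pos(2)], intro allI impI ballI)
    fix A :: "real^'n \<Rightarrow> real^'n^'n" and \<alpha> \<beta> :: real and \<T> and Vh :: "(real^'n \<Rightarrow> real) set"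
      and lam_h lam_H :: "nat \<Rightarrow> real" and l
    assume *: "admissible_coefficient \<Omega> \<alpha> \<beta> A \<and>
      simplicial_mesh \<Omega> \<T> \<and> shape_parameter \<T> = \<gamma> \<and>
      closed_subspace_H10 \<Omega> Vh \<and> P1_space \<Omega> \<T> \<subset> Vh \<and>
      lists_eigenvalues \<Omega> A Vh lam_h \<and>
      lists_eigenvalues \<Omega> A (coarse_space \<Omega> A \<T> Vh) lam_H"
    and l: "l \<in> {1..card (interior_vertices \<Omega> \<T>)}"
    and Hle: "mesh_size \<T> \<le> 1 / (2 * K) * real l powr (-1/4) * sqrt (\<alpha> / lam_h l)"
    interpret elliptic_form \<Omega> A \<alpha> \<beta> by unfold_locales (use O * in auto)
    let ?H = "mesh_size \<T>" and ?lam = "lam_h l"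
    have mesh: "simplicial_mesh \<Omega> \<T>" using * by simp
    have H: "?H > 0" by (rule mesh_size_bounds[OF O(3,2) mesh])
    have l1: "real l \<ge> 1" using l by simp
    have pw: "0 < real l powr (-1/4)" "real l powr (-1/4) \<le> 1"
      using l1 powr_mono[of "-1/4" 0 "real l"] by simp_all
    \<comment> \<open>Division by zero gives zero and \<open>sqrt\<close> is an odd function, so for \<open>lam_h l \<le> 0\<close> the bound assumed for
      the mesh size would not be positive.\<close>
    have lam: "?lam > 0"
    proof (rule ccontr)
      assume "\<not> ?lam > 0"
      then have "sqrt (\<alpha> / ?lam) \<le> 0" using alpha_pos by (simp add: divide_le_0_iff)
      then have "1 / (2 * K) * real l powr (-1/4) * sqrt (\<alpha> / ?lam) \<le> 0"
        using K pw by (intro mult_nonneg_nonpos) auto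
      then show False using Hle H by linarith
    qed
    have s0: "0 < sqrt (\<alpha> / ?lam)" using lam alpha_pos by simp
    have "1 / (2 * K) * real l powr (-1/4) * sqrt (\<alpha> / ?lam) \<le> 1 / (2 * K) * 1 * sqrt (\<alpha> / ?lam)"
      using K pw s0 by (intro mult_right_mono mult_left_mono) auto
    then have "K * ?H \<le> K * (1 / (2 * K) * 1 * sqrt (\<alpha> / ?lam))" using K Hle by (intro mult_left_mono) auto
    then have KH: "K * ?H \<le> sqrt (\<alpha> / ?lam) / 2" using K by simp
    have "(K * ?H)\<^sup>2 \<le> (sqrt (\<alpha> / ?lam) / 2)\<^sup>2" using KH K H by (intro power_mono) auto
    also have "\<dots> = \<alpha> / ?lam / 4" using lam alpha_pos by (simp add: power_divide)
    finally have "(K * ?H)\<^sup>2 / \<alpha> * ?lam \<le> 1 / 4" using lam alpha_pos by (simp add: field_simps)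
    then have "((K * ?H)\<^sup>2 / \<alpha> * ?lam)\<^sup>2 \<le> (1 / 4)\<^sup>2" using lam alpha_pos by (intro power_mono) auto
    then have "((K * ?H)\<^sup>2 / \<alpha>)\<^sup>2 * ?lam\<^sup>2 \<le> 1 / 16"
      unfolding power_mult_distrib[of "(K * ?H)\<^sup>2 / \<alpha>" ?lam] by (simp only: power_one_over) simp
    then have small: "2 * ((K * ?H)\<^sup>2 / \<alpha>)\<^sup>2 * ?lam\<^sup>2 \<le> 1 / 2" by linarith
    have "lam_H l - ?lam \<le> 4 * ((K * ?H)\<^sup>2 / \<alpha>)\<^sup>2 * ?lam\<^sup>2 * ?lam"
    proof (rule eigenvalue_error[where ev = lam_h and EV = lam_H and Vh = Vh and \<T> = \<T> and B = "K * ?H" and l = l])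
      show "\<exists>c. l2norm (lebesgue_on \<Omega>) (\<lambda>x. v x - lincomb (interior_vertices \<Omega> \<T>) c (hat_function \<T>) x)
          \<le> K * ?H * l2norm (lebesgue_on \<Omega>) (weak_gradient \<Omega> v)" if "v \<in> H10 \<Omega>" for v
        by (rule approx[OF mesh H10_weak_gradient_pair[OF that]])
      show "0 \<le> K * ?H" using K H by simp
    qed (use * assms l small in auto)
    then have "(lam_H l - ?lam) / ?lam \<le> 4 * ((K * ?H)\<^sup>2 / \<alpha>)\<^sup>2 * ?lam\<^sup>2"
      using lam by (simp add: pos_divide_le_eq)
    also have "\<dots> = 4 * K ^ 4 * 1 * (?lam / \<alpha>)\<^sup>2 * ?H ^ 4"
      by (simp add: power_divide power_mult_distrib flip: power_mult)
    also have "\<dots> \<le> 4 * K ^ 4 * real l * (?lam / \<alpha>)\<^sup>2 * ?H ^ 4"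
      using l1 K H by (intro mult_right_mono mult_left_mono) auto
    finally show "(lam_H l - ?lam) / ?lam \<le> 4 * K ^ 4 * real l * (?lam / \<alpha>)\<^sup>2 * ?H ^ 4" .
  qed
qed

end
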